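(* Let $d,k,n,\beta_0,\beta_1,\dots,\beta_k,\gamma_0,\gamma_1,\dots,\gamma_k$ be non-negative integers with $d\ge2$, $\beta_0+\beta_1+\dots+\beta_k=d+1$ and $\gamma_0+\gamma_1+\dots+\gamma_k=n+d$, and put $s=-d+\sum_{j=0}^k\gamma_j$. Consider rooted $d$-dimensional Fu\ss--Catalan complexes $(\Sigma,\Delta_* )$ of index $n$, each endowed with its uniquely determined vertex colouring by colours $c'_0,\dots,c'_k$ in which the first $\beta_0-1$ vertices of $\Delta_*$ have colour $c'_0$, the next $\beta_1$ vertices have colour $c'_1$, the next $\beta_2$ have colour $c'_2$, $\dots$, the last $\beta_k$ vertices have colour $c'_k$, and in which every $d$-dimensional simplex has exactly $\beta_i$ vertices of colour $c'_i$ for each $i=0,\dots,k$. Then the number of such complexes with exactly $\gamma_i$ vertices of colour $c'_i$ for each $i=0,1,\dots,k$ equals $$s^{k-1}\,\frac{\gamma_0-\beta_0+1}{\beta_0s+\beta_0-\gamma_0}\binom{\beta_0s+\beta_0-\gamma_0}{\gamma_0-\beta_0+1}\prod_{j=1}^{k}\frac{\beta_j}{\beta_js+\beta_j-\gamma_j}\binom{\beta_js+\beta_j-\gamma_j}{\gamma_j-\beta_j}.$$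
   Context: Let $d\ge2$. A $d$-dimensional Fu\ss--Catalan complex of index $n\ge1$ is a simplicial complex $\Sigma$ such that (i) $\Sigma$ is a $d$-dimensional simplicial complex homeomorphic to a closed $d$-dimensional ball and having exactly $n$ simplices of maximal dimension $d$; (ii) every simplex of $\Sigma$ of dimension at most $d-2$ is contained in the boundary $\partial\Sigma$. It is rooted if a $(d-1)$-simplex $\Delta_*$ of $\partial\Sigma$ is marked and its vertices are totally ordered; written $(\Sigma,\Delta_* )$. By convention the unique rooted complex of index $0$ is $(\Delta_*,\Delta_* )$ for a $(d-1)$-simplex $\Delta_*$ with ordered vertices. Complexes are counted up to combinatorial isomorphism preserving the marked simplex and the order of its vertices. Every rooted such complex has a unique proper colouring (endpoints of each edge get different colours) by $d+1$ colours $c_0<c_1<\dots<c_d$ with the $i$-th vertex of $\Delta_*$ coloured $c_i$ ($i=1,\dots,d$). The colouring in the claim is obtained from it by identifying colours: $c_0,\dots,c_{\beta_0-1}$ become $c'_0$; $c_{\beta_0},\dots,c_{\beta_0+\beta_1-1}$ become $c'_1$; in general $c_{\beta_0+\dots+\beta_{i-1}},\dots,c_{\beta_0+\dots+\beta_i-1}$ become $c'_i$, for $i=0,\dots,k$.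
   Formalization: β_0≥1 is assumed: for β_0=0 "the first β_0-1 vertices" is meaningless and the formula fails (d=2, β=(0,3), γ=(1,3) gives -1, count 0). Where the formula has 0/0 (n=0, or β_j=γ_j=0 with j≥1) it is read by cancelling: value 1 or 0 at n=0, factor 1/s. *)

theory Defs
  imports "HOL-Analysis.Analysis"
begin

section \<open>Abstract simplicial complexes and their realizations\<close>

text \<open>
  Simplices are non-empty finite vertex sets, so a simplex of dimension \<open>p\<close> has \<open>p + 1\<close> elements.
  Only finite complexes are needed: a complex homeomorphic to a closed ball is compact.
\<close>

definition abstract_complex :: "'v set set \<Rightarrow> bool" where
  "abstract_complex K \<longleftrightarrow>
     finite K \<and> (\<forall>\<sigma>\<in>K. finite \<sigma> \<and> \<sigma> \<noteq> {}) \<and> (\<forall>\<sigma>\<in>K. \<forall>\<tau>. \<tau> \<noteq> {} \<and> \<tau> \<subseteq> \<sigma> \<longrightarrow> \<tau> \<in> K)"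

definition facets :: "nat \<Rightarrow> 'v set set \<Rightarrow> 'v set set" where
  "facets d K = {\<sigma>\<in>K. card \<sigma> = d + 1}"

text \<open>
  Points of the realization are given by barycentric coordinates. For a finite complex the
  topology of pointwise convergence is the usual (weak) topology.
\<close>

definition realization :: "'v set set \<Rightarrow> ('v \<Rightarrow> real) set" where
  "realization K =
     {x. (\<forall>v. 0 \<le> x v) \<and> {v. x v \<noteq> 0} \<in> K \<and> (\<Sum>v | x v \<noteq> 0. x v) = 1}"

definition realization_top :: "'v set set \<Rightarrow> ('v \<Rightarrow> real) topology" where
  "realization_top K = subtopology (powertop_real UNIV) (realization K)"

definition closed_simplex :: "'v set set \<Rightarrow> 'v set \<Rightarrow> ('v \<Rightarrow> real) set" where
  "closed_simplex K \<sigma> = {x \<in> realization K. {v. x v \<noteq> 0} \<subseteq> \<sigma>}"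

definition closed_ball_top :: "nat \<Rightarrow> (nat \<Rightarrow> real) topology" where
  "closed_ball_top d = subtopology (Euclidean_space d) {y. (\<Sum>i<d. (y i)\<^sup>2) \<le> 1}"

text \<open>
  The boundary of a complex homeomorphic to the closed \<open>d\<close>-ball: the points sent to the unit sphere.
  By invariance of domain it does not depend on the homeomorphism.
\<close>

definition ball_boundary :: "nat \<Rightarrow> 'v set set \<Rightarrow> ('v \<Rightarrow> real) set" where
  "ball_boundary d K =
     {x \<in> realization K.
        \<exists>h. homeomorphic_map (realization_top K) (closed_ball_top d) h \<and> (\<Sum>i<d. (h x i)\<^sup>2) = 1}"

section \<open>Rooted Fuss-Catalan complexes\<close>

definition fuss_catalan_complex :: "nat \<Rightarrow> nat \<Rightarrow> 'v set set \<Rightarrow> bool" where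
  "fuss_catalan_complex d n K \<longleftrightarrow>
     n \<ge> 1 \<and> abstract_complex K \<and> (\<forall>\<sigma>\<in>K. card \<sigma> \<le> d + 1) \<and> card (facets d K) = n \<and>
     realization_top K homeomorphic_space closed_ball_top d \<and>
     (\<forall>\<sigma>\<in>K. card \<sigma> \<le> d - 1 \<longrightarrow> closed_simplex K \<sigma> \<subseteq> ball_boundary d K)"

text \<open>
  The marked simplex is given by the list of its vertices in increasing order. The complex of
  index \<open>0\<close> is a single \<open>(d - 1)\<close>-simplex marked by itself.
\<close>

definition rooted_fuss_catalan :: "nat \<Rightarrow> nat \<Rightarrow> 'v set set \<Rightarrow> 'v list \<Rightarrow> bool" where
  "rooted_fuss_catalan d n K r \<longleftrightarrow>
     distinct r \<and> length r = d \<and>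
     (if n = 0 then K = {\<sigma>. \<sigma> \<noteq> {} \<and> \<sigma> \<subseteq> set r}
      else fuss_catalan_complex d n K \<and> set r \<in> K \<and>
           closed_simplex K (set r) \<subseteq> ball_boundary d K)"

definition rooted_iso :: "'v set set \<times> 'v list \<Rightarrow> 'v set set \<times> 'v list \<Rightarrow> bool" where
  "rooted_iso X Y \<longleftrightarrow>
     (\<exists>f. inj_on f (\<Union>(fst X)) \<and> (\<lambda>\<sigma>. f ` \<sigma>) ` fst X = fst Y \<and> map f (snd X) = snd Y)"

text \<open>
  Colour \<open>i\<close> stands for \<open>c'\<^sub>i\<close>. The value of \<open>c\<close> outside the vertex set is irrelevant.
\<close>

definition fc_colouring ::
  "nat \<Rightarrow> nat \<Rightarrow> (nat \<Rightarrow> nat) \<Rightarrow> 'v set set \<Rightarrow> 'v list \<Rightarrow> ('v \<Rightarrow> nat) \<Rightarrow> bool" where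
  "fc_colouring d k \<beta> K r c \<longleftrightarrow>
     (\<forall>v\<in>\<Union>K. c v \<le> k) \<and>
     map c r = replicate (\<beta> 0 - 1) 0 @ concat (map (\<lambda>i. replicate (\<beta> i) i) [1..<Suc k]) \<and>
     (\<forall>\<sigma>\<in>facets d K. \<forall>i\<le>k. card {v\<in>\<sigma>. c v = i} = \<beta> i)"

text \<open>Every complex considered is finite, so each isomorphism type occurs on vertices in \<open>nat\<close>.\<close>

definition coloured_rooted_fc ::
  "nat \<Rightarrow> nat \<Rightarrow> nat \<Rightarrow> (nat \<Rightarrow> nat) \<Rightarrow> (nat \<Rightarrow> nat) \<Rightarrow> (nat set set \<times> nat list) set" where
  "coloured_rooted_fc d k n \<beta> \<gamma> =
     {(K, r). rooted_fuss_catalan d n K r \<and>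
        (\<exists>c. fc_colouring d k \<beta> K r c \<and> (\<forall>i\<le>k. card {v\<in>\<Union>K. c v = i} = \<gamma> i))}"

definition iso_types :: "(nat set set \<times> nat list) set \<Rightarrow> (nat set set \<times> nat list) set set" where
  "iso_types S = S // {(X, Y). X \<in> S \<and> Y \<in> S \<and> rooted_iso X Y}"

section \<open>The counting formula\<close>

text \<open>The binomial coefficient with integer lower index, zero when that index is negative.\<close>

definition int_binom :: "real \<Rightarrow> int \<Rightarrow> real" where
  "int_binom x m = (if m < 0 then 0 else x gchoose (nat m))"

text \<open>
  For \<open>g = b\<close> the factor is \<open>b / (b * s)\<close>; the indeterminate case \<open>b = g = 0\<close> is read as \<open>1 / s\<close>,
  by cancelling \<open>b\<close>.
\<close>

definition fc_factor :: "real \<Rightarrow> nat \<Rightarrow> nat \<Rightarrow> real" where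
  "fc_factor s b g =
     (if b = 0 \<and> g = 0 then 1 / s
      else real b / (real b * s + real b - real g) *
           int_binom (real b * s + real b - real g) (int g - int b))"

text \<open>
  For \<open>s = 0\<close> (index \<open>0\<close>) the displayed expression contains quotients with denominator zero and is
  read by cancelling powers of \<open>s\<close>. If \<open>\<gamma> j = \<beta> j\<close> for all \<open>j \<ge> 1\<close>, then \<open>\<gamma> 0 - \<beta> 0 + 1 = s\<close> and
  the factors \<open>j \<ge> 1\<close> are \<open>1 / s\<close>, so that the value is \<open>s\<^sup>k\<^sup>-\<^sup>1 * s * s\<^sup>-\<^sup>k = 1\<close>; otherwise one of
  the binomial coefficients has negative lower index and the value is \<open>0\<close>.
\<close>

definition fc_formula :: "nat \<Rightarrow> (nat \<Rightarrow> nat) \<Rightarrow> (nat \<Rightarrow> nat) \<Rightarrow> real \<Rightarrow> real" where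
  "fc_formula k \<beta> \<gamma> s =
     (if s = 0 then (if \<gamma> 0 + 1 = \<beta> 0 \<and> (\<forall>j\<in>{1..k}. \<gamma> j = \<beta> j) then 1 else 0)
      else s powi (int k - 1) *
           ((real (\<gamma> 0) - real (\<beta> 0) + 1) / (real (\<beta> 0) * s + real (\<beta> 0) - real (\<gamma> 0))) *
           int_binom (real (\<beta> 0) * s + real (\<beta> 0) - real (\<gamma> 0)) (int (\<gamma> 0) - int (\<beta> 0) + 1) *
           (\<Prod>j=1..k. fc_factor s (\<beta> j) (\<gamma> j)))"

end

theory Submission
  imports Defs "HOL-Homology.Invariance_of_Domain"
begin

text \<open>
  A rooted Fuss-Catalan complex is the same as a finite \<open>d\<close>-ary tree of simplices. To glue a simplex
  onto a boundary wall is to apply a homeomorphism, so every tree gives a ball. Conversely, the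
  complement of the codimension two skeleton of a Fuss-Catalan complex is homeomorphic to a convex
  set, namely to a ball from which a part of its boundary sphere is removed. Connectedness and the
  existence of continuous logarithms on convex sets make the dual graph a tree; invariance of
  domain bounds the number of facets at a wall by two; and the convexity of small neighbourhoods of
  a boundary point makes the facets at a vertex a subtree, so that there are no further
  identifications.

  Coloured trees are counted through forests. Let \<open>T\<^sub>c\<close> be the generating function of the trees
  whose root wall misses the colour \<open>c\<close>. Then \<open>T\<^sub>c = 1 + y\<^sub>c T\<^sub>c\<^sup>-\<^sup>1 \<Prod>\<^sub>j T\<^sub>j\<^bsup>\<beta> j\<^esup>\<close>, and a closed form of Lagrange type for the
  coefficients of \<open>\<Prod>\<^sub>c T\<^sub>c\<^bsup>e c\<^esup>\<close> satisfies the resulting recurrence factor by factor.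
\<close>

section \<open>Trees with coloured nodes\<close>

text \<open>The homeomorphism with the ball is arbitrary, so nothing is known beforehand about the
  links of simplices. What does survive is strict convexity: a closed ball stays convex whichever
  points of its sphere are removed, and condition (ii) says exactly that the simplices of
  codimension at least two sit on the sphere. All statements about gluing are read off from this one
  convex set.

  On the counting side a single tree gives no closed recurrence, since removing its root leaves
  \<open>d\<close> trees whose root walls miss various colours. Lists of trees do, and their number
  depends only on how many of them miss each colour. With u_c = y_c \<Prod> T_j^(\<beta> j) the
  system becomes T_c = \<phi>(u_c) for one and the same series \<phi>. The Jacobian matrix in the
  Lagrange inversion is the identity minus a matrix of rank one, so its determinant is 1 minus a
  trace; this is the origin of the single subtracted sum in \<open>forest_number\<close>.\<close>

definition fc_child :: "nat list \<times> nat \<Rightarrow> nat \<Rightarrow> nat list \<times> nat" where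
  "fc_child s i = ((fst s)[i := snd s], fst s ! i)"

text \<open>A state holds the colours of the \<open>d\<close> ordered vertices of a wall and the
  colour of the apex that completes the wall to a facet. Words are read from the right: the head is
  the last step taken, so that the parent of \<open>i # q\<close> is its tail
  \<open>q\<close>.\<close>

primrec fc_state :: "nat list \<times> nat \<Rightarrow> nat list \<Rightarrow> nat list \<times> nat" where
  "fc_state s [] = s"
| "fc_state s (i # q) = fc_child (fc_state s q) i"

lemma fc_state_snoc: "fc_state s (q @ [i]) = fc_state (fc_child s i) q"
  by (induction q) auto

definition dtree :: "nat \<Rightarrow> nat list set \<Rightarrow> bool" where
  "dtree d T \<longleftrightarrow> finite T \<and> (\<forall>q\<in>T. set q \<subseteq> {..<d}) \<and> (\<forall>i q. i # q \<in> T \<longrightarrow> q \<in> T)"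

definition colour_count :: "nat list \<times> nat \<Rightarrow> nat list set \<Rightarrow> nat \<Rightarrow> nat" where
  "colour_count s T c = card {q \<in> T. snd (fc_state s q) = c}"

text \<open>The number of a branch is appended at the end, because the first step away from the root
  is the last letter of a word.\<close>

definition graft :: "nat list set list \<Rightarrow> nat list set" where
  "graft Us = insert [] {q @ [i] | q i. i < length Us \<and> q \<in> Us ! i}"

definition branches :: "nat \<Rightarrow> nat list set \<Rightarrow> nat list set list" where
  "branches d T = map (\<lambda>i. {q. q @ [i] \<in> T}) [0..<d]"

lemma graft_eq: "graft Us = insert [] (\<Union>i<length Us. (\<lambda>q. q @ [i]) ` (Us ! i))"
  by (auto simp: graft_def)

lemma branches_graft: "branches (length Us) (graft Us) = Us"
  by (rule nth_equalityI) (auto simp: branches_def graft_def)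

lemma dtree_empty [simp]: "dtree d {}"
  by (simp add: dtree_def)

lemma dtree_Nil_mem:
  assumes "dtree d T" "T \<noteq> {}" shows "[] \<in> T"
proof -
  have "q \<in> T \<Longrightarrow> [] \<in> T" for q
    by (induction q) (use assms(1) in \<open>unfold dtree_def, blast+\<close>)
  with assms show ?thesis by auto
qed

lemma graft_branches:
  assumes "dtree d T" "T \<noteq> {}" shows "graft (branches d T) = T"
proof (rule Set.set_eqI)
  fix q
  have "i < d" if "p @ [i] \<in> T" for p i using assms(1) that by (fastforce simp: dtree_def)
  then show "q \<in> graft (branches d T) \<longleftrightarrow> q \<in> T"
    using dtree_Nil_mem[OF assms] by (cases q rule: rev_cases) (auto simp: graft_def branches_def)
qed

lemma dtree_graft:
  assumes "length Us = d" "\<forall>U\<in>set Us. dtree d U" shows "dtree d (graft Us)"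
proof -
  have D: "dtree d (Us ! i)" if "i < d" for i using assms that by auto
  have "finite (graft Us)" using D by (simp add: graft_eq assms(1) dtree_def)
  moreover have "set q \<subseteq> {..<d}" if "q \<in> graft Us" for q
    using that D by (fastforce simp: graft_def assms(1) dtree_def)
  moreover have "q \<in> graft Us" if "i # q \<in> graft Us" for i q
    using that D by (cases q rule: rev_cases) (auto simp: graft_def assms(1) dtree_def)
  ultimately show ?thesis by (auto simp: dtree_def)
qed

lemma dtree_branches:
  assumes "dtree d T" "U \<in> set (branches d T)" shows "dtree d U"
proof -
  obtain i where i: "i < d" "U = {q. q @ [i] \<in> T}" using assms(2) by (auto simp: branches_def)
  have "(\<lambda>q. q @ [i]) ` U \<subseteq> T" using i by auto
  then have "finite U" using assms(1) by (meson dtree_def finite_imageD finite_subset inj_onI append_same_eq)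
  then show ?thesis using assms(1) i by (fastforce simp: dtree_def)
qed

lemma colour_count_graft:
  assumes "length Us = d" "\<forall>U\<in>set Us. dtree d U"
  shows "colour_count s (graft Us) c = (if snd s = c then 1 else 0) + (\<Sum>i<d. colour_count (fc_child s i) (Us ! i) c)"
proof -
  let ?A = "\<lambda>i. (\<lambda>q. q @ [i]) ` {q \<in> Us ! i. snd (fc_state (fc_child s i) q) = c}"
  have fin: "finite (Us ! i)" if "i < d" for i using assms that by (auto simp: dtree_def)
  have eq: "{q \<in> graft Us. snd (fc_state s q) = c} =
      (if snd s = c then {[]} else {}) \<union> (\<Union>i<d. ?A i)"
    by (auto simp: graft_eq assms(1) fc_state_snoc image_iff)
  have "card (\<Union>i<d. ?A i) = (\<Sum>i<d. card (?A i))"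
    by (rule card_UN_disjoint) (use fin in auto)
  also have "\<dots> = (\<Sum>i<d. colour_count (fc_child s i) (Us ! i) c)"
    by (intro sum.cong refl) (simp add: colour_count_def card_image inj_on_def)
  finally have 1: "card (\<Union>i<d. ?A i) = (\<Sum>i<d. colour_count (fc_child s i) (Us ! i) c)" .
  have "finite (\<Union>i<d. ?A i)" using fin by auto
  then show ?thesis
    unfolding colour_count_def eq using 1 by (subst card_Un_disjoint) (auto simp: colour_count_def)
qed

section \<open>Counting forests\<close>

definition forest_content :: "(nat list \<times> nat) list \<Rightarrow> nat list set list \<Rightarrow> nat \<Rightarrow> nat" where
  "forest_content L Ts c = (\<Sum>(s, T)\<leftarrow>zip L Ts. colour_count s T c)"

definition forests :: "nat \<Rightarrow> (nat list \<times> nat) list \<Rightarrow> (nat \<Rightarrow> nat) \<Rightarrow> nat list set list set" where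
  "forests d L g = {Ts. length Ts = length L \<and> (\<forall>T\<in>set Ts. dtree d T) \<and> forest_content L Ts = g}"

lemma forest_content_children:
  assumes "length Us = d"
  shows "forest_content (map (fc_child s) [0..<d]) Us c = (\<Sum>i<d. colour_count (fc_child s i) (Us ! i) c)"
proof -
  have "zip (map (fc_child s) [0..<d]) Us = map (\<lambda>i. (fc_child s i, Us ! i)) [0..<d]"
    by (rule nth_equalityI) (auto simp: assms)
  then show ?thesis
    by (simp add: forest_content_def interv_sum_list_conv_sum_set_nat atLeast0LessThan comp_def)
qed

lemma forest_content_append:
  "length Us = length L \<Longrightarrow> forest_content (L @ L') (Us @ Us') c = forest_content L Us c + forest_content L' Us' c"
  by (simp add: forest_content_def)

lemma forests_Nil: "forests d [] g = (if g = (\<lambda>_. 0) then {[]} else {})"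
  by (auto simp: forests_def forest_content_def)

lemma colour_count_empty [simp]: "colour_count s {} c = 0"
  by (simp add: colour_count_def)

text \<open>Either the first tree is empty, or its root, whose new vertex has colour
  \<open>snd s\<close>, is removed and its \<open>d\<close> branches join the list. The list may
  grow, but the content drops by one.\<close>

lemma forests_Cons:
  "forests d (s # L) g = (#) {} ` forests d L g \<union>
     (if 0 < g (snd s) then
        (\<lambda>Us. graft (take d Us) # drop d Us) `
          forests d (map (fc_child s) [0..<d] @ L) (g(snd s := g (snd s) - 1))
      else {})"  (is "?L = ?A \<union> ?B")
proof (intro Set.equalityI subsetI)
  fix Ts assume Ts: "Ts \<in> ?L"
  then obtain T Ts' where T: "Ts = T # Ts'" by (cases Ts) (auto simp: forests_def)
  have dT: "dtree d T" "\<forall>T\<in>set Ts'. dtree d T" and len: "length Ts' = length L" using Ts T by (auto simp: forests_def)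
  have g: "g c = colour_count s T c + forest_content L Ts' c" for c
    using Ts T by (auto simp: forests_def forest_content_def)
  show "Ts \<in> ?A \<union> ?B"
  proof (cases "T = {}")
    case True
    then show ?thesis using dT len g T by (auto simp: forests_def fun_eq_iff)
  next
    case False
    let ?Us = "branches d T"
    have b: "graft ?Us = T" "\<forall>U\<in>set ?Us. dtree d U" "length ?Us = d"
      using graft_branches[OF dT(1) False] dtree_branches[OF dT(1)] by (auto simp: branches_def)
    have c: "colour_count s T c = (if snd s = c then 1 else 0) + forest_content (map (fc_child s) [0..<d]) ?Us c" for c
      using colour_count_graft[OF b(3,2)] forest_content_children[OF b(3)] b(1) by simp
    have pos: "0 < g (snd s)" by (simp add: g c)
    have "?Us @ Ts' \<in> forests d (map (fc_child s) [0..<d] @ L) (g(snd s := g (snd s) - 1))"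
      using b dT len by (auto simp: forests_def fun_eq_iff forest_content_append g c)
    moreover have "Ts = (\<lambda>Us. graft (take d Us) # drop d Us) (?Us @ Ts')" using b T by simp
    ultimately have "Ts \<in> ?B" unfolding if_P[OF pos] by (rule rev_image_eqI)
    then show ?thesis ..
  qed
next
  fix Ts assume "Ts \<in> ?A \<union> ?B"
  then show "Ts \<in> ?L"
  proof
    assume "Ts \<in> ?A" then show ?thesis by (auto simp: forests_def forest_content_def fun_eq_iff)
  next
    assume "Ts \<in> ?B"
    then obtain Us where pos: "0 < g (snd s)" and Ts: "Ts = graft (take d Us) # drop d Us"
      and Us: "Us \<in> forests d (map (fc_child s) [0..<d] @ L) (g(snd s := g (snd s) - 1))"
      by (auto split: if_splits)
    have len: "length (take d Us) = d" "\<forall>U\<in>set (take d Us). dtree d U" "\<forall>U\<in>set (drop d Us). dtree d U"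
      "length (drop d Us) = length L"
      using Us by (auto simp: forests_def dest: in_set_takeD in_set_dropD)
    have split: "forest_content (map (fc_child s) [0..<d]) (take d Us) c + forest_content L (drop d Us) c = (g(snd s := g (snd s) - 1)) c" for c
      using forest_content_append[of "take d Us" "map (fc_child s) [0..<d]" L "drop d Us" c] len Us
      by (simp add: forests_def)
    have "colour_count s (graft (take d Us)) c + forest_content L (drop d Us) c = g c" for c
      using split[of c] colour_count_graft[OF len(1,2), of s c] forest_content_children[OF len(1), of s c] pos
      by (cases "c = snd s") (simp_all add: fun_upd_def split: if_splits)
    then show ?thesis
      unfolding Ts forests_def using len dtree_graft[OF len(1,2)] by (auto simp: forest_content_def fun_eq_iff)
  qed
qed

lemma inj_on_graft_forests:
  "inj_on (\<lambda>Us. graft (take d Us) # drop d Us) (forests d (map (fc_child s) [0..<d] @ L) g)"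
proof (rule inj_onI)
  fix Us Vs assume U: "Us \<in> forests d (map (fc_child s) [0..<d] @ L) g"
    and V: "Vs \<in> forests d (map (fc_child s) [0..<d] @ L) g"
    and eq: "graft (take d Us) # drop d Us = graft (take d Vs) # drop d Vs"
  have "length (take d Us) = d" "length (take d Vs) = d" using U V by (auto simp: forests_def)
  then have "take d Us = take d Vs"
    using branches_graft eq by (metis list.inject)
  with eq show "Us = Vs" by (metis append_take_drop_id list.inject)
qed

text \<open>The coefficient of \<open>u\<^sup>m\<close> in the \<open>x\<close>-th power of the series \<open>\<phi> = 1 + u / \<phi>\<close>, and the
  coefficient of \<open>u\<^sup>m\<close> in \<open>u \<phi>' \<phi>\<^sup>x\<^sup>-\<^sup>1\<close>.\<close>

definition pow_coeff :: "real \<Rightarrow> nat \<Rightarrow> real" where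
  "pow_coeff x m = (if m = 0 then 1 else ((x - m) gchoose m) + ((x - m - 1) gchoose (m - 1)))"

definition der_coeff :: "real \<Rightarrow> nat \<Rightarrow> real" where
  "der_coeff x m = (if m = 0 then 0 else (x - m - 1) gchoose (m - 1))"

section \<open>Recurrences for the coefficients of powers of \<phi>\<close>

lemma gchoose_Suc': "(x::real) gchoose Suc m = ((x - 1) gchoose m) + ((x - 1) gchoose Suc m)"
  using gbinomial_Suc_Suc[of "x - 1" m] by simp

text \<open>Multiply \<phi> = 1 + u / \<phi> by u \<phi>' \<phi>^(x-1) and compare coefficients of
  u^(m+1). For \<open>pow_coeff_rec\<close> the multiplier is \<phi>^x.\<close>

lemma der_coeff_rec: "der_coeff (x + 1) (Suc m) = der_coeff x (Suc m) + der_coeff (x - 1) m"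
proof (cases m)
  case (Suc l)
  then show ?thesis using gchoose_Suc'[of "x - l - 2" l]
    by (simp add: der_coeff_def algebra_simps)
qed (simp add: der_coeff_def)

lemma pow_coeff_rec: "pow_coeff (x + 1) (Suc m) = pow_coeff x (Suc m) + pow_coeff (x - 1) m"
proof (cases m)
  case (Suc l)
  then show ?thesis using gchoose_Suc'[of "x - l - 1" "Suc l"] gchoose_Suc'[of "x - l - 2" l]
    by (simp add: pow_coeff_def algebra_simps)
qed (simp add: pow_coeff_def)

text \<open>This is x u \<phi>' \<phi>^(x-1) = u (\<phi>^x)', coefficient by coefficient.\<close>

lemma der_coeff_mult: "x * der_coeff x m = m * pow_coeff x m"
proof (cases m)
  case (Suc l)
  have "(x - m) * ((x - m - 1) gchoose l) = Suc l * ((x - m) gchoose Suc l)"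
    using gbinomial_absorption[of l "x - m"] by (simp add: mult.commute)
  then show ?thesis by (simp add: pow_coeff_def der_coeff_def Suc algebra_simps)
qed (simp add: pow_coeff_def der_coeff_def)

text \<open>Lagrange inversion for u_c = y_c P with P = \<Prod> \<phi>(u_j)^(\<beta> j): the
  coefficient of y^g in \<Prod> \<phi>(u_c)^(e c) is that of u^g in P^n \<Prod> \<phi>(u_c)^(e c) (1
  - \<Sum> \<beta>_i u_i \<phi>'(u_i) / \<phi>(u_i)), where n is the sum of \<open>g\<close>. Hence
  the exponents \<open>e i + n * \<beta> i\<close>. That this value counts forests is verified
  through \<open>forest_number_rec\<close>.\<close>

definition forest_number :: "nat \<Rightarrow> (nat \<Rightarrow> nat) \<Rightarrow> (nat \<Rightarrow> nat) \<Rightarrow> (nat \<Rightarrow> nat) \<Rightarrow> real" where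
  "forest_number k \<beta> e g =
     (let a = (\<lambda>i. real (e i + (\<Sum>j\<le>k. g j) * \<beta> i)) in
        (\<Prod>j\<le>k. pow_coeff (a j) (g j)) -
        (\<Sum>i\<le>k. \<beta> i * der_coeff (a i) (g i) * (\<Prod>j\<in>{..k} - {i}. pow_coeff (a j) (g j))))"

text \<open>Isolates one colour \<open>c\<close>: with the other colours fixed, the expression is
  linear in \<open>pow_coeff\<close> and \<open>der_coeff\<close> at \<open>c\<close>. As these two
  obey the same three-term recurrence, so does the whole.\<close>

lemma forest_number_split:
  fixes c k :: nat
  assumes "c \<le> k"
  shows "\<exists>Q R. \<forall>a g. (\<forall>j\<in>{..k} - {c}. a j = a0 j \<and> g j = g0 j) \<longrightarrow>
     (\<Prod>j\<le>k. pow_coeff (a j) (g j)) -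
        (\<Sum>i\<le>k. \<beta> i * der_coeff (a i) (g i) * (\<Prod>j\<in>{..k} - {i}. pow_coeff (a j) (g j)))
     = pow_coeff (a c) (g c) * R - real (\<beta> c) * der_coeff (a c) (g c) * Q"
proof -
  let ?Q = "\<lambda>a g. \<Prod>j\<in>{..k} - {c}. pow_coeff (a j) (g j)"
  let ?R = "\<lambda>a g. \<Sum>i\<in>{..k} - {c}. \<beta> i * der_coeff (a i) (g i) * (\<Prod>j\<in>{..k} - {i} - {c}. pow_coeff (a j) (g j))"
  have c: "c \<in> {..k}" using assms by simp
  have "(\<Prod>j\<le>k. pow_coeff (a j) (g j)) -
        (\<Sum>i\<le>k. \<beta> i * der_coeff (a i) (g i) * (\<Prod>j\<in>{..k} - {i}. pow_coeff (a j) (g j)))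
     = pow_coeff (a c) (g c) * (?Q a0 g0 - ?R a0 g0) - real (\<beta> c) * der_coeff (a c) (g c) * ?Q a0 g0"
    if *: "\<forall>j\<in>{..k} - {c}. a j = a0 j \<and> g j = g0 j" for a g
  proof -
    have Q: "?Q a g = ?Q a0 g0" using * by (intro prod.cong) auto
    have R: "?R a g = ?R a0 g0" using * by (intro sum.cong arg_cong2[where f="(*)"] prod.cong) auto
    have "(\<Sum>i\<in>{..k} - {c}. \<beta> i * der_coeff (a i) (g i) * (\<Prod>j\<in>{..k} - {i}. pow_coeff (a j) (g j)))
       = pow_coeff (a c) (g c) * ?R a g"
      unfolding sum_distrib_left
    proof (rule sum.cong)
      fix i assume "i \<in> {..k} - {c}"
      then have "c \<in> {..k} - {i}" using c by auto
      then show "\<beta> i * der_coeff (a i) (g i) * (\<Prod>j\<in>{..k} - {i}. pow_coeff (a j) (g j)) =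
        pow_coeff (a c) (g c) * (\<beta> i * der_coeff (a i) (g i) * (\<Prod>j\<in>{..k} - {i} - {c}. pow_coeff (a j) (g j)))"
        by (subst prod.remove[of _ c]) auto
    qed simp
    moreover have "(\<Prod>j\<le>k. pow_coeff (a j) (g j)) = pow_coeff (a c) (g c) * ?Q a g"
      using c by (subst prod.remove[of _ c]) auto
    ultimately show ?thesis
      using c Q R by (subst sum.remove[of _ c]) (auto simp: algebra_simps)
  qed
  then show ?thesis by blast
qed

lemma forest_number_rec:
  assumes "c \<le> k" "1 \<le> \<beta> c"
  shows "forest_number k \<beta> (e(c := Suc (e c))) g = forest_number k \<beta> e g +
    (if 0 < g c then forest_number k \<beta> (\<lambda>i. e i + \<beta> i - (if i = c then 1 else 0)) (g(c := g c - 1)) else 0)"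
proof -
  let ?n = "\<Sum>j\<le>k. g j"
  define a where "a = (\<lambda>i. real (e i + ?n * \<beta> i))"
  let ?F = "\<lambda>a g. (\<Prod>j\<le>k. pow_coeff (a j) (g j)) -
        (\<Sum>i\<le>k. \<beta> i * der_coeff (a i) (g i) * (\<Prod>j\<in>{..k} - {i}. pow_coeff (a j) (g j)))"
  obtain Q R where QR: "\<And>a' g'. (\<forall>j\<in>{..k} - {c}. a' j = a j \<and> g' j = g j) \<Longrightarrow>
     ?F a' g' = pow_coeff (a' c) (g' c) * R - real (\<beta> c) * der_coeff (a' c) (g' c) * Q"
    using forest_number_split[OF assms(1), of a g \<beta>] by blast
  have 1: "forest_number k \<beta> e g = pow_coeff (a c) (g c) * R - real (\<beta> c) * der_coeff (a c) (g c) * Q"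
    unfolding forest_number_def Let_def using QR[of a g] by (simp add: a_def)
  have "forest_number k \<beta> (e(c := Suc (e c))) g = ?F (a(c := a c + 1)) g"
  proof -
    have "real ((e(c := Suc (e c))) i + ?n * \<beta> i) = (a(c := a c + 1)) i" for i by (auto simp: a_def)
    then show ?thesis unfolding forest_number_def Let_def by (simp only:)
  qed
  also have "\<dots> = pow_coeff (a c + 1) (g c) * R - real (\<beta> c) * der_coeff (a c + 1) (g c) * Q"
    using QR[of "a(c := a c + 1)" g] by simp
  finally have 2: "forest_number k \<beta> (e(c := Suc (e c))) g = \<dots>" .
  show ?thesis
  proof (cases "g c")
    case 0
    then show ?thesis using 1 2 by (simp add: pow_coeff_def der_coeff_def)
  next
    case (Suc m)
    have "(\<Sum>j\<le>k. g j) = g c + (\<Sum>j\<in>{..k} - {c}. g j)" using assms by (subst sum.remove[of _ c]) auto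
    moreover have "(\<Sum>j\<le>k. (g(c := m)) j) = m + (\<Sum>j\<in>{..k} - {c}. g j)"
      using assms by (subst sum.remove[of _ c]) auto
    ultimately have n: "?n = Suc (\<Sum>j\<le>k. (g(c := m)) j)" using Suc by simp
    \<comment> \<open>The total drops by one while every \<open>e i\<close> gains
      \<open>\<beta> i\<close>, so the exponents stay as they are, except that the one at
      \<open>c\<close> falls by one.\<close>
    have "real ((e i + \<beta> i - (if i = c then 1 else 0)) + (\<Sum>j\<le>k. (g(c := m)) j) * \<beta> i) = (a(c := a c - 1)) i" for i
      using assms unfolding a_def n by (auto simp: algebra_simps of_nat_diff)
    moreover have "g(c := g c - 1) = g(c := m)" using Suc by simp
    ultimately have "forest_number k \<beta> (\<lambda>i. e i + \<beta> i - (if i = c then 1 else 0)) (g(c := g c - 1)) = ?F (a(c := a c - 1)) (g(c := m))"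
      unfolding forest_number_def Let_def by (simp only:)
    also have "\<dots> = pow_coeff (a c - 1) m * R - real (\<beta> c) * der_coeff (a c - 1) m * Q"
      using QR[of "a(c := a c - 1)" "g(c := m)"] by simp
    finally show ?thesis using 1 2 Suc der_coeff_rec[of "a c" m] pow_coeff_rec[of "a c" m]
      by (simp add: algebra_simps)
  qed
qed

text \<open>Since \<open>e i = a i - n * \<beta> i\<close>, and
  \<open>a i * der_coeff (a i) (g i)\<close> equals \<open>g i * pow_coeff (a i) (g i)\<close>, the
  sum reassembles \<open>n\<close> times the forest number. The right-hand side is 0 for the empty
  list and a single product for one tree.\<close>

lemma forest_number_mult:
  fixes e g \<beta> :: "nat \<Rightarrow> nat" and k :: nat
  defines "n \<equiv> \<Sum>j\<le>k. g j"
  defines "a \<equiv> \<lambda>i. real (e i + n * \<beta> i)"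
  shows "n * forest_number k \<beta> e g =
    (\<Sum>i\<le>k. e i * der_coeff (a i) (g i) * (\<Prod>j\<in>{..k} - {i}. pow_coeff (a j) (g j)))"
proof -
  let ?P = "\<lambda>i. \<Prod>j\<in>{..k} - {i}. pow_coeff (a j) (g j)"
  have "(\<Sum>i\<le>k. e i * der_coeff (a i) (g i) * ?P i)
     = (\<Sum>i\<le>k. g i * (\<Prod>j\<le>k. pow_coeff (a j) (g j)) - n * (\<beta> i * der_coeff (a i) (g i) * ?P i))"
  proof (rule sum.cong)
    fix i assume i: "i \<in> {..k}"
    have "a i = e i + n * \<beta> i" by (simp add: a_def)
    then have "(e i + n * \<beta> i) * der_coeff (a i) (g i) = g i * pow_coeff (a i) (g i)"
      by (metis der_coeff_mult)
    then have "e i * der_coeff (a i) (g i) = g i * pow_coeff (a i) (g i) - n * (\<beta> i * der_coeff (a i) (g i))"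
      by (simp add: algebra_simps)
    then have "e i * der_coeff (a i) (g i) * ?P i = (g i * pow_coeff (a i) (g i) - n * (\<beta> i * der_coeff (a i) (g i))) * ?P i"
      by (simp only:)
    then have "e i * der_coeff (a i) (g i) * ?P i = g i * (pow_coeff (a i) (g i) * ?P i) - n * (\<beta> i * der_coeff (a i) (g i) * ?P i)"
      by (simp only: left_diff_distrib mult.assoc)
    then show "e i * der_coeff (a i) (g i) * ?P i = g i * (\<Prod>j\<le>k. pow_coeff (a j) (g j)) - n * (\<beta> i * der_coeff (a i) (g i) * ?P i)"
      using i by (simp add: prod.remove[of "{..k}" i])
  qed simp
  also have "\<dots> = n * forest_number k \<beta> e g"
    unfolding forest_number_def Let_def n_def[symmetric] a_def[symmetric]
    by (simp add: sum_subtractf sum_distrib_left[symmetric] sum_distrib_right[symmetric] n_def right_diff_distrib flip: of_nat_sum)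
  finally show ?thesis by simp
qed

section \<open>Colour states and the number of forests\<close>

definition good_state :: "nat \<Rightarrow> (nat \<Rightarrow> nat) \<Rightarrow> nat list \<times> nat \<Rightarrow> bool" where
  "good_state d \<beta> s \<longleftrightarrow> length (fst s) = d \<and> (\<forall>c. count_list (fst s) c + (if snd s = c then 1 else 0) = \<beta> c)"

lemma count_list_update:
  "i < length xs \<Longrightarrow> count_list (xs[i := x]) c + (if xs ! i = c then 1 else 0) = count_list xs c + (if x = c then 1 else 0)"
proof (induction xs arbitrary: i)
  case (Cons y xs)
  show ?case
  proof (cases i)
    case (Suc j)
    then show ?thesis using Cons.IH[of j] Cons.prems by (auto split: if_splits)
  qed simp
qed simp

lemma good_state_child:
  assumes "good_state d \<beta> s" "i < d" shows "good_state d \<beta> (fc_child s i)"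
  using assms count_list_update[of i "fst s" "snd s"] by (auto simp: good_state_def fc_child_def)

definition miss_count :: "(nat list \<times> nat) list \<Rightarrow> nat \<Rightarrow> nat" where
  "miss_count L c = count_list (map snd L) c"

text \<open>Child \<open>i\<close> misses the colour of the vertex that it replaces, so the colours
  missed by the children are those of the wall itself. This is the factor T_c^-1 \<Prod>
  T_j^(\<beta> j) of the functional equation.\<close>

lemma miss_count_children:
  assumes "good_state d \<beta> s"
  shows "miss_count (map (fc_child s) [0..<d]) c = \<beta> c - (if c = snd s then 1 else 0)"
proof -
  have "map snd (map (fc_child s) [0..<d]) = fst s"
    by (rule nth_equalityI) (use assms in \<open>auto simp: good_state_def fc_child_def\<close>)
  moreover have "count_list (fst s) c + (if snd s = c then 1 else 0) = \<beta> c"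
    using assms by (auto simp: good_state_def)
  ultimately show ?thesis by (auto simp: miss_count_def)
qed

text \<open>Two nested inductions: removing a root lowers the content but may lengthen the list,
  while dropping an empty tree keeps the content and shortens the list.\<close>

theorem card_forests:
  assumes "\<And>c. k < c \<Longrightarrow> \<beta> c = 0" "\<And>c. k < c \<Longrightarrow> g c = 0" "\<forall>s\<in>set L. good_state d \<beta> s"
  shows "finite (forests d L g) \<and> card (forests d L g) = forest_number k \<beta> (miss_count L) g"
  using assms(2,3)
proof (induction "\<Sum>c\<le>k. g c" arbitrary: g L rule: less_induct)
  case less
  note outer = less
  show ?case using outer(3)
  proof (induction L)
    case Nil
    show ?case
    proof (cases "g = (\<lambda>_. 0)")
      case True
      then show ?thesis by (simp add: forests_Nil forest_number_def Let_def miss_count_def pow_coeff_def der_coeff_def)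
    next
      case False
      then obtain c where "g c \<noteq> 0" by auto
      with outer(2) have "c \<le> k" "g c \<noteq> 0" by (meson leI)+
      then have "(\<Sum>j\<le>k. g j) \<noteq> 0" by auto
      then have "real (\<Sum>j\<le>k. g j) \<noteq> 0" by (simp only: of_nat_eq_0_iff not_False_eq_True)
      \<comment> \<open>Without trees all exponents \<open>e\<close> are 0, so every summand of
        \<open>forest_number_mult\<close> vanishes.\<close>
      moreover have "(\<Sum>j\<le>k. g j) * forest_number k \<beta> (miss_count []) g = 0"
        by (subst forest_number_mult) (simp add: miss_count_def)
      ultimately show ?thesis using False by (simp only: forests_Nil mult_eq_0_iff if_False) simp
    qed
  next
    case (Cons s L)
    let ?c = "snd s"
    have gs: "good_state d \<beta> s" using Cons.prems by simp
    then have b: "1 \<le> \<beta> ?c" by (auto simp: good_state_def dest: spec[of _ ?c])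
    then have ck: "?c \<le> k" using assms(1)[of ?c] by (cases "?c \<le> k") auto
    have IH1: "finite (forests d L g)" "card (forests d L g) = forest_number k \<beta> (miss_count L) g"
      using Cons by auto
    have mc: "miss_count (s # L) = (miss_count L)(?c := Suc (miss_count L ?c))"
      by (auto simp: miss_count_def)
    let ?g = "g(?c := g ?c - 1)" let ?L = "map (fc_child s) [0..<d] @ L"
    let ?h = "\<lambda>Us. graft (take d Us) # drop d Us"
    have IH2: "finite (forests d ?L ?g) \<and> card (forests d ?L ?g) = forest_number k \<beta> (miss_count ?L) ?g" if "0 < g ?c"
    proof (rule outer(1))
      show "(\<Sum>c\<le>k. ?g c) < (\<Sum>c\<le>k. g c)"
        by (rule sum_strict_mono_ex1) (use ck that in auto)
      show "\<forall>s\<in>set ?L. good_state d \<beta> s" using Cons.prems good_state_child[OF gs] by auto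
    qed (use outer(2) in auto)
    have mL: "miss_count ?L = (\<lambda>i. miss_count L i + \<beta> i - (if i = ?c then 1 else 0))"
    proof
      fix i
      have "miss_count ?L i = miss_count (map (fc_child s) [0..<d]) i + miss_count L i"
        by (simp add: miss_count_def)
      then show "miss_count ?L i = miss_count L i + \<beta> i - (if i = ?c then 1 else 0)"
        unfolding miss_count_children[OF gs] using b by auto
    qed
    have inj: "inj_on ((#) {}) (forests d L g)" by (auto simp: inj_on_def)
    have disj: "(#) {} ` forests d L g \<inter> ?h ` forests d ?L ?g = {}" by (auto simp: graft_def)
    show ?case
    proof (cases "0 < g ?c")
      case True
      have "card (forests d (s # L) g) = card (forests d L g) + card (forests d ?L ?g)"
        unfolding forests_Cons using True IH1(1) IH2[OF True] disj
        by (simp add: card_Un_disjoint card_image inj inj_on_graft_forests)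
      moreover have "finite (forests d (s # L) g)"
        unfolding forests_Cons using True IH1(1) IH2[OF True] by simp
      ultimately show ?thesis
        unfolding mc forest_number_rec[where \<beta> = \<beta> and c = "snd s", OF ck b] using True IH1 IH2[OF True] mL by simp
    next
      case False
      then have "forests d (s # L) g = (#) {} ` forests d L g" unfolding forests_Cons by simp
      then show ?thesis unfolding mc forest_number_rec[where \<beta> = \<beta> and c = "snd s", OF ck b] using False IH1 by (simp add: card_image inj)
    qed
  qed
qed

section \<open>From the forest number to the displayed product\<close>

lemma pow_coeff_eq:
  assumes "x \<noteq> real m" shows "pow_coeff x m = x / (x - m) * ((x - m) gchoose m)"
proof (cases m)
  case (Suc l)
  have 1: "(x - m) * der_coeff x m = m * ((x - m) gchoose m)"
    using gbinomial_absorption[of l "x - m"] by (simp add: der_coeff_def Suc mult.commute)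
  have "m * pow_coeff x m * (x - m) = x * (m * ((x - m) gchoose m))"
    unfolding 1[symmetric] der_coeff_mult[symmetric] by (simp add: ac_simps)
  then have "real m * (pow_coeff x m * (x - m)) = real m * (x * ((x - m) gchoose m))"
    by (simp add: ac_simps)
  then have "pow_coeff x m * (x - m) = x * ((x - m) gchoose m)"
    using Suc by (simp only: mult_cancel_left) simp
  then show ?thesis using assms by (simp add: field_simps)
qed (use assms in \<open>simp add: pow_coeff_def\<close>)

lemma der_coeff_eq:
  assumes "x \<noteq> real m" shows "der_coeff x m = m / (x - m) * ((x - m) gchoose m)"
proof (cases m)
  case (Suc l)
  have "(x - m) * der_coeff x m = m * ((x - m) gchoose m)"
    using gbinomial_absorption[of l "x - m"] by (simp add: der_coeff_def Suc mult.commute)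
  then show ?thesis using assms by (simp add: field_simps)
qed (simp add: der_coeff_def)

text \<open>For \<open>b > 0\<close> the strict bound keeps the denominator
  \<open>n * b - (g - b)\<close> positive. For \<open>b = 0\<close> both sides are 1 if
  \<open>g = 0\<close>, by the convention in \<open>fc_factor\<close>, and 0 otherwise.\<close>

lemma fc_factor_eq:
  assumes "b \<le> g" "g - b < n"
  shows "real n * fc_factor (real n) b g = pow_coeff (n * b) (g - b)"
proof (cases "b = 0")
  case True
  have "g \<noteq> 0 \<Longrightarrow> pow_coeff 0 g = 0" using der_coeff_mult[of 0 g] by simp
  then show ?thesis using True assms by (auto simp: fc_factor_def pow_coeff_def)
next
  case False
  then have lt: "g - b < n * b" using assms by (metis One_nat_def leI less_le_trans mult.right_neutral mult_le_mono2 less_one)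
  have eq: "real b * real n + real b - real g = real (n * b) - real (g - b)" using assms by (simp add: of_nat_diff)
  have *: "int g - int b = int (g - b)" using assms by simp
  have ib: "int_binom x (int g - int b) = x gchoose (g - b)" for x
    unfolding * int_binom_def by simp
  have "fc_factor (real n) b g = real b / (real (n * b) - real (g - b)) * ((real (n * b) - real (g - b)) gchoose (g - b))"
    using False by (simp add: fc_factor_def ib eq)
  moreover have "real (n * b) \<noteq> real (g - b)" using lt by linarith
  ultimately show ?thesis using pow_coeff_eq[of "real (n * b)" "g - b"] by simp
qed

text \<open>Here \<open>m i\<close> is the number of nodes whose new vertex has colour
  \<open>i\<close>. The shift at colour 0 comes from the root wall, which has only
  \<open>\<beta> 0 - 1\<close> vertices of that colour. As 0 is thus the colour missed by the only
  tree, the exponents are the unit vector at 0 and one summand of \<open>forest_number_mult\<close>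
  remains.\<close>

lemma fc_formula_eq_forest_number:
  fixes \<beta> \<gamma> m :: "nat \<Rightarrow> nat"
  assumes m: "\<And>i. i \<le> k \<Longrightarrow> \<gamma> i + (if i = 0 then 1 else 0) = \<beta> i + m i"
    and n: "(\<Sum>i\<le>k. m i) = n" "1 \<le> n" and b: "1 \<le> \<beta> 0"
  shows "fc_formula k \<beta> \<gamma> (real n) = forest_number k \<beta> (\<lambda>i. if i = 0 then 1 else 0) m"
proof -
  let ?e = "\<lambda>i::nat. if i = 0 then 1 else 0 :: nat"
  let ?P = "\<Prod>j\<in>{..k} - {0}. pow_coeff (n * \<beta> j) (m j)"
  have k0: "{..k} - {0} = {1..k}" by auto
  have "real n * forest_number k \<beta> ?e m =
     (\<Sum>i\<le>k. ?e i * der_coeff (?e i + n * \<beta> i) (m i) * (\<Prod>j\<in>{..k} - {i}. pow_coeff (?e j + n * \<beta> j) (m j)))"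
    by (subst n(1)[symmetric], subst forest_number_mult) (simp add: n)
  also have "\<dots> = der_coeff (1 + n * \<beta> 0) (m 0) * ?P"
    by (subst sum.remove[of _ 0]) (auto intro!: prod.cong)
  finally have 1: "real n * forest_number k \<beta> ?e m = der_coeff (1 + n * \<beta> 0) (m 0) * ?P" .
  have g0: "real (\<gamma> 0) = real (\<beta> 0) + real (m 0) - 1" using m[of 0] by simp
  have "m 0 \<le> n" unfolding n(1)[symmetric] by (rule member_le_sum) auto
  then have lt: "m 0 < 1 + n * \<beta> 0" using b
    by (metis Suc_eq_plus1_left le_imp_less_Suc le_trans mult.right_neutral mult_le_mono2)
  have i0: "int (\<gamma> 0) - int (\<beta> 0) + 1 = int (m 0)" using m[of 0] by simp
  have X: "real (\<beta> 0) * real n + real (\<beta> 0) - real (\<gamma> 0) = real (1 + n * \<beta> 0) - real (m 0)"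
    unfolding g0 by simp
  have Y: "real (\<gamma> 0) - real (\<beta> 0) + 1 = real (m 0)" unfolding g0 by simp
  have "int_binom x (int (m 0)) = x gchoose (m 0)" for x by (simp add: int_binom_def)
  then have 2: "(real (\<gamma> 0) - real (\<beta> 0) + 1) / (real (\<beta> 0) * real n + real (\<beta> 0) - real (\<gamma> 0)) *
      int_binom (real (\<beta> 0) * real n + real (\<beta> 0) - real (\<gamma> 0)) (int (\<gamma> 0) - int (\<beta> 0) + 1)
    = der_coeff (1 + n * \<beta> 0) (m 0)"
    unfolding i0 X Y using der_coeff_eq[of "real (1 + n * \<beta> 0)" "m 0"] lt by (simp del: of_nat_add of_nat_mult)
  \<comment> \<open>If \<open>m 0\<close> is nonzero, every other \<open>m j\<close> is below
    \<open>n\<close>, as \<open>fc_factor_eq\<close> requires. If it is zero, the leading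
    \<open>der_coeff\<close> already makes both sides of the final equation 0.\<close>
  have 3: "real n powi (int k - 1) * (\<Prod>j=1..k. fc_factor n (\<beta> j) (\<gamma> j)) = ?P / n" if m0: "m 0 \<noteq> 0"
  proof -
    have "?P = (\<Prod>j=1..k. real n * fc_factor n (\<beta> j) (\<gamma> j))" unfolding k0
    proof (rule prod.cong)
      fix j assume j: "j \<in> {1..k}"
      then have mj: "\<gamma> j = \<beta> j + m j" using m[of j] by auto
      have "m j + m 0 = (\<Sum>i\<in>{j, 0}. m i)" using j by simp
      also have "\<dots> \<le> n" unfolding n(1)[symmetric] by (rule sum_mono2) (use j in auto)
      finally show "pow_coeff (n * \<beta> j) (m j) = real n * fc_factor n (\<beta> j) (\<gamma> j)"
        using fc_factor_eq[of "\<beta> j" "\<gamma> j" n] mj m0 by simp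
    qed simp
    also have "\<dots> = real n ^ k * (\<Prod>j=1..k. fc_factor n (\<beta> j) (\<gamma> j))" by (simp add: prod.distrib)
    also have "real n ^ k = n * real n powi (int k - 1)"
      using n(2) by (simp add: power_int_diff)
    finally show ?thesis using n(2) by (simp add: field_simps)
  qed
  have "fc_formula k \<beta> \<gamma> (real n) = der_coeff (1 + n * \<beta> 0) (m 0) *
      (real n powi (int k - 1) * (\<Prod>j=1..k. fc_factor n (\<beta> j) (\<gamma> j)))"
    using n(2) unfolding 2[symmetric] fc_formula_def by (simp add: mult.assoc mult.left_commute mult.commute)
  also have "\<dots> = der_coeff (1 + n * \<beta> 0) (m 0) * (?P / n)"
    using 3 by (cases "m 0 = 0") (auto simp: der_coeff_def)
  finally have "real n * fc_formula k \<beta> \<gamma> (real n) = real n * forest_number k \<beta> ?e m"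
    unfolding 1 using n(2) by simp
  then show ?thesis using n(2) by simp
qed

section \<open>Stacked complexes\<close>

definition faces :: "'v set set \<Rightarrow> 'v set set" where
  "faces F = {\<rho>. \<rho> \<noteq> {} \<and> (\<exists>\<sigma>\<in>F. \<rho> \<subseteq> \<sigma>)}"

text \<open>A facet is attached only along a free wall, one that lies in a single facet so far. The
  wall \<open>R\<close> is excluded and thus stays free for the marking. The apex \<open>w\<close>
  is a new vertex, so the facets meet only as the gluing dictates.\<close>

inductive stacked :: "nat \<Rightarrow> 'v set \<Rightarrow> 'v set set \<Rightarrow> bool" for d R where
  base: "finite R \<Longrightarrow> card R = d \<Longrightarrow> w \<notin> R \<Longrightarrow> stacked d R {insert w R}"
| step: "stacked d R F \<Longrightarrow> \<sigma> \<in> F \<Longrightarrow> \<tau> \<subseteq> \<sigma> \<Longrightarrow> card \<tau> = d \<Longrightarrow> \<tau> \<noteq> R \<Longrightarrow> \<forall>\<rho>\<in>F. \<tau> \<subseteq> \<rho> \<longrightarrow> \<rho> = \<sigma> \<Longrightarrow>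
    w \<notin> \<Union>F \<Longrightarrow> stacked d R (insert (insert w \<tau>) F)"

lemma subset_card_pred:
  assumes "finite B" "A \<subseteq> B" "Suc (card A) = card B" obtains x where "x \<in> B" "A = B - {x}"
proof -
  have "card (B - A) = 1" using assms by (simp add: card_Diff_subset finite_subset)
  then obtain x where "B - A = {x}" by (auto simp: card_1_singleton_iff)
  then show ?thesis using that[of x] assms(2) by blast
qed

section \<open>The universal tree of simplices\<close>

text \<open>Even numbers are the vertices of the initial wall and odd numbers the apices of nodes.
  All trees of simplices thus live in one infinite complex on \<open>nat\<close>, from which a
  finite tree selects facets.\<close>

definition base_vertex :: "nat \<Rightarrow> nat" where "base_vertex i = 2 * i"

definition apex :: "nat list \<Rightarrow> nat" where "apex q = Suc (2 * to_nat q)"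

lemma apex_inj [simp]: "apex p = apex q \<longleftrightarrow> p = q"
  by (simp add: apex_def)

lemma apex_neq_base_vertex [simp]: "apex q \<noteq> base_vertex i" "base_vertex i \<noteq> apex q"
  unfolding apex_def base_vertex_def by presburger+

text \<open>A new apex takes the position of the vertex that it replaces. The order of the initial
  wall is passed on in this way to all walls, so that words over \<open>{..<d}\<close> name walls
  without any choice.\<close>

primrec root_at :: "nat \<Rightarrow> nat list \<Rightarrow> nat list" where
  "root_at d [] = map base_vertex [0..<d]"
| "root_at d (i # q) = (root_at d q)[i := apex q]"

definition facet_at :: "nat \<Rightarrow> nat list \<Rightarrow> nat set" where
  "facet_at d q = insert (apex q) (set (root_at d q))"

lemma length_root_at [simp]: "length (root_at d q) = d"
  by (induction q) (auto simp: root_at.simps(1))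

lemma set_root_at_Cons_subset: "set (root_at d (i # q)) \<subseteq> facet_at d q"
  by (simp add: facet_at_def set_update_subset_insert)

text \<open>Vertices are inherited only downwards, so an apex in the wall of \<open>q\<close> was
  created at a proper ancestor, that is at a proper suffix of \<open>q\<close>.\<close>

lemma apex_in_root_at: "apex p \<in> set (root_at d q) \<Longrightarrow> \<exists>i q'. q = q' @ i # p"
proof (induction q)
  case (Cons i q)
  then show ?case using set_update_subset_insert[of "root_at d q" i "apex q"]
    by (fastforce simp: Cons_eq_append_conv)
qed auto

lemma apex_in_facet_at: "apex p \<in> facet_at d q \<Longrightarrow> \<exists>q'. q = q' @ p"
  using apex_in_root_at[of p d q] by (auto simp: facet_at_def)

lemma apex_notin_root_at [simp]: "apex q \<notin> set (root_at d q)"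
  using apex_in_root_at[of q d q] by auto

lemma distinct_root_at: "distinct (root_at d q)"
  by (induction q) (auto simp: distinct_map inj_on_def base_vertex_def intro!: distinct_list_update)

declare root_at.simps(1) [simp del]

lemma card_facet_at [simp]: "card (facet_at d q) = Suc d" and finite_facet_at [simp]: "finite (facet_at d q)"
  by (simp_all add: facet_at_def distinct_card distinct_root_at)

lemma set_root_at_Cons:
  assumes "i < d" shows "set (root_at d (i # q)) = facet_at d q - {root_at d q ! i}"
proof -
  have "apex q \<noteq> root_at d q ! i" using assms apex_notin_root_at by (metis length_root_at nth_mem)
  then show ?thesis using assms distinct_root_at[of d q] by (auto simp: facet_at_def set_update_distinct)
qed

text \<open>A vertex once replaced never returns: the subtree below child \<open>i\<close> inherits
  from a wall without it and otherwise adds only apices of its own nodes.\<close>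

lemma root_at_nth_notin_facet_at:
  assumes "i < d" shows "root_at d q ! i \<notin> facet_at d (q' @ i # q)"
proof (induction q')
  have ne: "root_at d q ! i \<noteq> apex (x @ q)" for x
    using apex_in_root_at[of "x @ q" d q] assms by (metis append_Nil append_is_Nil_conv length_root_at list.discI nth_mem append_assoc append_Cons append_eq_append_conv2 self_append_conv2 append_self_conv2)
  { case Nil
    show ?case using set_root_at_Cons[OF assms, of q] ne[of "[i]"] by (auto simp: facet_at_def)
  next
    case (Cons j q')
    show ?case using Cons set_root_at_Cons_subset[of d j "q' @ i # q"] ne[of "j # q' @ [i]"] by (auto simp: facet_at_def) }
qed

lemma root_subset_facet_at:
  assumes "set (root_at d []) \<subseteq> facet_at d q" "set q \<subseteq> {..<d}" shows "q = []"
proof (rule ccontr)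
  assume "q \<noteq> []"
  then obtain y l where q: "q = y @ [l]" by (metis rev_exhaust)
  then have "root_at d [] ! l \<in> facet_at d q" using assms by (metis length_root_at nth_mem subsetD in_set_conv_decomp lessThan_iff)
  then show False using root_at_nth_notin_facet_at[of l d "[]" y] q assms by auto
qed

text \<open>The apex of \<open>q\<close> confines \<open>q'\<close> to the subtree at
  \<open>q\<close>. There a first step other than \<open>i\<close>, or any step beyond
  \<open>i # q\<close>, loses a vertex of the wall. So a wall is shared at most by a parent and its
  child.\<close>

lemma root_at_subset_facet_at:
  assumes "set (root_at d (i # q)) \<subseteq> facet_at d q'" "set q' \<subseteq> {..<d}" "i < d" shows "q' = q \<or> q' = i # q"
proof -
  have "apex q \<in> set (root_at d (i # q))" using assms by (simp add: set_update_memI)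
  then obtain x where x: "q' = x @ q" using apex_in_facet_at assms by blast
  show ?thesis
  proof (cases x rule: rev_cases)
    case (snoc y j)
    then have q': "q' = y @ j # q" "j < d" using x assms by auto
    have "j = i"
    proof (rule ccontr)
      assume "j \<noteq> i"
      then have "root_at d q ! j = root_at d (i # q) ! j" by simp
      also have "\<dots> \<in> set (root_at d (i # q))" using q' by (metis length_root_at nth_mem)
      finally show False using root_at_nth_notin_facet_at[of j d q y] q' assms by auto
    qed
    show ?thesis
    proof (cases y rule: rev_cases)
      case (snoc z l)
      then have "l < d" "q' = z @ l # (i # q)" using q' assms \<open>j = i\<close> by auto
      moreover have "root_at d (i # q) ! l \<in> set (root_at d (i # q))" using \<open>l < d\<close> by (metis length_root_at nth_mem)
      ultimately show ?thesis using root_at_nth_notin_facet_at[of l d "i # q" z] assms(1) by blast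
    qed (use q' \<open>j = i\<close> in auto)
  qed (use x in auto)
qed

lemma facet_at_inj [simp]: "facet_at d p = facet_at d q \<longleftrightarrow> p = q"
proof
  assume "facet_at d p = facet_at d q"
  then have "apex p \<in> facet_at d q" "apex q \<in> facet_at d p" by (metis facet_at_def insertI1)+
  then obtain x y where "q = x @ p" "p = y @ q" using apex_in_facet_at by meson
  then have "q = (x @ y) @ q" by simp
  then have "x = []" by (metis append_is_Nil_conv self_append_conv2)
  then show "p = q" using \<open>q = x @ p\<close> by simp
qed auto

text \<open>The initial wall is listed as a generator so that the empty tree yields the complex of
  index 0.\<close>

definition tree_complex :: "nat \<Rightarrow> nat list set \<Rightarrow> nat set set" where
  "tree_complex d T = faces (insert (set (root_at d [])) (facet_at d ` T))"

lemma facet_at_in_tree_complex: "q \<in> T \<Longrightarrow> facet_at d q \<in> tree_complex d T"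
  by (auto simp: tree_complex_def faces_def facet_at_def)

lemma facets_tree_complex: "facets d (tree_complex d T) = facet_at d ` T"
proof -
  have c: "card (set (root_at d [])) = d" by (simp only: distinct_card distinct_root_at length_root_at)
  have "\<sigma> \<in> facet_at d ` T" if s: "\<sigma> \<in> tree_complex d T" "card \<sigma> = d + 1" for \<sigma>
  proof -
    have "\<not> \<sigma> \<subseteq> set (root_at d [])" using s(2) c card_mono[of "set (root_at d [])" \<sigma>] by (auto simp del: root_at.simps)
    then obtain q where "q \<in> T" "\<sigma> \<subseteq> facet_at d q" using s by (auto simp: tree_complex_def faces_def)
    then show ?thesis using s(2) card_subset_eq[of "facet_at d q" \<sigma>] by auto
  qed
  then show ?thesis using facet_at_in_tree_complex by (fastforce simp: facets_def)
qed

text \<open>An isomorphism that fixes the ordered root wall is rigid. Working outwards, once a wall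
  and its facet are preserved, the one vertex off the wall is fixed. The image of the facet of
  \<open>i # p\<close> contains the wall of \<open>i # p\<close>, so it is the facet of
  \<open>p\<close> or of \<open>i # p\<close>; injectivity rules out \<open>p\<close>, whose facet
  is already taken.\<close>

lemma tree_complex_iso_subset:
  assumes T: "dtree d T" "dtree d T'" and iso: "rooted_iso (tree_complex d T, root_at d []) (tree_complex d T', root_at d [])"
  shows "T \<subseteq> T'"
proof -
  obtain f where inj: "inj_on f (\<Union>(tree_complex d T))"
    and img: "(\<lambda>\<sigma>. f ` \<sigma>) ` tree_complex d T = tree_complex d T'" and rt0: "map f (root_at d []) = root_at d []"
    using iso by (auto simp: rooted_iso_def)
  have injf: "inj_on f (facet_at d q)" if "q \<in> T" for q
    using inj_on_subset[OF inj] facet_at_in_tree_complex[OF that, of d] by auto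
  have fq: "\<exists>q'\<in>T'. f ` facet_at d q = facet_at d q'" if q: "q \<in> T" for q
  proof -
    have "f ` facet_at d q \<in> facets d (tree_complex d T')"
      using img facet_at_in_tree_complex[OF q, of d] by (auto simp: facets_def card_image[OF injf[OF q]])
    then show ?thesis by (auto simp: facets_tree_complex)
  qed
  have new: "f (apex q) = apex q" if "q \<in> T" "map f (root_at d q) = root_at d q" "f ` facet_at d q = facet_at d q" for q
  proof -
    have s: "f ` set (root_at d q) = set (root_at d q)" using that(2) by (metis set_map)
    have "f (apex q) \<notin> f ` set (root_at d q)"
      using injf[OF that(1)] by (auto simp: facet_at_def inj_on_def)
    moreover have "f (apex q) \<in> facet_at d q" using that(3) by (auto simp: facet_at_def)
    ultimately show ?thesis using s by (auto simp: facet_at_def)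
  qed
  have sd: "set q \<subseteq> {..<d}" if "q \<in> T'" for q using that T by (auto simp: dtree_def)
  have "q \<in> T \<longrightarrow> q \<in> T' \<and> map f (root_at d q) = root_at d q \<and> f ` facet_at d q = facet_at d q" for q
  proof (induction q)
    case Nil
    show ?case
    proof
      assume q: "[] \<in> T"
      then obtain q' where q': "q' \<in> T'" "f ` facet_at d [] = facet_at d q'" using fq by blast
      have "set (root_at d []) = f ` set (root_at d [])" using rt0 by (metis set_map)
      also have "\<dots> \<subseteq> facet_at d q'" unfolding q'(2)[symmetric] by (auto simp: facet_at_def)
      finally have "q' = []" using root_subset_facet_at sd[OF q'(1)] by blast
      then show "[] \<in> T' \<and> map f (root_at d []) = root_at d [] \<and> f ` facet_at d [] = facet_at d []"
        using q' rt0 by (simp del: root_at.simps)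
    qed
  next
    case (Cons i p)
    show ?case
    proof
      assume q: "i # p \<in> T"
      then have p: "p \<in> T" and i: "i < d" using T(1) by (auto simp: dtree_def)
      have IH: "p \<in> T'" "map f (root_at d p) = root_at d p" "f ` facet_at d p = facet_at d p" using Cons p by auto
      have 1: "map f (root_at d (i # p)) = root_at d (i # p)" using new[OF p IH(2,3)] IH(2) by (simp add: map_update)
      obtain q' where q': "q' \<in> T'" "f ` facet_at d (i # p) = facet_at d q'" using fq[OF q] by blast
      have "set (root_at d (i # p)) = f ` set (root_at d (i # p))" using 1 by (metis set_map)
      also have "\<dots> \<subseteq> facet_at d q'" unfolding q'(2)[symmetric] by (auto simp: facet_at_def)
      finally have "q' = p \<or> q' = i # p" using root_at_subset_facet_at sd[OF q'(1)] i by blast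
      moreover have "q' \<noteq> p"
      proof
        assume "q' = p"
        then have "f ` facet_at d (i # p) = f ` facet_at d p" using q' IH by simp
        moreover have "facet_at d (i # p) \<subseteq> \<Union>(tree_complex d T)" "facet_at d p \<subseteq> \<Union>(tree_complex d T)"
          using facet_at_in_tree_complex p q by blast+
        ultimately have "facet_at d (i # p) = facet_at d p" using inj by (simp add: inj_on_image_eq_iff)
        then show False by simp
      qed
      ultimately show "i # p \<in> T' \<and> map f (root_at d (i # p)) = root_at d (i # p) \<and> f ` facet_at d (i # p) = facet_at d (i # p)"
        using q' 1 by auto
    qed
  qed
  then show ?thesis by blast
qed

lemma stacked_imp_tree:
  assumes "stacked d (set r) F" "distinct r" "length r = d"
  shows "\<exists>T f. dtree d T \<and> T \<noteq> {} \<and> inj_on f (\<Union>(facet_at d ` T)) \<and> map f (root_at d []) = r \<and> (\<lambda>q. f ` facet_at d q) ` T = F"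
  using assms(1)
proof induction
  case (base w)
  define f where "f = (\<lambda>v. if v = apex [] then w else r ! (v div 2))"
  have m: "map f (root_at d []) = r"
  proof (rule nth_equalityI)
    fix i assume "i < length (map f (root_at d []))"
    then have "i < d" by simp
    then show "map f (root_at d []) ! i = r ! i" by (simp add: f_def root_at.simps(1)) (simp add: base_vertex_def)
  qed (simp add: assms)
  have s: "f ` set (root_at d []) = set r" using set_map[of f "root_at d []"] unfolding m by simp
  have "inj_on f (set (root_at d []))" using assms(2) distinct_map[of f "root_at d []"] unfolding m by simp
  moreover have fn: "f (apex []) = w" by (simp add: f_def)
  ultimately have "inj_on f (facet_at d [])" using base s by (simp add: facet_at_def del: root_at.simps)
  moreover have "f ` facet_at d [] = insert w (set r)" using s fn by (simp add: facet_at_def del: root_at.simps)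
  ultimately have "dtree d {[]} \<and> {[]} \<noteq> ({} :: nat list set) \<and> inj_on f (\<Union>(facet_at d ` {[]})) \<and> map f (root_at d []) = r \<and> (\<lambda>q. f ` facet_at d q) ` {[]} = {insert w (set r)}"
    using m by (simp add: dtree_def del: root_at.simps)
  then show ?case by blast
next
  case (step F \<sigma> \<tau> w)
  obtain T f where T: "dtree d T" "T \<noteq> {}" and inj: "inj_on f (\<Union>(facet_at d ` T))"
    and rt0: "map f (root_at d []) = r" and F: "(\<lambda>q. f ` facet_at d q) ` T = F" using step.IH by blast
  obtain p where p: "p \<in> T" "\<sigma> = f ` facet_at d p" using F \<open>\<sigma> \<in> F\<close> by blast
  obtain \<tau>0 where t: "\<tau>0 \<subseteq> facet_at d p" "\<tau> = f ` \<tau>0" using step p by (meson subset_image_iff)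
  have inj_eq: "q = p" if "q \<in> T" "f ` facet_at d q = f ` facet_at d p" for q
  proof -
    have "facet_at d q = facet_at d p" by (rule inj_on_image_eq_iff[THEN iffD1, OF inj]) (use that p in auto)
    then show ?thesis by simp
  qed
  have uniq: "q = p" if "q \<in> T" "\<tau>0 \<subseteq> facet_at d q" for q
  proof -
    have "f ` facet_at d q \<in> F" using F that(1) by blast
    moreover have "\<tau> \<subseteq> f ` facet_at d q" using t(2) that(2) by blast
    ultimately have "f ` facet_at d q = \<sigma>" using step.hyps(6) by blast
    then show ?thesis using inj_eq that(1) p(2) by blast
  qed
  have "card \<tau>0 = d" using step t inj p by (metis card_image inj_on_subset UN_upper order_trans)
  then obtain x where x: "x \<in> facet_at d p" "\<tau>0 = facet_at d p - {x}"
    using subset_card_pred[OF finite_facet_at t(1)] by auto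
  \<comment> \<open>The face opposite the apex is the wall through which \<open>p\<close> was
    entered. It is the root wall or is shared with the parent, and a free wall is neither.\<close>
  have "x \<noteq> apex p"
  proof
    assume "x = apex p"
    then have t0: "\<tau>0 = set (root_at d p)" using x by (auto simp: facet_at_def)
    show False
    proof (cases p)
      case Nil
      then show False using t0 t step rt0 by (metis set_map)
    next
      case (Cons i p')
      then have "p' \<in> T" using p T by (auto simp: dtree_def)
      moreover have "\<tau>0 \<subseteq> facet_at d p'" unfolding t0 Cons by (rule set_root_at_Cons_subset)
      ultimately show False using uniq Cons by fastforce
    qed
  qed
  then obtain i where i: "i < d" "x = root_at d p ! i"
    using x by (auto simp: facet_at_def in_set_conv_nth)
  let ?q = "i # p"
  have t0: "\<tau>0 = set (root_at d ?q)" using set_root_at_Cons[OF i(1)] x i by simp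
  have qT: "?q \<notin> T"
  proof
    assume "?q \<in> T"
    moreover have "\<tau>0 \<subseteq> facet_at d ?q" unfolding t0 by (auto simp: facet_at_def)
    ultimately show False using uniq[of ?q] by auto
  qed
  have suff: "q \<in> T" if "q' @ q \<in> T" for q q' using that by (induction q') (use T in \<open>auto simp: dtree_def\<close>)
  have new: "apex ?q \<notin> \<Union>(facet_at d ` T)" using apex_in_facet_at suff qT by blast
  let ?f = "f(apex ?q := w)"
  have f: "?f ` A = f ` A" if "apex ?q \<notin> A" for A using that by (auto simp: image_iff)
  have "dtree d (insert ?q T)" using T p i by (auto simp: dtree_def)
  moreover have "?f ` facet_at d q = f ` facet_at d q" if "q \<in> T" for q using new that by (intro f) auto
  moreover have fq: "?f ` facet_at d ?q = insert w \<tau>"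
    using f[of \<tau>0] t t0 by (simp add: facet_at_def del: root_at.simps)
  moreover have "inj_on ?f (\<Union>(facet_at d ` insert ?q T))"
  proof -
    have eq: "\<Union>(facet_at d ` insert ?q T) = insert (apex ?q) (\<Union>(facet_at d ` T))"
      using set_root_at_Cons_subset[of d i p] p by (auto simp: facet_at_def)
    have "\<Union>F = f ` (\<Union>(facet_at d ` T))" using F by auto
    then have "w \<notin> f ` (\<Union>(facet_at d ` T))" using step by simp
    moreover have "inj_on ?f (\<Union>(facet_at d ` T))" using inj new by (simp add: inj_on_fun_updI inj_on_def)
    ultimately show ?thesis unfolding eq using f[OF new] new by (simp add: inj_on_insert)
  qed
  moreover have "map ?f (root_at d []) = r" using rt0 apex_in_root_at[of ?q d "[]"] by auto
  ultimately have "dtree d (insert ?q T) \<and> insert ?q T \<noteq> {} \<and> inj_on ?f (\<Union>(facet_at d ` insert ?q T)) \<and>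
    map ?f (root_at d []) = r \<and> (\<lambda>q. ?f ` facet_at d q) ` (insert ?q T) = insert (insert w \<tau>) F"
    using F by (simp del: root_at.simps)
  then show ?case by blast
qed

lemma dtree_tl: "dtree d T \<Longrightarrow> i # q \<in> T \<Longrightarrow> q \<in> T"
  unfolding dtree_def by blast

text \<open>A longest word is a leaf: its apex lies in no other facet, and without it its wall lies
  only in the facet of the parent. So it can be the last facet glued.\<close>

lemma stacked_tree:
  assumes "dtree d T" "T \<noteq> {}"
  shows "stacked d (set (root_at d [])) (facet_at d ` T)"
  using assms
proof (induction "card T" arbitrary: T rule: less_induct)
  case less
  have fin: "finite T" using less by (simp add: dtree_def)
  have "Max (length ` T) \<in> length ` T" using fin less by (intro Max_in) auto
  then obtain q where q: "q \<in> T" "length q = Max (length ` T)" by auto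
  then have max: "length p \<le> length q" if "p \<in> T" for p using that fin by simp
  have c0: "card (set (root_at d [])) = d" by (simp only: distinct_card distinct_root_at length_root_at)
  show ?case
  proof (cases q)
    case Nil
    then have "T = {[]}" using max q(1) by auto
    then show ?thesis using stacked.base[OF _ c0 apex_notin_root_at] by (simp add: facet_at_def del: root_at.simps)
  next
    case (Cons i p)
    let ?S = "T - {q}"
    have p: "p \<in> ?S" "i < d" using less q Cons by (auto simp: dtree_def)
    have tl: "t \<in> ?S" if "j # t \<in> ?S" for j t
      using that max[of "j # t"] dtree_tl[OF less(2), of j t] by auto
    have sub: "\<forall>t\<in>?S. set t \<subseteq> {..<d}" using less(2) unfolding dtree_def by (meson DiffD1)
    have S: "dtree d ?S" unfolding dtree_def
      by (rule conjI[OF finite_Diff[OF fin] conjI[OF sub]], intro allI impI, rule tl)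
    have S': "set t \<subseteq> {..<d}" if "t \<in> ?S" for t using that sub by blast
    have st: "stacked d (set (root_at d [])) (facet_at d ` ?S)"
      using less(1)[of ?S] S p q fin by (metis card_Diff1_less empty_iff)
    have eq: "facet_at d ` T = insert (insert (apex q) (set (root_at d q))) (facet_at d ` ?S)"
      using q by (auto simp: facet_at_def)
    show ?thesis unfolding eq
    proof (rule stacked.step[OF st, of "facet_at d p"])
      show "set (root_at d q) \<subseteq> facet_at d p" unfolding Cons by (rule set_root_at_Cons_subset)
      show "card (set (root_at d q)) = d" by (simp only: distinct_card distinct_root_at length_root_at)
      have "apex p \<in> set (root_at d q)" using Cons p by (simp add: set_update_memI)
      then show "set (root_at d q) \<noteq> set (root_at d [])" using apex_in_root_at[of p d "[]"] by auto
      show "\<forall>\<rho>\<in>facet_at d ` ?S. set (root_at d q) \<subseteq> \<rho> \<longrightarrow> \<rho> = facet_at d p"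
      proof (intro ballI impI)
        fix \<rho> assume "\<rho> \<in> facet_at d ` ?S" "set (root_at d q) \<subseteq> \<rho>"
        then obtain t where t: "t \<in> ?S" "\<rho> = facet_at d t" "set (root_at d (i # p)) \<subseteq> facet_at d t" using Cons by blast
        then have "t = p" using root_at_subset_facet_at[OF t(3) S'[OF t(1)] p(2)] Cons by blast
        then show "\<rho> = facet_at d p" using t by simp
      qed
      show "apex q \<notin> \<Union> (facet_at d ` ?S)"
      proof
        assume "apex q \<in> \<Union> (facet_at d ` ?S)"
        then obtain t where t: "t \<in> ?S" "apex q \<in> facet_at d t" by auto
        then obtain x where x: "t = x @ q" using apex_in_facet_at by blast
        then show False using t max[of t] by auto
      qed
    qed (use p in auto)
  qed
qed

section \<open>Realizations as subspaces of a function type\<close>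

lemma realization_top_eq: "realization_top K = top_of_set (realization K)"
  by (simp add: realization_top_def euclidean_product_topology)

definition fcball :: "nat \<Rightarrow> (nat \<Rightarrow> real) set" where
  "fcball d = {y. (\<forall>i\<ge>d. y i = 0) \<and> (\<Sum>i<d. (y i)\<^sup>2) \<le> 1}"

lemma Euclidean_space_eq: "Euclidean_space d = top_of_set {y. \<forall>i\<ge>d. y i = 0}"
  by (simp add: Euclidean_space_def euclidean_product_topology)

lemma closed_ball_top_eq: "closed_ball_top d = top_of_set (fcball d)"
  by (simp add: closed_ball_top_def Euclidean_space_eq subtopology_subtopology fcball_def Int_def)

lemma homeomorphic_map_euclidean:
  "homeomorphic_map (top_of_set S) (top_of_set T) h \<longleftrightarrow> (\<exists>g. homeomorphism S T h g)"
proof -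
  have "homeomorphic_maps (top_of_set S) (top_of_set T) h g \<longleftrightarrow> homeomorphism S T h g" for g
  proof
    assume "homeomorphic_maps (top_of_set S) (top_of_set T) h g"
    then show "homeomorphism S T h g"
      by (intro homeomorphismI) (auto simp: homeomorphic_maps_def continuous_map_subtopology_eu)
  next
    assume "homeomorphism S T h g"
    then show "homeomorphic_maps (top_of_set S) (top_of_set T) h g"
      by (auto simp: homeomorphic_maps_def continuous_map_subtopology_eu homeomorphism_def)
  qed
  then show ?thesis by (simp add: homeomorphic_map_maps)
qed

lemma homeomorphic_space_euclidean:
  "top_of_set S homeomorphic_space top_of_set T \<longleftrightarrow> (\<exists>h g. homeomorphism S T h g)"
  by (simp add: homeomorphic_space homeomorphic_map_euclidean)

lemma ball_boundary_eq:
  "ball_boundary d K = {x \<in> realization K. \<exists>h g. homeomorphism (realization K) (fcball d) h g \<and> (\<Sum>i<d. (h x i)\<^sup>2) = 1}"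
  by (auto simp: ball_boundary_def realization_top_eq closed_ball_top_eq homeomorphic_map_euclidean)

lemma realization_faces:
  assumes "\<forall>\<sigma>\<in>F. finite \<sigma>"
  shows "realization (faces F) = {x. (\<forall>v. 0 \<le> x v) \<and> (\<exists>\<sigma>\<in>F. {v. x v \<noteq> 0} \<subseteq> \<sigma> \<and> (\<Sum>v\<in>\<sigma>. x v) = 1)}"
proof (rule Set.set_eqI)
  fix x :: "'a \<Rightarrow> real"
  have *: "(\<Sum>v\<in>\<sigma>. x v) = (\<Sum>v | x v \<noteq> 0. x v)" if "\<sigma> \<in> F" "{v. x v \<noteq> 0} \<subseteq> \<sigma>" for \<sigma>
    by (rule sum.mono_neutral_right) (use assms that in auto)
  have ne: "(\<Sum>v | x v \<noteq> 0. x v) = 1 \<Longrightarrow> {v. x v \<noteq> 0} \<noteq> {}" by (metis sum.empty zero_neq_one)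
  show "x \<in> realization (faces F) \<longleftrightarrow>
    x \<in> {x. (\<forall>v. 0 \<le> x v) \<and> (\<exists>\<sigma>\<in>F. {v. x v \<noteq> 0} \<subseteq> \<sigma> \<and> (\<Sum>v\<in>\<sigma>. x v) = 1)}"
  proof
    assume "x \<in> realization (faces F)"
    then have x: "\<forall>v. 0 \<le> x v" "{v. x v \<noteq> 0} \<in> faces F" "(\<Sum>v | x v \<noteq> 0. x v) = 1" by (auto simp: realization_def)
    then obtain \<sigma> where "\<sigma> \<in> F" "{v. x v \<noteq> 0} \<subseteq> \<sigma>" unfolding faces_def by blast
    then show "x \<in> {x. (\<forall>v. 0 \<le> x v) \<and> (\<exists>\<sigma>\<in>F. {v. x v \<noteq> 0} \<subseteq> \<sigma> \<and> (\<Sum>v\<in>\<sigma>. x v) = 1)}"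
      using * x by auto
  next
    assume "x \<in> {x. (\<forall>v. 0 \<le> x v) \<and> (\<exists>\<sigma>\<in>F. {v. x v \<noteq> 0} \<subseteq> \<sigma> \<and> (\<Sum>v\<in>\<sigma>. x v) = 1)}"
    then obtain \<sigma> where "\<forall>v. 0 \<le> x v" "\<sigma> \<in> F" "{v. x v \<noteq> 0} \<subseteq> \<sigma>" "(\<Sum>v\<in>\<sigma>. x v) = 1" by blast
    then show "x \<in> realization (faces F)" using * ne by (auto simp: realization_def faces_def)
  qed
qed

lemma continuous_on_Min_family:
  fixes f :: "'a \<Rightarrow> 'b::topological_space \<Rightarrow> real"
  assumes "finite A" "A \<noteq> {}" "\<And>a. a \<in> A \<Longrightarrow> continuous_on S (f a)"
  shows "continuous_on S (\<lambda>x. Min ((\<lambda>a. f a x) ` A))"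
  using assms
proof (induction A rule: finite_ne_induct)
  case (insert a A)
  then have "(\<lambda>x. Min ((\<lambda>a. f a x) ` insert a A)) = (\<lambda>x. min (f a x) (Min ((\<lambda>a. f a x) ` A)))"
    by auto
  then show ?case using insert by (auto intro!: continuous_on_min)
qed auto

section \<open>A simplex is a ball\<close>

text \<open>Only the origin is at stake, where the quotient is 0 / 0 = 0. Domination of the
  coordinates by \<open>q\<close> bounds each coordinate of the image by
  \<open>\<bar>p y\<bar>\<close>, which tends to 0.\<close>

lemma continuous_on_rescale:
  fixes p q :: "(nat \<Rightarrow> real) \<Rightarrow> real" and d :: nat
  defines "E \<equiv> {y :: nat \<Rightarrow> real. \<forall>i\<ge>d. y i = 0}"
  assumes p: "continuous_on E p" "p (\<lambda>_. 0) = 0"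
    and q: "continuous_on E q" "\<And>y i. y \<in> E \<Longrightarrow> \<bar>y i\<bar> \<le> q y"
  shows "continuous_on E (\<lambda>y i. p y / q y * y i)"
proof (rule continuous_on_coordinatewise_then_product)
  fix i
  have pos: "0 < q y" if "y \<in> E" "y \<noteq> (\<lambda>_. 0)" for y
  proof -
    obtain j where "y j \<noteq> 0" using \<open>y \<noteq> (\<lambda>_. 0)\<close> by auto
    then show ?thesis using q(2)[OF that(1), of j] by linarith
  qed
  have c: "continuous_on E (\<lambda>y. y i)" by (rule continuous_on_subset[OF continuous_on_product_coordinates]) simp
  show "continuous_on E (\<lambda>y. p y / q y * y i)"
    unfolding continuous_on_eq_continuous_within
  proof
    fix y assume y: "y \<in> E"
    show "continuous (at y within E) (\<lambda>y. p y / q y * y i)"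
    proof (cases "y = (\<lambda>_. 0)")
      case False
      then have "q y \<noteq> 0" using pos y by force
      then show ?thesis using p(1) q(1) c y
        by (auto intro!: continuous_intros simp: continuous_on_eq_continuous_within)
    next
      case True
      have "((\<lambda>y. p y / q y * y i) \<longlongrightarrow> 0) (at y within E)"
      proof (rule Lim_null_comparison)
        show "\<forall>\<^sub>F z in at y within E. norm (p z / q z * z i) \<le> \<bar>p z\<bar>"
          unfolding eventually_at_filter
        proof (intro always_eventually allI impI)
          fix z assume z: "z \<noteq> y" "z \<in> E"
          then have "0 < q z" using pos True by auto
          moreover have "\<bar>p z\<bar> * \<bar>z i\<bar> \<le> \<bar>p z\<bar> * q z" using q(2)[OF z(2), of i] by (simp add: mult_left_mono)
          ultimately show "norm (p z / q z * z i) \<le> \<bar>p z\<bar>" by (simp add: abs_mult field_simps)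
        qed
        have "(p \<longlongrightarrow> p y) (at y within E)" using p(1) y by (simp add: continuous_on_def)
        then show "((\<lambda>z. \<bar>p z\<bar>) \<longlongrightarrow> 0) (at y within E)" using True p(2) tendsto_rabs_zero by simp
      qed
      then show ?thesis using True by (simp add: continuous_within)
    qed
  qed
qed

text \<open>Radial rescaling between the unit balls of two gauges. Only positive homogeneity is
  asked for, because the gauge of a simplex about its barycentre need not be symmetric; domination
  of the coordinates makes both gauges positive away from 0. The second claim says that unit spheres
  correspond.\<close>

lemma homeomorphism_rescale:
  fixes p q :: "(nat \<Rightarrow> real) \<Rightarrow> real" and d :: nat
  defines "E \<equiv> {y :: nat \<Rightarrow> real. \<forall>i\<ge>d. y i = 0}"
  assumes p: "continuous_on E p" "\<And>y i. y \<in> E \<Longrightarrow> \<bar>y i\<bar> \<le> p y" "\<And>y c. y \<in> E \<Longrightarrow> 0 \<le> c \<Longrightarrow> p (\<lambda>i. c * y i) = c * p y"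
    and q: "continuous_on E q" "\<And>y i. y \<in> E \<Longrightarrow> \<bar>y i\<bar> \<le> q y" "\<And>y c. y \<in> E \<Longrightarrow> 0 \<le> c \<Longrightarrow> q (\<lambda>i. c * y i) = c * q y"
  shows "homeomorphism {y \<in> E. p y \<le> 1} {y \<in> E. q y \<le> 1} (\<lambda>y i. p y / q y * y i) (\<lambda>y i. q y / p y * y i)"
    and "\<And>y. y \<in> E \<Longrightarrow> q (\<lambda>i. p y / q y * y i) = p y"
proof -
  have z: "(\<lambda>_. 0) \<in> E" by (simp add: E_def)
  have p0: "p (\<lambda>_. 0) = 0" "q (\<lambda>_. 0) = 0" using p(3)[OF z, of 0] q(3)[OF z, of 0] by simp_all
  have nn: "0 \<le> p y" "0 \<le> q y" if "y \<in> E" for y using p(2)[OF that, of 0] q(2)[OF that, of 0] by linarith+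
  have pos: "0 < p y" "0 < q y" if "y \<in> E" "y \<noteq> (\<lambda>_. 0)" for y
  proof -
    obtain j where "y j \<noteq> 0" using \<open>y \<noteq> (\<lambda>_. 0)\<close> by auto
    then show "0 < p y" "0 < q y" using p(2)[OF that(1), of j] q(2)[OF that(1), of j] by linarith+
  qed
  have q_eq: "q (\<lambda>i. p y / q y * y i) = p y" if "y \<in> E" for y
    using q(3)[OF that, of "p y / q y"] nn[OF that] pos[OF that] p0 by (cases "y = (\<lambda>_. 0)") auto
  have p_eq: "p (\<lambda>i. q y / p y * y i) = q y" if "y \<in> E" for y
    using p(3)[OF that, of "q y / p y"] nn[OF that] pos[OF that] p0 by (cases "y = (\<lambda>_. 0)") auto
  have E: "(\<lambda>i. c * y i) \<in> E" if "y \<in> E" for y c using that by (auto simp: E_def)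
  have 1: "continuous_on E (\<lambda>y i. p y / q y * y i)" "continuous_on E (\<lambda>y i. q y / p y * y i)"
    using continuous_on_rescale[of d p q] continuous_on_rescale[of d q p] p q p0 unfolding E_def by simp_all
  show "homeomorphism {y \<in> E. p y \<le> 1} {y \<in> E. q y \<le> 1} (\<lambda>y i. p y / q y * y i) (\<lambda>y i. q y / p y * y i)"
  proof (rule homeomorphismI)
    show "continuous_on {y \<in> E. p y \<le> 1} (\<lambda>y i. p y / q y * y i)"
      by (rule continuous_on_subset[OF 1(1)]) auto
    show "continuous_on {y \<in> E. q y \<le> 1} (\<lambda>y i. q y / p y * y i)"
      by (rule continuous_on_subset[OF 1(2)]) auto
    show "(\<lambda>i. q (\<lambda>i. p y / q y * y i) / p (\<lambda>i. p y / q y * y i) * (p y / q y * y i)) = y"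
      if "y \<in> {y \<in> E. p y \<le> 1}" for y
    proof (cases "y = (\<lambda>_. 0)")
      case False
      have y: "y \<in> E" using that by simp
      have "p (\<lambda>i. p y / q y * y i) = p y / q y * p y" using p(3)[OF y, of "p y / q y"] nn[OF y] by simp
      then show ?thesis using q_eq[OF y] pos[OF y False] by (simp add: fun_eq_iff)
    qed auto
    show "(\<lambda>i. p (\<lambda>i. q y / p y * y i) / q (\<lambda>i. q y / p y * y i) * (q y / p y * y i)) = y"
      if "y \<in> {y \<in> E. q y \<le> 1}" for y
    proof (cases "y = (\<lambda>_. 0)")
      case False
      have y: "y \<in> E" using that by simp
      have "q (\<lambda>i. q y / p y * y i) = q y / p y * q y" using q(3)[OF y, of "q y / p y"] nn[OF y] by simp
      then show ?thesis using p_eq[OF y] pos[OF y False] by (simp add: fun_eq_iff)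
    qed auto
    show "(\<lambda>y i. p y / q y * y i) ` {y \<in> E. p y \<le> 1} \<subseteq> {y \<in> E. q y \<le> 1}"
    proof (rule image_subsetI)
      fix y assume "y \<in> {y \<in> E. p y \<le> 1}"
      then have y: "y \<in> E" "p y \<le> 1" by auto
      then show "(\<lambda>i. p y / q y * y i) \<in> {y \<in> E. q y \<le> 1}"
        unfolding mem_Collect_eq q_eq[OF y(1)] using E[OF y(1)] by blast
    qed
    show "(\<lambda>y i. q y / p y * y i) ` {y \<in> E. q y \<le> 1} \<subseteq> {y \<in> E. p y \<le> 1}"
    proof (rule image_subsetI)
      fix y assume "y \<in> {y \<in> E. q y \<le> 1}"
      then have y: "y \<in> E" "q y \<le> 1" by auto
      then show "(\<lambda>i. q y / p y * y i) \<in> {y \<in> E. p y \<le> 1}"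
        unfolding mem_Collect_eq p_eq[OF y(1)] using E[OF y(1)] by blast
    qed
  qed
  show "\<And>y. y \<in> E \<Longrightarrow> q (\<lambda>i. p y / q y * y i) = p y" by (rule q_eq)
qed

lemma continuous_on_coord [continuous_intros]: "continuous_on S (\<lambda>x. x i :: real)"
  by (rule continuous_on_subset[OF continuous_on_product_coordinates]) simp

text \<open>A point of the simplex is translated by its barycentre and the last coordinate is dropped;
  in these coordinates the simplex is the unit ball of the gauge \<open>p\<close>.\<close>

lemma simplex_homeomorphic_ball:
  fixes \<sigma> :: "'v set"
  assumes "card \<sigma> = d + 1" "1 \<le> d"
  shows "\<exists>h g. homeomorphism (realization (faces {\<sigma>})) (fcball d) h g \<and>
    (\<forall>x\<in>realization (faces {\<sigma>}). {v. x v \<noteq> 0} \<noteq> \<sigma> \<longrightarrow> (\<Sum>i<d. (h x i)\<^sup>2) = 1)"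
proof -
  have fin: "finite \<sigma>" using assms by (metis card.infinite add_is_0 one_neq_zero)
  then obtain e where e: "bij_betw e {..d} \<sigma>"
    using ex_bij_betw_nat_finite[of \<sigma>] assms(1) by (metis Suc_eq_plus1 atLeast0LessThan lessThan_Suc_atMost)
  \<comment> \<open>All \<open>d + 1\<close> translated barycentric coordinates: they sum to 0,
    which restores the dropped one.\<close>
  define w where "w = (\<lambda>(y::nat\<Rightarrow>real) i. if i < d then y i else - (\<Sum>j<d. y j))"
  define mn where "mn = (\<lambda>y. Min ((\<lambda>i. w y i) ` {..d}))"
  \<comment> \<open>Adding the barycentre back gives nonnegative coordinates iff \<open>mn y\<close>
    is at least -1 / (d + 1), that is, iff \<open>p y \<le> 1\<close>.\<close>
  define p where "p = (\<lambda>y. - (real (d + 1) * mn y))"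
  define q where "q = (\<lambda>y :: nat \<Rightarrow> real. sqrt (\<Sum>i<d. (y i)\<^sup>2))"
  let ?E = "{y :: nat \<Rightarrow> real. \<forall>i\<ge>d. y i = 0}"
  have wsum: "(\<Sum>i\<le>d. w y i) = 0" for y
  proof -
    have "(\<Sum>i\<le>d. w y i) = (\<Sum>i<d. w y i) + w y d" by (simp flip: lessThan_Suc_atMost)
    then show ?thesis by (simp add: w_def)
  qed
  have pmn: "- p y / (d + 1) = mn y" for y
  proof -
    have "real (d + 1) \<noteq> 0" by (simp only: of_nat_eq_0_iff)
    then show ?thesis unfolding p_def minus_minus by (rule nonzero_mult_div_cancel_left)
  qed
  have wge: "- p y / (d + 1) \<le> w y i" if "i \<le> d" for y i
    unfolding pmn using that by (simp add: mn_def)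
  \<comment> \<open>For numbers with sum zero a lower bound gives an upper bound: each is minus the
    sum of \<open>d\<close> others, all at least \<open>- p y / (d + 1)\<close>.\<close>
  have wabs: "\<bar>w y i\<bar> \<le> p y" if i: "i \<le> d" for y i
  proof -
    have "w y i + (\<Sum>j\<in>{..d} - {i}. w y j) = 0" using wsum[of y] i by (subst (asm) sum.remove[of _ i]) auto
    moreover have "(\<Sum>j\<in>{..d} - {i}. - p y / (d + 1)) \<le> (\<Sum>j\<in>{..d} - {i}. w y j)"
      by (rule sum_mono) (use wge in auto)
    moreover have "(\<Sum>j\<in>{..d} - {i}. - p y / (d + 1)) = - (real d / (d + 1)) * p y" using i by simp
    ultimately have 1: "w y i \<le> real d / (d + 1) * p y" by linarith
    have "- p y / (d + 1) \<le> real d / (d + 1) * p y" using 1 wge[OF i, of y] by linarith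
    then have "0 \<le> (real d / (d + 1) + 1 / (d + 1)) * p y" by (simp add: algebra_simps)
    moreover have "real d / (d + 1) + 1 / (d + 1) = 1" by (simp add: field_simps)
    ultimately have p0: "0 \<le> p y" by simp
    have "real d / (d + 1) * p y \<le> 1 * p y" by (rule mult_right_mono) (use p0 in auto)
    moreover have "- p y \<le> - p y / (d + 1)" using p0 by (simp add: field_simps)
    ultimately show ?thesis using 1 wge[OF i, of y] by linarith
  qed
  have pE: "\<bar>y i\<bar> \<le> p y" if "y \<in> ?E" for y i
    using wabs[of i y] wabs[of 0 y] that assms(2) by (cases "i < d") (auto simp: w_def)
  have qE: "\<bar>y i\<bar> \<le> q y" if "y \<in> ?E" for y i
  proof (cases "i < d")
    case True
    then have "(y i)\<^sup>2 \<le> (\<Sum>i<d. (y i)\<^sup>2)" by (intro member_le_sum) auto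
    then show ?thesis unfolding q_def by (metis real_sqrt_abs real_sqrt_le_mono)
  qed (use that in \<open>auto simp: q_def sum_nonneg\<close>)
  have ph: "p (\<lambda>i. c * y i) = c * p y" if "0 \<le> c" for c y
  proof -
    have "w (\<lambda>i. c * y i) i = c * w y i" for i by (simp add: w_def sum_distrib_left)
    then have "mn (\<lambda>i. c * y i) = Min ((*) c ` (\<lambda>i. w y i) ` {..d})"
      by (simp add: image_image mn_def)
    also have "\<dots> = c * mn y" unfolding mn_def
      by (rule mono_Min_commute[symmetric]) (use that in \<open>auto simp: mono_def mult_left_mono\<close>)
    finally show ?thesis by (simp add: p_def)
  qed
  have qh: "q (\<lambda>i. c * y i) = c * q y" if "0 \<le> c" for c y
    using that by (simp add: q_def power_mult_distrib sum_distrib_left[symmetric] real_sqrt_mult)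
  have cw: "continuous_on S (\<lambda>y. w y i)" for i S
    by (cases "i < d") (auto simp: w_def intro!: continuous_intros)
  have cp: "continuous_on ?E p" unfolding p_def mn_def
    by (intro continuous_intros continuous_on_Min_family cw) auto
  have cq: "continuous_on ?E q" unfolding q_def by (intro continuous_intros)
  note R = homeomorphism_rescale[where d = d and p = p and q = q, OF cp pE ph cq qE qh]
  have ball: "{y \<in> ?E. q y \<le> 1} = fcball d"
    by (auto simp: q_def fcball_def)
  define a where "a = (\<lambda>(x :: 'v \<Rightarrow> real) i. if i < d then x (e i) - 1 / (d + 1) else 0)"
  define b where "b = (\<lambda>y v. if v \<in> \<sigma> then w y (inv_into {..d} e v) + 1 / (d + 1) else 0)"
  have X: "realization (faces {\<sigma>}) = {x. (\<forall>v. 0 \<le> x v) \<and> {v. x v \<noteq> 0} \<subseteq> \<sigma> \<and> (\<Sum>v\<in>\<sigma>. x v) = 1}"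
    using realization_faces[of "{\<sigma>}"] fin by auto
  have sum_e: "(\<Sum>v\<in>\<sigma>. f v) = (\<Sum>i\<le>d. f (e i))" for f :: "'v \<Rightarrow> real"
    using sum.reindex_bij_betw[OF e, of f] by simp
  have inv_e: "inv_into {..d} e (e i) = i" if "i \<le> d" for i using e that by (simp add: bij_betw_def)
  have e_in: "e i \<in> \<sigma>" if "i \<le> d" for i using e that by (auto simp: bij_betw_def)
  have e_inv: "e (inv_into {..d} e v) = v" "inv_into {..d} e v \<le> d" if "v \<in> \<sigma>" for v
    using e that by (auto simp: bij_betw_def f_inv_into_f inv_into_into dest: inv_into_into[of v e "{..d}"])
  have wa: "w (a x) i = x (e i) - 1 / (d + 1)" if x: "x \<in> realization (faces {\<sigma>})" and i: "i \<le> d" for x i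
  proof (cases "i < d")
    case False
    have "1 = (\<Sum>i<d. x (e i)) + x (e d)" using x sum_e[of x] by (simp add: X flip: lessThan_Suc_atMost)
    moreover have "(\<Sum>i<d. a x i) = (\<Sum>i<d. x (e i)) - d / (d + 1)"
      by (simp add: a_def sum_subtractf)
    moreover have "real d / (d + 1) = 1 - 1 / (d + 1)" by (simp add: field_simps)
    ultimately show ?thesis using False i by (simp add: w_def)
  qed (simp add: w_def a_def)
  have p_le: "p y \<le> 1 \<longleftrightarrow> (\<forall>i\<le>d. - 1 / (d + 1) \<le> w y i)" for y
  proof -
    have "p y \<le> 1 \<longleftrightarrow> - 1 / (d + 1) \<le> mn y" by (auto simp: p_def field_simps)
    also have "\<dots> \<longleftrightarrow> (\<forall>i\<le>d. - 1 / (d + 1) \<le> w y i)" unfolding mn_def by (subst Min_ge_iff) auto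
    finally show ?thesis .
  qed
  have ab: "homeomorphism (realization (faces {\<sigma>})) {y \<in> ?E. p y \<le> 1} a b"
  proof (rule homeomorphismI)
    have "continuous_on S (\<lambda>x. a x i)" for i S
      by (cases "i < d") (auto simp: a_def intro!: continuous_intros)
    then show "continuous_on (realization (faces {\<sigma>})) a"
      by (rule continuous_on_coordinatewise_then_product)
    have "continuous_on S (\<lambda>y. b y v)" for v S
      by (cases "v \<in> \<sigma>") (auto simp: b_def intro!: continuous_intros cw)
    then show "continuous_on {y \<in> ?E. p y \<le> 1} b"
      by (rule continuous_on_coordinatewise_then_product)
    show "a ` realization (faces {\<sigma>}) \<subseteq> {y \<in> ?E. p y \<le> 1}"
    proof safe
      fix x assume x: "x \<in> realization (faces {\<sigma>})"
      show "p (a x) \<le> 1" unfolding p_le using wa[OF x] x by (auto simp: X)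
    qed (auto simp: a_def)
    show "b ` {y \<in> ?E. p y \<le> 1} \<subseteq> realization (faces {\<sigma>})"
    proof safe
      fix y assume y: "\<forall>i\<ge>d. y i = 0" "p y \<le> 1"
      have "0 \<le> b y v" for v
      proof (cases "v \<in> \<sigma>")
        case True
        then have "- 1 / (d + 1) \<le> w y (inv_into {..d} e v)" using y(2) e_inv(2) unfolding p_le by blast
        then show ?thesis using True by (simp add: b_def)
      qed (simp add: b_def)
      moreover have "(\<Sum>v\<in>\<sigma>. b y v) = 1"
      proof -
        have "(\<Sum>v\<in>\<sigma>. b y v) = (\<Sum>i\<le>d. w y i + 1 / (d + 1))"
          unfolding sum_e by (intro sum.cong) (auto simp: b_def e_in inv_e)
        also have "\<dots> = 1" by (simp add: sum.distrib wsum)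
        finally show ?thesis .
      qed
      ultimately show "b y \<in> realization (faces {\<sigma>})" unfolding X by (auto simp: b_def)
    qed
    show "b (a x) = x" if x: "x \<in> realization (faces {\<sigma>})" for x
    proof
      fix v show "b (a x) v = x v"
        using x wa[OF x e_inv(2), of v] e_inv(1)[of v] unfolding X by (auto simp: b_def)
    qed
    show "a (b y) = y" if "y \<in> {y \<in> ?E. p y \<le> 1}" for y
      using that by (auto simp: a_def b_def e_in inv_e w_def fun_eq_iff)
  qed
  have p1: "p (a x) = 1" if x: "x \<in> realization (faces {\<sigma>})" "{v. x v \<noteq> 0} \<noteq> \<sigma>" for x
  proof -
    obtain v where v: "v \<in> \<sigma>" "x v = 0" using x by (auto simp: X)
    have "p (a x) \<le> 1" using ab x(1) by (auto simp: homeomorphism_def)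
    moreover have "w (a x) (inv_into {..d} e v) = - 1 / (d + 1)"
      using wa[OF x(1) e_inv(2)[OF v(1)]] e_inv(1)[OF v(1)] v by simp
    then have "1 \<le> p (a x)" using wge[OF e_inv(2)[OF v(1)], of "a x"] by (simp add: field_simps)
    ultimately show ?thesis by simp
  qed
  let ?h = "(\<lambda>y i. p y / q y * y i) \<circ> a"
  have "homeomorphism (realization (faces {\<sigma>})) (fcball d) ?h (b \<circ> (\<lambda>y i. q y / p y * y i))"
    unfolding ball[symmetric] by (rule homeomorphism_compose[OF ab R(1)]) auto
  moreover have "(\<Sum>i<d. (?h x i)\<^sup>2) = 1" if x: "x \<in> realization (faces {\<sigma>})" "{v. x v \<noteq> 0} \<noteq> \<sigma>" for x
  proof -
    have "a x \<in> ?E" by (auto simp: a_def)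
    then have "q (?h x) = 1" using R(2)[of "a x"] p1[OF x] by simp
    then show ?thesis by (simp add: q_def)
  qed
  ultimately show ?thesis by blast
qed

section \<open>Stacked complexes are balls\<close>

text \<open>Faces with fewer than \<open>d\<close> vertices enter without further condition: in a
  stacked complex none of them is interior, which is condition (ii).\<close>

definition bdry :: "nat \<Rightarrow> 'v set set \<Rightarrow> 'v set set" where
  "bdry d F = {\<rho> \<in> faces F. card \<rho> < d \<or> (card \<rho> = d \<and> (\<exists>!\<sigma>\<in>F. \<rho> \<subseteq> \<sigma>))}"

lemma stacked_props:
  assumes "stacked d R F" "1 \<le> d"
  shows "finite F \<and> F \<noteq> {} \<and> (\<forall>\<sigma>\<in>F. finite \<sigma> \<and> card \<sigma> = d + 1) \<and> finite R \<and> card R = d \<and> (\<exists>!\<sigma>\<in>F. R \<subseteq> \<sigma>)"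
  using assms(1)
proof induction
  case (step F \<sigma> \<tau> w)
  have fin: "finite \<tau>" using step assms by (metis card.infinite not_one_le_zero)
  have w: "w \<notin> \<tau>" using step by blast
  have "\<not> R \<subseteq> insert w \<tau>"
  proof
    assume R: "R \<subseteq> insert w \<tau>"
    have "w \<notin> R" using step by blast
    then have "R \<subseteq> \<tau>" using R by auto
    then show False using step fin by (metis card_subset_eq)
  qed
  then have "\<exists>!\<sigma>'. \<sigma>' \<in> insert (insert w \<tau>) F \<and> R \<subseteq> \<sigma>'" using step.IH by blast
  then show ?case using step fin w by simp
qed auto

lemma Min_image_add:
  fixes f :: "'a \<Rightarrow> real"
  assumes "finite A" "A \<noteq> {}" shows "Min ((\<lambda>a. f a + c) ` A) = Min (f ` A) + c"
  using Min_add_commute[OF assms, of f c] by simp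

text \<open>Along the direction from the apex \<open>u\<close> to the barycentre of \<open>\<tau>\<close>, every line through the
  bipyramid over \<open>\<tau>\<close> is compressed affinely onto its part in \<open>insert u \<tau>\<close>. The map fixes the other
  faces of \<open>insert u \<tau>\<close>, so that it extends by the identity.\<close>

definition push_in :: "nat \<Rightarrow> 'v set \<Rightarrow> 'v \<Rightarrow> 'v \<Rightarrow> ('v \<Rightarrow> real) \<Rightarrow> 'v \<Rightarrow> real" where
  "push_in d \<tau> u w x v =
     (if v \<in> \<tau> then x v + (x w / d - Min (x ` \<tau>) / 2)
      else if v = u then x u + d * Min (x ` \<tau>) / 2 else if v = w then 0 else x v)"

definition push_out :: "nat \<Rightarrow> 'v set \<Rightarrow> 'v \<Rightarrow> 'v \<Rightarrow> ('v \<Rightarrow> real) \<Rightarrow> 'v \<Rightarrow> real" where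
  "push_out d \<tau> u w z v =
     (if v \<in> \<tau> then z v + (2 * min (z u) (d * Min (z ` \<tau>)) / d - Min (z ` \<tau>))
      else if v = u then max (z u - d * Min (z ` \<tau>)) 0
      else if v = w then max (d * Min (z ` \<tau>) - z u) 0 else z v)"

context
  fixes d :: nat and \<tau> :: "'v set" and u w :: 'v
  assumes \<tau>: "finite \<tau>" "card \<tau> = d" "1 \<le> d" and uw: "u \<notin> \<tau>" "w \<notin> \<tau>" "u \<noteq> w"
begin

lemma \<tau>_ne: "\<tau> \<noteq> {}" using \<tau> by auto

lemma continuous_on_push: "continuous_on S (push_in d \<tau> u w)" "continuous_on S (push_out d \<tau> u w)"
proof -
  have m: "continuous_on S (\<lambda>x :: 'v \<Rightarrow> real. Min (x ` \<tau>))" for S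
    using continuous_on_Min_family[OF \<tau>(1) \<tau>_ne, of S "\<lambda>v x. x v"] by (simp add: continuous_intros)
  have "continuous_on S (\<lambda>x. push_in d \<tau> u w x v)" for v
    unfolding push_in_def using \<tau>(3)
    by (cases "v \<in> \<tau>"; cases "v = u"; cases "v = w") (auto intro!: continuous_intros m)
  then show "continuous_on S (push_in d \<tau> u w)" by (rule continuous_on_coordinatewise_then_product)
  have "continuous_on S (\<lambda>x. push_out d \<tau> u w x v)" for v
    unfolding push_out_def using \<tau>(3)
    by (cases "v \<in> \<tau>"; cases "v = u"; cases "v = w") (auto intro!: continuous_intros m continuous_on_min continuous_on_max)
  then show "continuous_on S (push_out d \<tau> u w)" by (rule continuous_on_coordinatewise_then_product)
qed

lemma push_in_simps:
  fixes x :: "'v \<Rightarrow> real"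
  shows "v \<in> \<tau> \<Longrightarrow> push_in d \<tau> u w x v = x v + (x w / d - Min (x ` \<tau>) / 2)"
  "push_in d \<tau> u w x u = x u + d * Min (x ` \<tau>) / 2" "push_in d \<tau> u w x w = 0"
  "Min (push_in d \<tau> u w x ` \<tau>) = x w / d + Min (x ` \<tau>) / 2"
proof -
  have "push_in d \<tau> u w x ` \<tau> = (\<lambda>v. x v + (x w / d - Min (x ` \<tau>) / 2)) ` \<tau>"
    by (intro image_cong) (auto simp: push_in_def)
  then show "Min (push_in d \<tau> u w x ` \<tau>) = x w / d + Min (x ` \<tau>) / 2"
    using Min_image_add[OF \<tau>(1) \<tau>_ne, of x] by simp
qed (use uw in \<open>auto simp: push_in_def\<close>)

lemma push_out_simps:
  fixes z :: "'v \<Rightarrow> real"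
  shows "v \<in> \<tau> \<Longrightarrow> push_out d \<tau> u w z v = z v + (2 * min (z u) (d * Min (z ` \<tau>)) / d - Min (z ` \<tau>))"
  "push_out d \<tau> u w z u = max (z u - d * Min (z ` \<tau>)) 0"
  "push_out d \<tau> u w z w = max (d * Min (z ` \<tau>) - z u) 0"
  "Min (push_out d \<tau> u w z ` \<tau>) = 2 * min (z u) (d * Min (z ` \<tau>)) / d"
proof -
  have "push_out d \<tau> u w z ` \<tau> = (\<lambda>v. z v + (2 * min (z u) (d * Min (z ` \<tau>)) / d - Min (z ` \<tau>))) ` \<tau>"
    by (intro image_cong) (auto simp: push_out_def)
  then show "Min (push_out d \<tau> u w z ` \<tau>) = 2 * min (z u) (d * Min (z ` \<tau>)) / d"
    using Min_image_add[OF \<tau>(1) \<tau>_ne, of z] by simp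
qed (use uw in \<open>auto simp: push_out_def\<close>)

text \<open>Let m and m' be the minima over \<open>\<tau>\<close> of \<open>x\<close> and of its
  image z. Then m' = x w / d + m / 2 and z u = x u + d m / 2, so d m' - z u = x w - x u. As one of
  \<open>x u\<close> and \<open>x w\<close> is 0, both are positive parts of this difference up to
  sign, and the smaller of z u and d m' is d m / 2, which recovers m.\<close>

lemma push_out_in:
  fixes x :: "'v \<Rightarrow> real"
  assumes "0 \<le> x u" "0 \<le> x w" "x u = 0 \<or> x w = 0" "\<And>v. 0 \<le> x v"
  shows "push_out d \<tau> u w (push_in d \<tau> u w x) = x"
proof
  fix v
  define m where "m = Min (x ` \<tau>)"
  have d: "real d > 0" using \<tau> by simp
  have c: "real d * (x w / d + m / 2) = x w + d * m / 2" using d by (simp add: field_simps)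
  have mn: "min (x u + d * m / 2) (x w + d * m / 2) = d * m / 2" using assms by auto
  consider "v \<in> \<tau>" | "v = u" | "v = w" | "v \<notin> \<tau>" "v \<noteq> u" "v \<noteq> w" by blast
  then show "push_out d \<tau> u w (push_in d \<tau> u w x) v = x v"
  proof cases
    case 1
    have "2 * (d * m / 2) / d = m" using d by simp
    then show ?thesis
      using 1 by (simp only: push_out_simps push_in_simps c mn flip: m_def; simp)
  next
    case 2
    then show ?thesis using assms by (simp only: push_out_simps push_in_simps c mn flip: m_def; auto)
  next
    case 3
    then show ?thesis using assms by (simp only: push_out_simps push_in_simps c mn flip: m_def; auto)
  qed (simp add: push_in_def push_out_def)
qed

lemma push_in_out:
  fixes z :: "'v \<Rightarrow> real"
  assumes "z w = 0"
  shows "push_in d \<tau> u w (push_out d \<tau> u w z) = z"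
proof
  fix v
  define m where "m = Min (z ` \<tau>)"
  have d: "real d > 0" using \<tau> by simp
  consider "v \<in> \<tau>" | "v = u" | "v = w" | "v \<notin> \<tau>" "v \<noteq> u" "v \<noteq> w" by blast
  then show "push_in d \<tau> u w (push_out d \<tau> u w z) v = z v"
  proof cases
    case 1
    have "max (d * m - z u) 0 + min (z u) (d * m) = d * m" by auto
    then have "(max (d * m - z u) 0 + min (z u) (d * m)) / d = m" using d by simp
    then have "max (d * m - z u) 0 / d + min (z u) (d * m) / d = m" by (simp only: add_divide_distrib)
    then show ?thesis using 1 by (simp only: push_out_simps push_in_simps flip: m_def; simp)
  next
    case 2
    have "d * (2 * min (z u) (d * m) / d) / 2 = min (z u) (d * m)" using d by simp
    then show ?thesis using 2 by (simp only: push_out_simps push_in_simps flip: m_def; auto)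
  next
    case 3
    then show ?thesis using assms by (simp only: push_in_simps)
  qed (simp add: push_in_def push_out_def)
qed

lemma push_in_id:
  fixes x :: "'v \<Rightarrow> real"
  assumes "v0 \<in> \<tau>" "x v0 = 0" "\<And>v. 0 \<le> x v" "x w = 0" shows "push_in d \<tau> u w x = x"
proof -
  have "Min (x ` \<tau>) = 0" using assms \<tau>(1) by (intro Min_eqI) force+
  then show ?thesis using assms(4) by (auto simp: push_in_def)
qed

lemma push_out_id:
  fixes x :: "'v \<Rightarrow> real"
  assumes "v0 \<in> \<tau>" "x v0 = 0" "\<And>v. 0 \<le> x v" "x w = 0" shows "push_out d \<tau> u w x = x"
proof -
  have "Min (x ` \<tau>) = 0" using assms \<tau>(1) by (intro Min_eqI) force+
  then show ?thesis using assms(3)[of u] assms(4) by (auto simp: push_out_def max_def min_def)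
qed

text \<open>A facet other than the two at \<open>\<tau>\<close> misses a vertex of
  \<open>\<tau>\<close>, because \<open>insert u \<tau>\<close> is the only old facet containing
  \<open>\<tau>\<close>. On it the minimum over \<open>\<tau>\<close> is 0 and both maps are the
  identity. On the two facets at \<open>\<tau>\<close> it remains to check signs and the total
  mass.\<close>

lemma homeomorphism_push:
  assumes F: "\<forall>\<sigma>\<in>F. finite \<sigma>" "insert u \<tau> \<in> F" "\<forall>\<rho>\<in>F. \<tau> \<subseteq> \<rho> \<longrightarrow> \<rho> = insert u \<tau>" "w \<notin> \<Union>F"
  shows "homeomorphism (realization (faces (insert (insert w \<tau>) F))) (realization (faces F))
     (push_in d \<tau> u w) (push_out d \<tau> u w)"
proof -
  let ?X = "realization (faces (insert (insert w \<tau>) F))" and ?Z = "realization (faces F)"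
  let ?g = "push_in d \<tau> u w" and ?k = "push_out d \<tau> u w"
  have d: "real d > 0" using \<tau> by simp
  have F': "\<forall>\<sigma>\<in>insert (insert w \<tau>) F. finite \<sigma>" using F \<tau> by auto
  have X: "?X = {x. (\<forall>v. 0 \<le> x v) \<and> (\<exists>\<sigma>\<in>insert (insert w \<tau>) F. {v. x v \<noteq> 0} \<subseteq> \<sigma> \<and> (\<Sum>v\<in>\<sigma>. x v) = 1)}"
    by (rule realization_faces[OF F'])
  have Z: "?Z = {x. (\<forall>v. 0 \<le> x v) \<and> (\<exists>\<sigma>\<in>F. {v. x v \<noteq> 0} \<subseteq> \<sigma> \<and> (\<Sum>v\<in>\<sigma>. x v) = 1)}"
    by (rule realization_faces[OF F(1)])
  have minle: "Min (x ` \<tau>) \<le> x v" if "v \<in> \<tau>" for x :: "'v \<Rightarrow> real" and v using that \<tau> by simp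
  have min0: "0 \<le> Min (x ` \<tau>)" if "\<And>v. 0 \<le> x v" for x :: "'v \<Rightarrow> real" using that \<tau> \<tau>_ne by simp
  have suZ: "z \<in> ?Z" if "\<And>v. 0 \<le> z v" "{v. z v \<noteq> 0} \<subseteq> insert u \<tau>" "z u + (\<Sum>v\<in>\<tau>. z v) = 1" for z
    using that F(2) \<tau>(1) uw(1) unfolding Z by (auto intro!: bexI[of _ "insert u \<tau>"])
  have in_Z: "?g x \<in> ?Z" and xuw: "x u = 0 \<or> x w = 0" if x: "x \<in> ?X" for x
  proof -
    have nn: "\<And>v. 0 \<le> x v" using x by (auto simp: X)
    obtain \<sigma> where s: "\<sigma> \<in> insert (insert w \<tau>) F" "{v. x v \<noteq> 0} \<subseteq> \<sigma>" "(\<Sum>v\<in>\<sigma>. x v) = 1" using x by (auto simp: X)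
    show "x u = 0 \<or> x w = 0" using s F(4) uw by auto
    have main: "?g x \<in> ?Z" if "{v. x v \<noteq> 0} \<subseteq> insert u (insert w \<tau>)" "x u + x w + (\<Sum>v\<in>\<tau>. x v) = 1"
    proof (rule suZ)
      show "0 \<le> ?g x v" for v
      proof -
        have "0 \<le> x w / d" using nn[of w] d by simp
        then show ?thesis using nn[of v] nn[of u] minle[of v x] min0[of x, OF nn]
          by (cases "v \<in> \<tau>") (auto simp: push_in_def)
      qed
      show "{v. ?g x v \<noteq> 0} \<subseteq> insert u \<tau>" using that(1) by (auto simp: push_in_def)
      have "(\<Sum>v\<in>\<tau>. ?g x v) = (\<Sum>v\<in>\<tau>. x v + (x w / d - Min (x ` \<tau>) / 2))"
        by (intro sum.cong) (auto simp: push_in_def)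
      also have "\<dots> = (\<Sum>v\<in>\<tau>. x v) + d * (x w / d - Min (x ` \<tau>) / 2)" using \<tau> by (simp add: sum.distrib)
      also have "d * (x w / d - Min (x ` \<tau>) / 2) = x w - d * Min (x ` \<tau>) / 2" using d by (simp add: field_simps)
      finally show "?g x u + (\<Sum>v\<in>\<tau>. ?g x v) = 1" using that(2) unfolding push_in_simps by simp
    qed
    show "?g x \<in> ?Z"
    proof (cases "\<sigma> = insert w \<tau> \<or> \<sigma> = insert u \<tau>")
      case True
      then show ?thesis
      proof
        assume "\<sigma> = insert w \<tau>"
        moreover from this have "x u = 0" using s uw by auto
        ultimately show ?thesis using main s \<tau> uw by auto
      next
        assume "\<sigma> = insert u \<tau>"
        moreover from this have "x w = 0" using s uw by auto
        ultimately show ?thesis using main s \<tau> uw by auto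
      qed
    next
      case False
      then obtain v0 where "v0 \<in> \<tau>" "v0 \<notin> \<sigma>" and sF: "\<sigma> \<in> F" using s F(3) by blast
      moreover have "x v0 = 0" "x w = 0" using s \<open>v0 \<notin> \<sigma>\<close> F(4) sF by auto
      ultimately have "?g x = x" using push_in_id nn by blast
      then show ?thesis using sF s nn by (auto simp: Z)
    qed
  qed
  have in_X: "?k z \<in> ?X" and zw: "z w = 0" if z: "z \<in> ?Z" for z
  proof -
    have nn: "\<And>v. 0 \<le> z v" using z by (auto simp: Z)
    obtain \<sigma> where s: "\<sigma> \<in> F" "{v. z v \<noteq> 0} \<subseteq> \<sigma>" "(\<Sum>v\<in>\<sigma>. z v) = 1" using z by (auto simp: Z)
    show zw: "z w = 0" using s F(4) by auto
    show "?k z \<in> ?X"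
    proof (cases "\<sigma> = insert u \<tau>")
      case True
      define m where "m = Min (z ` \<tau>)"
      define M where "M = min (z u) (d * m)"
      have m0: "0 \<le> m" using min0[of z, OF nn] by (simp add: m_def)
      have M0: "0 \<le> M" using m0 nn by (simp add: M_def)
      have k: "?k z v = z v + (2 * M / d - m)" if "v \<in> \<tau>" for v unfolding m_def M_def by (rule push_out_simps(1)[OF that])
      have ku: "?k z u = max (z u - d * m) 0" and kw: "?k z w = max (d * m - z u) 0"
        unfolding push_out_simps m_def by simp_all
      have sup: "?k z v = 0" if "v \<notin> insert u (insert w \<tau>)" for v using that s True by (auto simp: push_out_def)
      have knn: "0 \<le> ?k z v" for v
      proof -
        have "0 \<le> 2 * M / d" using M0 d by simp
        then have "v \<in> \<tau> \<Longrightarrow> 0 \<le> ?k z v" using k[of v] minle[of v z] unfolding m_def[symmetric] by simp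
        then show ?thesis using ku kw sup by (cases "v \<in> insert u (insert w \<tau>)") auto
      qed
      have "(\<Sum>v\<in>\<tau>. ?k z v) = (\<Sum>v\<in>\<tau>. z v + (2 * M / d - m))" by (intro sum.cong) (auto simp: k)
      also have "\<dots> = (\<Sum>v\<in>\<tau>. z v) + d * (2 * M / d - m)" using \<tau> by (simp add: sum.distrib)
      also have "d * (2 * M / d - m) = 2 * M - d * m" using d by (simp add: field_simps)
      finally have ks: "(\<Sum>v\<in>\<tau>. ?k z v) = 1 - z u + 2 * M - d * m" using s(3) True \<tau> uw by simp
      show ?thesis
      proof (cases "d * m \<le> z u")
        case True
        then have "?k z w = 0" using kw by simp
        then have "v \<in> insert u \<tau>" if "?k z v \<noteq> 0" for v using sup[of v] that by (cases "v = w") auto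
        then have "{v. ?k z v \<noteq> 0} \<subseteq> insert u \<tau>" by blast
        moreover have "(\<Sum>v\<in>insert u \<tau>. ?k z v) = 1" using ks ku True \<tau> uw by (simp add: M_def)
        ultimately show ?thesis using knn F(2) unfolding X by blast
      next
        case False
        then have "?k z u = 0" using ku by simp
        then have "v \<in> insert w \<tau>" if "?k z v \<noteq> 0" for v using sup[of v] that by (cases "v = u") auto
        then have "{v. ?k z v \<noteq> 0} \<subseteq> insert w \<tau>" by blast
        moreover have "(\<Sum>v\<in>insert w \<tau>. ?k z v) = 1" using ks kw False \<tau> uw by (simp add: M_def)
        ultimately show ?thesis using knn unfolding X by blast
      qed
    next
      case False
      then obtain v0 where v0: "v0 \<in> \<tau>" "v0 \<notin> \<sigma>" using s F(3) by blast
      moreover have "z v0 = 0" using s v0 by auto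
      ultimately have "?k z = z" using push_out_id[of v0 z] nn zw by blast
      then show ?thesis using s nn by (auto simp: X)
    qed
  qed
  show ?thesis
  proof (rule homeomorphismI)
    show "?k (?g x) = x" if "x \<in> ?X" for x
      by (rule push_out_in) (use that xuw in \<open>auto simp: X\<close>)
    show "?g (?k z) = z" if "z \<in> ?Z" for z by (rule push_in_out) (rule zw[OF that])
  qed (use in_Z in_X continuous_on_push in auto)
qed

end

text \<open>The clause on \<open>bdry\<close> is carried through the induction because condition
  (ii) and the marking both ask for points on the sphere. It persists since \<open>push_in\<close>
  sends points with support in the new \<open>bdry\<close> to points with support in the old
  one.\<close>

theorem stacked_ball:
  assumes "stacked d R F" "1 \<le> d"
  shows "\<exists>h g. homeomorphism (realization (faces F)) (fcball d) h g \<and>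
    (\<forall>x\<in>realization (faces F). {v. x v \<noteq> 0} \<in> bdry d F \<longrightarrow> (\<Sum>i<d. (h x i)\<^sup>2) = 1)"
  using assms(1)
proof induction
  case (base w)
  have c: "card (insert w R) = d + 1" using base by simp
  obtain h g where "homeomorphism (realization (faces {insert w R})) (fcball d) h g"
    "\<forall>x\<in>realization (faces {insert w R}). {v. x v \<noteq> 0} \<noteq> insert w R \<longrightarrow> (\<Sum>i<d. (h x i)\<^sup>2) = 1"
    using simplex_homeomorphic_ball[OF c assms(2)] by blast
  moreover have "insert w R \<notin> bdry d {insert w R}" using c by (simp add: bdry_def)
  ultimately show ?case by metis
next
  case (step F \<sigma> \<tau> w)
  obtain h g where hg: "homeomorphism (realization (faces F)) (fcball d) h g"
    and bd: "\<forall>x\<in>realization (faces F). {v. x v \<noteq> 0} \<in> bdry d F \<longrightarrow> (\<Sum>i<d. (h x i)\<^sup>2) = 1"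
    using step.IH by blast
  have P: "finite F" "\<forall>\<sigma>\<in>F. finite \<sigma>" "\<forall>\<sigma>\<in>F. card \<sigma> = d + 1" using stacked_props[OF step.hyps(1) assms(2)] by simp_all
  have \<tau>: "finite \<tau>" "card \<tau> = d" using step.hyps(2,3,4) P by (auto intro: finite_subset)
  have \<tau>ne: "\<tau> \<noteq> {}" using \<tau> assms by auto
  obtain u where u: "u \<in> \<sigma>" "\<tau> = \<sigma> - {u}"
    by (rule subset_card_pred[of \<sigma> \<tau>]) (use step.hyps(2,3,4) P in auto)
  have \<sigma>: "\<sigma> = insert u \<tau>" using u by auto
  have uw: "u \<notin> \<tau>" "w \<notin> \<tau>" "u \<noteq> w" using u step.hyps(2,7) by auto
  let ?F' = "insert (insert w \<tau>) F" and ?g = "push_in d \<tau> u w"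
  have H: "homeomorphism (realization (faces ?F')) (realization (faces F)) ?g (push_out d \<tau> u w)"
    by (rule homeomorphism_push[OF \<tau> assms(2) uw P(2)]) (use step.hyps(2,6,7) in \<open>simp_all add: \<sigma>\<close>)
  have "(\<Sum>i<d. ((h \<circ> ?g) x i)\<^sup>2) = 1" if x: "x \<in> realization (faces ?F')" and b: "{v. x v \<noteq> 0} \<in> bdry d ?F'" for x
  proof -
    let ?\<rho> = "{v. x v \<noteq> 0}"
    have nn: "\<And>v. 0 \<le> x v" using x by (auto simp: realization_def)
    have gx: "?g x \<in> realization (faces F)" using H x by (auto simp: homeomorphism_def)
    have \<rho>: "?\<rho> \<noteq> {}" "card ?\<rho> \<le> d" using b by (auto simp: bdry_def faces_def)
    obtain \<sigma>1 where s1: "\<sigma>1 \<in> ?F'" "?\<rho> \<subseteq> \<sigma>1" using b by (auto simp: bdry_def faces_def)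
    have fr: "finite ?\<rho>" using s1 P \<tau> by (auto intro: finite_subset)
    have "{v. ?g x v \<noteq> 0} \<in> bdry d F"
    proof (cases "x w = 0")
      case True
      have "\<exists>\<sigma>2\<in>F. ?\<rho> \<subseteq> \<sigma>2"
      proof (cases "\<sigma>1 \<in> F")
        case False
        then have "?\<rho> \<subseteq> \<tau>" using s1 True by auto
        then show ?thesis using \<sigma> step.hyps(2) by blast
      qed (use s1 in blast)
      then obtain \<sigma>2 where s2: "\<sigma>2 \<in> F" "?\<rho> \<subseteq> \<sigma>2" by blast
      \<comment> \<open>After the gluing \<open>\<tau>\<close> lies in two facets and has become
        interior, so a boundary face without \<open>w\<close> misses a vertex of
        \<open>\<tau>\<close>.\<close>
      have neq: "?\<rho> \<noteq> \<tau>"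
      proof
        assume eq: "?\<rho> = \<tau>"
        then have "\<exists>!\<sigma>'. \<sigma>' \<in> ?F' \<and> \<tau> \<subseteq> \<sigma>'" using b \<tau> by (auto simp: bdry_def)
        moreover have "\<sigma> \<in> ?F'" "\<tau> \<subseteq> \<sigma>" "insert w \<tau> \<in> ?F'" "\<tau> \<subseteq> insert w \<tau>" using step.hyps(2,3) by auto
        ultimately have "\<sigma> = insert w \<tau>" by blast
        then show False using step.hyps(2,7) by blast
      qed
      have "\<not> \<tau> \<subseteq> ?\<rho>" using neq \<rho>(2) \<tau> fr by (metis card_subset_eq card_mono le_antisym)
      then obtain v0 where "v0 \<in> \<tau>" "x v0 = 0" by blast
      then have "?g x = x" using push_in_id[OF \<tau> assms(2) uw] nn True by blast
      moreover have "?\<rho> \<in> bdry d F"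
      proof -
        have "?\<rho> \<in> faces F" using \<rho> s2 by (auto simp: faces_def)
        moreover have "\<exists>!\<sigma>'. \<sigma>' \<in> F \<and> ?\<rho> \<subseteq> \<sigma>'" if "card ?\<rho> = d"
        proof -
          have "\<exists>!\<sigma>'. \<sigma>' \<in> ?F' \<and> ?\<rho> \<subseteq> \<sigma>'" using b that by (auto simp: bdry_def)
          then show ?thesis using s2 by blast
        qed
        ultimately show ?thesis using \<rho>(2) le_neq_implies_less unfolding bdry_def by blast
      qed
      ultimately show ?thesis by simp
    next
      case False
      have s1: "\<sigma>1 = insert w \<tau>" using s1 False step.hyps(7) by blast
      have "card (insert w \<tau>) = Suc d" using \<tau> uw by simp
      then have "?\<rho> \<noteq> insert w \<tau>" using \<rho>(2) by (metis Suc_n_not_le_n)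
      moreover have sub: "?\<rho> \<subseteq> insert w \<tau>" using \<open>?\<rho> \<subseteq> \<sigma>1\<close> s1 by simp
      ultimately obtain v where "v \<in> insert w \<tau>" "v \<notin> ?\<rho>" by blast
      with False obtain v0 where v0: "v0 \<in> \<tau>" "x v0 = 0" by auto
      have m: "Min (x ` \<tau>) = 0" using v0 nn \<tau> by (intro Min_eqI) force+
      have xu: "x v = 0" if "v \<notin> insert w \<tau>" for v using sub that by blast
      have "0 < x w / d" using False nn[of w] assms(2) by simp
      then have pos: "0 < x v + x w / d" for v using nn[of v] by linarith
      \<comment> \<open>The minimum over \<open>\<tau>\<close> is 0, so \<open>u\<close> receives
        nothing, while the mass of \<open>w\<close> is spread evenly over \<open>\<tau>\<close>:
        boundary faces through \<open>w\<close> are flattened into the old boundary wall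
        \<open>\<tau>\<close>.\<close>
      have "{v. ?g x v \<noteq> 0} = \<tau>"
        using xu uw pos by (auto simp: push_in_def m less_imp_neq[symmetric])
      moreover have "\<tau> \<in> bdry d F"
      proof -
        have "\<exists>!\<sigma>'. \<sigma>' \<in> F \<and> \<tau> \<subseteq> \<sigma>'" using step.hyps(2,3,6) by blast
        then show ?thesis using \<tau> \<tau>ne step.hyps(2,3) by (auto simp: bdry_def faces_def)
      qed
      ultimately show ?thesis by simp
    qed
    then show ?thesis using bd gx by simp
  qed
  then show ?case using homeomorphism_compose[OF H hg] by blast
qed

theorem stacked_fuss_catalan:
  assumes "stacked d R F" "2 \<le> d"
  shows "fuss_catalan_complex d (card F) (faces F)" "R \<in> faces F"
    "closed_simplex (faces F) R \<subseteq> ball_boundary d (faces F)" "facets d (faces F) = F"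
proof -
  have d: "1 \<le> d" using assms by simp
  have P: "finite F" "F \<noteq> {}" "\<forall>\<sigma>\<in>F. finite \<sigma>" "\<forall>\<sigma>\<in>F. card \<sigma> = d + 1" "finite R" "card R = d" "\<exists>!\<sigma>. \<sigma> \<in> F \<and> R \<subseteq> \<sigma>"
    using stacked_props[OF assms(1) d] by auto
  obtain h g where hg: "homeomorphism (realization (faces F)) (fcball d) h g"
    and bd: "\<forall>x\<in>realization (faces F). {v. x v \<noteq> 0} \<in> bdry d F \<longrightarrow> (\<Sum>i<d. (h x i)\<^sup>2) = 1"
    using stacked_ball[OF assms(1) d] by blast
  have supp: "{v. x v \<noteq> 0} \<in> faces F" if "x \<in> realization (faces F)" for x using that by (simp add: realization_def)
  have in_bd: "x \<in> ball_boundary d (faces F)" if "x \<in> realization (faces F)" "{v. x v \<noteq> 0} \<in> bdry d F" for x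
    unfolding ball_boundary_eq using hg bd that by blast
  show "R \<in> faces F" using P d by (auto simp: faces_def)
  show fac: "facets d (faces F) = F"
  proof -
    have "\<sigma> \<in> F" if s: "\<sigma> \<in> faces F" "card \<sigma> = d + 1" for \<sigma>
    proof -
      obtain \<rho> where "\<rho> \<in> F" "\<sigma> \<subseteq> \<rho>" using s by (auto simp: faces_def)
      then have "\<sigma> = \<rho>" using P s by (metis card_subset_eq)
      then show ?thesis using \<open>\<rho> \<in> F\<close> by simp
    qed
    moreover have "\<sigma> \<in> faces F" if "\<sigma> \<in> F" for \<sigma> using that P by (auto simp: faces_def)
    ultimately show ?thesis using P by (auto simp: facets_def)
  qed
  show "closed_simplex (faces F) R \<subseteq> ball_boundary d (faces F)"
  proof
    fix x assume "x \<in> closed_simplex (faces F) R"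
    then have x: "x \<in> realization (faces F)" "{v. x v \<noteq> 0} \<subseteq> R" by (auto simp: closed_simplex_def)
    have "{v. x v \<noteq> 0} = R \<or> card {v. x v \<noteq> 0} < d" using x P by (metis psubsetI psubset_card_mono)
    then have "{v. x v \<noteq> 0} \<in> bdry d F" using supp[OF x(1)] P by (auto simp: bdry_def)
    then show "x \<in> ball_boundary d (faces F)" using in_bd x by blast
  qed
  have fin: "finite (faces F)"
  proof (rule finite_subset)
    show "faces F \<subseteq> Pow (\<Union>F)" by (auto simp: faces_def)
  qed (use P in auto)
  have fs: "finite \<sigma>" "\<sigma> \<noteq> {}" "card \<sigma> \<le> d + 1" if s: "\<sigma> \<in> faces F" for \<sigma>
  proof -
    obtain \<rho> where r: "\<rho> \<in> F" "\<sigma> \<subseteq> \<rho>" using s by (auto simp: faces_def)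
    show "finite \<sigma>" using r P(3) finite_subset by blast
    show "\<sigma> \<noteq> {}" using s by (simp add: faces_def)
    show "card \<sigma> \<le> d + 1" using r P(3,4) card_mono by metis
  qed
  have "\<forall>\<sigma>\<in>faces F. \<forall>\<rho>. \<rho> \<noteq> {} \<and> \<rho> \<subseteq> \<sigma> \<longrightarrow> \<rho> \<in> faces F"
    unfolding faces_def by blast
  then have "abstract_complex (faces F)" unfolding abstract_complex_def
    using fin fs(1,2) by (intro conjI) blast+
  moreover have "card F \<ge> 1" using P by (simp add: Suc_leI card_gt_0_iff)
  moreover have "realization_top (faces F) homeomorphic_space closed_ball_top d"
    unfolding realization_top_eq closed_ball_top_eq homeomorphic_space_euclidean using hg by blast
  moreover have "closed_simplex (faces F) \<sigma> \<subseteq> ball_boundary d (faces F)" if s: "\<sigma> \<in> faces F" "card \<sigma> \<le> d - 1" for \<sigma>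
  proof
    fix x assume "x \<in> closed_simplex (faces F) \<sigma>"
    then have x: "x \<in> realization (faces F)" "{v. x v \<noteq> 0} \<subseteq> \<sigma>" by (auto simp: closed_simplex_def)
    have "card {v. x v \<noteq> 0} \<le> card \<sigma>" by (rule card_mono[OF fs(1)[OF s(1)] x(2)])
    then have "card {v. x v \<noteq> 0} < d" using s(2) assms(2) by linarith
    then have "{v. x v \<noteq> 0} \<in> bdry d F" using supp[OF x(1)] by (simp add: bdry_def)
    then show "x \<in> ball_boundary d (faces F)" using in_bd x by blast
  qed
  moreover have "\<forall>\<sigma>\<in>faces F. card \<sigma> \<le> d + 1" using fs(3) by blast
  ultimately show "fuss_catalan_complex d (card F) (faces F)"
    unfolding fuss_catalan_complex_def fac by blast
qed

section \<open>Coordinatewise convex sets\<close>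

definition lerp :: "real \<Rightarrow> ('v \<Rightarrow> real) \<Rightarrow> ('v \<Rightarrow> real) \<Rightarrow> 'v \<Rightarrow> real" where
  "lerp t x y = (\<lambda>v. (1 - t) * x v + t * y v)"

definition fconvex :: "('v \<Rightarrow> real) set \<Rightarrow> bool" where
  "fconvex S \<longleftrightarrow> (\<forall>x\<in>S. \<forall>y\<in>S. \<forall>t\<in>{0..1}. lerp t x y \<in> S)"

lemma lerp_0 [simp]: "lerp 0 x y = x" and lerp_1 [simp]: "lerp 1 x y = y"
  by (auto simp: lerp_def)

lemma continuous_on_lerp: "continuous_on T (\<lambda>t. lerp t x y)"
  unfolding lerp_def by (intro continuous_on_coordinatewise_then_product continuous_intros)

lemma fconvex_Int: "fconvex S \<Longrightarrow> fconvex T \<Longrightarrow> fconvex (S \<inter> T)"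
  by (auto simp: fconvex_def)

lemma fconvex_connected:
  assumes "fconvex S" shows "connected S"
proof (cases "S = {}")
  case False
  then obtain x where x: "x \<in> S" by auto
  have "S = (\<Union>y\<in>S. (\<lambda>t. lerp t x y) ` {0..1})"
  proof
    show "S \<subseteq> (\<Union>y\<in>S. (\<lambda>t. lerp t x y) ` {0..1})"
    proof
      fix y assume "y \<in> S"
      moreover have "y \<in> (\<lambda>t. lerp t x y) ` {0..1}" by (rule image_eqI[of _ _ 1]) auto
      ultimately show "y \<in> (\<Union>y\<in>S. (\<lambda>t. lerp t x y) ` {0..1})" by blast
    qed
    show "(\<Union>y\<in>S. (\<lambda>t. lerp t x y) ` {0..1}) \<subseteq> S" using assms x by (auto simp: fconvex_def)
  qed
  moreover have "connected (\<Union>y\<in>S. (\<lambda>t. lerp t x y) ` {0..1::real})"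
  proof (rule connected_Union)
    show "connected A" if "A \<in> (\<lambda>y. (\<lambda>t. lerp t x y) ` {0..1::real}) ` S" for A
      using that by (auto intro!: connected_continuous_image continuous_on_lerp)
    have "x \<in> (\<lambda>t. lerp t x y) ` {0..1::real}" for y
      by (rule image_eqI[of _ _ 0]) auto
    then show "\<Inter> ((\<lambda>y. (\<lambda>t. lerp t x y) ` {0..1::real}) ` S) \<noteq> {}" by blast
  qed
  ultimately show ?thesis by simp
qed simp

text \<open>The product topology is locally convex: a basic open set restricts finitely many
  coordinates, and these restrictions can be taken to be intervals.\<close>

lemma open_fconvex_neighbourhood:
  fixes U :: "('v \<Rightarrow> real) set"
  assumes "open U" "x \<in> U" obtains N where "open N" "fconvex N" "x \<in> N" "N \<subseteq> U"
proof -
  have "openin (product_topology (\<lambda>_. euclidean) UNIV) U"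
    using assms(1) by (simp add: euclidean_product_topology)
  then obtain B where B: "x \<in> (\<Pi>\<^sub>E i\<in>UNIV. B i)" "\<And>i. openin euclideanreal (B i)"
    "finite {i. B i \<noteq> topspace euclideanreal}" "(\<Pi>\<^sub>E i\<in>UNIV. B i) \<subseteq> U"
    using product_topology_open_contains_basis[OF _ assms(2)] by blast
  have "\<exists>e>0. ball (x i) e \<subseteq> B i" for i
    using B(1) B(2)[of i] by (auto simp: PiE_UNIV_domain intro: openE)
  then obtain e where e: "\<And>i. 0 < e i" "\<And>i. ball (x i) (e i) \<subseteq> B i" by metis
  let ?I = "{i. B i \<noteq> UNIV}"
  let ?N = "\<Inter>i\<in>?I. {y. dist (x i) (y i) < e i}"
  have "finite ?I" using B(3) by simp
  then have "open ?N" by (intro open_INT ballI open_Collect_less continuous_intros continuous_on_coord) auto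
  moreover have "fconvex ?N"
  proof -
    have "(1 - t) * a + t * b \<in> ball c r" if "a \<in> ball c r" "b \<in> ball c r" "0 \<le> t" "t \<le> 1" for a b c r t :: real
      using convexD[OF convex_ball that(1,2), where u = "1 - t" and v = t] that(3,4) by simp
    then show ?thesis by (auto simp: fconvex_def lerp_def)
  qed
  moreover have "x \<in> ?N" using e by simp
  moreover have "?N \<subseteq> U"
  proof
    fix y assume y: "y \<in> ?N"
    have "y i \<in> B i" for i
    proof (cases "B i = UNIV")
      case False
      then have "y i \<in> ball (x i) (e i)" using y by simp
      then show ?thesis using e(2) by blast
    qed simp
    then show "y \<in> U" using B(4) by (auto simp: PiE_UNIV_domain)
  qed
  ultimately show ?thesis using that by blast
qed

text \<open>The library provides continuous logarithms on contractible subsets of normed spaces only;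
  the bounded sequences are a normed space that contains every coordinate space.\<close>

lemma continuous_logarithm_on_fconvex:
  fixes f :: "(nat \<Rightarrow> real) \<Rightarrow> complex"
  assumes S: "fconvex S" "\<And>y i. y \<in> S \<Longrightarrow> d \<le> i \<Longrightarrow> y i = 0"
    and f: "continuous_on S f" "\<And>y. y \<in> S \<Longrightarrow> f y \<noteq> 0"
  obtains l where "continuous_on S l" "\<And>y. y \<in> S \<Longrightarrow> f y = exp (l y)"
proof -
  define b :: "nat \<Rightarrow> (nat \<Rightarrow>\<^sub>C real)" where "b i = Bcontfun (\<lambda>k. if k = i then 1 else 0)" for i
  have "(\<lambda>k. if k = i then 1 else 0 :: real) \<in> bcontfun" for i :: nat
    unfolding bcontfun_def by (auto intro!: boundedI[of _ 1])
  then have b: "apply_bcontfun (b i) k = (if k = i then 1 else 0)" for i k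
    by (simp add: b_def Bcontfun_inverse)
  define j where "j y = (\<Sum>i<d. y i *\<^sub>R b i)" for y :: "nat \<Rightarrow> real"
  have app_sum: "apply_bcontfun (\<Sum>i\<in>A. F i) k = (\<Sum>i\<in>A. apply_bcontfun (F i) k)" if "finite A" for A F and k :: nat
    using that by induction auto
  have j: "apply_bcontfun (j y) = y" if "y \<in> S" for y
  proof
    fix k
    have "apply_bcontfun (j y) k = (\<Sum>i<d. if k = i then y i else 0)"
      unfolding j_def by (simp add: app_sum b if_distrib[of "(*) _"] cong: if_cong)
    also have "\<dots> = y k" using S(2)[OF that, of k] by (simp add: sum.delta')
    finally show "apply_bcontfun (j y) k = y k" .
  qed
  have "convex (j ` S)"
    unfolding convex_alt
  proof (intro ballI allI impI)
    fix F G t assume "F \<in> j ` S" "G \<in> j ` S" and t: "0 \<le> t \<and> t \<le> (1::real)"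
    then obtain x y where xy: "x \<in> S" "y \<in> S" "F = j x" "G = j y" by auto
    have "(1 - t) *\<^sub>R F + t *\<^sub>R G = j (lerp t x y)"
      unfolding xy j_def lerp_def by (simp add: scaleR_sum_right sum.distrib scaleR_add_left)
    moreover have "lerp t x y \<in> S" using S(1) xy t by (auto simp: fconvex_def)
    ultimately show "(1 - t) *\<^sub>R F + t *\<^sub>R G \<in> j ` S" by simp
  qed
  then have con: "contractible (j ` S)" by (rule convex_imp_contractible)
  have "continuous_on A (\<lambda>F. apply_bcontfun F k)" for A :: "(nat \<Rightarrow>\<^sub>C real) set" and k
    unfolding continuous_on_iff using dist_bounded by (metis le_less_trans)
  then have "continuous_on (j ` S) (\<lambda>F. apply_bcontfun F :: nat \<Rightarrow> real)"
    by (rule continuous_on_coordinatewise_then_product)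
  then have "continuous_on (j ` S) (f \<circ> apply_bcontfun)"
    by (rule continuous_on_compose) (use f(1) j in \<open>simp add: image_image\<close>)
  moreover have "(f \<circ> apply_bcontfun) F \<noteq> 0" if "F \<in> j ` S" for F using that j f(2) by auto
  ultimately obtain L where L: "continuous_on (j ` S) L" "\<And>F. F \<in> j ` S \<Longrightarrow> (f \<circ> apply_bcontfun) F = exp (L F)"
    using continuous_logarithm_on_contractible con by blast
  have "continuous_on S j" unfolding j_def by (intro continuous_intros continuous_on_coord)
  then have "continuous_on S (L \<circ> j)" using L(1) by (rule continuous_on_compose)
  moreover have "f y = exp ((L \<circ> j) y)" if "y \<in> S" for y using L(2)[of "j y"] that j by simp
  ultimately show ?thesis using that by blast
qed

section \<open>The closed ball\<close>

text \<open>The sum of squares at the intermediate point falls short of linear interpolation by t (1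
  - t) times the squared distance of the ends. This strict convexity allows any points of the sphere
  to be deleted without losing convexity.\<close>

lemma fcball_lerp:
  assumes "x \<in> fcball d" "y \<in> fcball d" "0 < t" "t < 1" "x \<noteq> y"
  shows "(\<Sum>i<d. (lerp t x y i)\<^sup>2) < 1" "lerp t x y \<in> fcball d"
proof -
  obtain k where "x k \<noteq> y k" using assms by auto
  moreover from this have "k < d" using assms by (auto simp: fcball_def; metis not_le)
  ultimately have "0 < (\<Sum>i<d. (x i - y i)\<^sup>2)" by (intro sum_pos2[of _ k]) auto
  then have pos: "0 < t * (1 - t) * (\<Sum>i<d. (x i - y i)\<^sup>2)" using assms by simp
  have "(lerp t x y i)\<^sup>2 = (1 - t) * (x i)\<^sup>2 + t * (y i)\<^sup>2 - t * (1 - t) * (x i - y i)\<^sup>2" for i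
    unfolding lerp_def by (simp add: power2_eq_square algebra_simps)
  then have "(\<Sum>i<d. (lerp t x y i)\<^sup>2) = (1 - t) * (\<Sum>i<d. (x i)\<^sup>2) + t * (\<Sum>i<d. (y i)\<^sup>2) - t * (1 - t) * (\<Sum>i<d. (x i - y i)\<^sup>2)"
    by (simp add: sum.distrib sum_subtractf sum_distrib_left)
  also have "\<dots> < (1 - t) * 1 + t * 1"
  proof -
    have "(1 - t) * (\<Sum>i<d. (x i)\<^sup>2) \<le> (1 - t) * 1" "t * (\<Sum>i<d. (y i)\<^sup>2) \<le> t * 1"
      using assms by (auto simp: fcball_def intro!: mult_left_mono)
    then show ?thesis using pos by linarith
  qed
  finally show *: "(\<Sum>i<d. (lerp t x y i)\<^sup>2) < 1" by simp
  then show "lerp t x y \<in> fcball d" using assms by (auto simp: fcball_def lerp_def)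
qed

lemma fconvex_ball_minus_sphere:
  assumes "S \<subseteq> fcball d" "\<And>y. y \<in> fcball d \<Longrightarrow> (\<Sum>i<d. (y i)\<^sup>2) < 1 \<Longrightarrow> y \<in> S"
  shows "fconvex S"
  unfolding fconvex_def
proof (intro ballI)
  fix x y t assume xy: "x \<in> S" "y \<in> S" "t \<in> {0..1::real}"
  consider "t = 0" | "t = 1" | "x = y" | "x \<noteq> y" "0 < t" "t < 1" using xy by fastforce
  then show "lerp t x y \<in> S"
  proof cases
    case 3
    then have "lerp t x y = x" by (auto simp: lerp_def algebra_simps)
    then show ?thesis using xy by simp
  next
    case 4
    then show ?thesis using assms fcball_lerp[of x d y t] xy by blast
  qed (use xy in auto)
qed

text \<open>With a point of the sphere an open set would also contain slightly larger multiples of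
  it.\<close>

lemma open_in_ball_interior:
  assumes "openin (Euclidean_space d) V" "V \<subseteq> fcball d" "y \<in> V"
  shows "(\<Sum>i<d. (y i)\<^sup>2) < 1"
proof (rule ccontr)
  assume "\<not> (\<Sum>i<d. (y i)\<^sup>2) < 1"
  then have y1: "(\<Sum>i<d. (y i)\<^sup>2) = 1" using assms by (force simp: fcball_def)
  obtain O' where O: "open O'" "V = {y. \<forall>i\<ge>d. y i = 0} \<inter> O'"
    using assms(1) by (auto simp: Euclidean_space_eq openin_open)
  define c where "c = (\<lambda>t i. t * y i)"
  have "continuous_on UNIV c" unfolding c_def
    by (intro continuous_on_coordinatewise_then_product continuous_intros)
  then have "open (c -` O')" using O(1) by (simp add: continuous_on_open_vimage)
  moreover have "1 \<in> c -` O'" using assms(3) O(2) by (simp add: c_def)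
  ultimately obtain e where e: "0 < e" "ball 1 e \<subseteq> c -` O'" by (meson openE)
  have "1 + e / 2 \<in> ball 1 e" using e by (simp add: dist_real_def)
  then have "c (1 + e / 2) \<in> O'" using e by blast
  moreover have "\<forall>i\<ge>d. c (1 + e / 2) i = 0" using assms(3) O by (simp add: c_def)
  ultimately have "c (1 + e / 2) \<in> fcball d" using assms(2) O(2) by blast
  moreover have "(\<Sum>i<d. (c (1 + e / 2) i)\<^sup>2) = (1 + e / 2)\<^sup>2"
    using y1 by (simp add: c_def power_mult_distrib flip: sum_distrib_left)
  ultimately have "(1 + e / 2)\<^sup>2 \<le> 1" by (simp add: fcball_def)
  moreover have "(1 + e / 2)\<^sup>2 > 1" using e by simp
  ultimately show False by simp
qed

text \<open>Invariance of domain. It yields both that two open facets and their common open wall are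
  open in the complex and that this wall avoids the sphere.\<close>

lemma open_embedding_in_ball:
  assumes W: "openin (Euclidean_space d) W" and f: "continuous_on W f" "inj_on f W" "f ` W \<subseteq> fcball d"
  shows "openin (Euclidean_space d) (f ` W)" "\<And>y. y \<in> f ` W \<Longrightarrow> (\<Sum>i<d. (y i)\<^sup>2) < 1"
proof -
  have "W \<subseteq> {y. \<forall>i\<ge>d. y i = 0}" using W by (metis openin_subset topspace_Euclidean_space)
  then have "subtopology (Euclidean_space d) W = top_of_set W"
    by (simp add: Euclidean_space_eq subtopology_subtopology Int_absorb1)
  moreover have "f ` W \<subseteq> {y. \<forall>i\<ge>d. y i = 0}" using f(3) by (auto simp: fcball_def)
  ultimately have "continuous_map (subtopology (Euclidean_space d) W) (Euclidean_space d) f"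
    using f(1) by (auto simp: Euclidean_space_eq)
  then show o: "openin (Euclidean_space d) (f ` W)"
    using invariance_of_domain_Euclidean_space W f(2) by blast
  show "\<And>y. y \<in> f ` W \<Longrightarrow> (\<Sum>i<d. (y i)\<^sup>2) < 1"
    using open_in_ball_interior[OF o f(3)] by blast
qed

lemma openin_open_ball: "openin (Euclidean_space d) {y \<in> fcball d. (\<Sum>i<d. (y i)\<^sup>2) < 1}"
proof -
  have "open {y :: nat \<Rightarrow> real. (\<Sum>i<d. (y i)\<^sup>2) < 1}"
    by (intro open_Collect_less continuous_intros continuous_on_coord)
  moreover have "{y \<in> fcball d. (\<Sum>i<d. (y i)\<^sup>2) < 1} = {y. \<forall>i\<ge>d. y i = 0} \<inter> {y. (\<Sum>i<d. (y i)\<^sup>2) < 1}"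
    by (auto simp: fcball_def)
  ultimately show ?thesis unfolding Euclidean_space_eq openin_open by blast
qed

text \<open>\<open>ball_boundary\<close> asks for some homeomorphism. The transition map from
  another one embeds the open ball into the ball, so it cannot send an interior point to the
  sphere.\<close>

lemma ball_boundary_norm:
  assumes h: "homeomorphism (realization K) (fcball d) h g" and x: "x \<in> ball_boundary d K"
  shows "(\<Sum>i<d. (h x i)\<^sup>2) = 1"
proof (rule ccontr)
  assume neq: "(\<Sum>i<d. (h x i)\<^sup>2) \<noteq> 1"
  obtain h1 g1 where h1: "homeomorphism (realization K) (fcball d) h1 g1" "(\<Sum>i<d. (h1 x i)\<^sup>2) = 1"
    and xK: "x \<in> realization K" using x by (auto simp: ball_boundary_eq)
  let ?U = "{y \<in> fcball d. (\<Sum>i<d. (y i)\<^sup>2) < 1}"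
  have "h x \<in> fcball d" using h xK unfolding homeomorphism_def by blast
  moreover from this have "(\<Sum>i<d. (h x i)\<^sup>2) \<le> 1" by (simp add: fcball_def)
  ultimately have xU: "h x \<in> ?U" using neq by simp
  have hom: "homeomorphism (fcball d) (fcball d) (h1 \<circ> g) (h \<circ> g1)"
    using homeomorphism_compose[OF homeomorphism_symD[OF h] h1(1)] .
  have "(h1 \<circ> g) (h x) \<in> (h1 \<circ> g) ` ?U" using xU by blast
  then have "(\<Sum>i<d. ((h1 \<circ> g) (h x) i)\<^sup>2) < 1"
  proof (rule open_embedding_in_ball(2)[rotated 4])
    show "continuous_on ?U (h1 \<circ> g)" using hom by (auto simp: homeomorphism_def intro: continuous_on_subset)
    have "\<forall>y\<in>fcball d. (h \<circ> g1) ((h1 \<circ> g) y) = y" using hom unfolding homeomorphism_def by blast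
    then show "inj_on (h1 \<circ> g) ?U" by (intro inj_on_inverseI[of _ "h \<circ> g1"]) blast
    show "(h1 \<circ> g) ` ?U \<subseteq> fcball d" using hom by (auto simp: homeomorphism_def)
  qed (rule openin_open_ball)
  then show False using h1(2) h xK by (simp add: homeomorphism_def)
qed

section \<open>Fuss-Catalan complexes are stacked\<close>

abbreviation supp :: "('v \<Rightarrow> real) \<Rightarrow> 'v set" where "supp x \<equiv> {v. x v \<noteq> 0}"

definition bary :: "'v set \<Rightarrow> 'v \<Rightarrow> real" where
  "bary \<rho> v = (if v \<in> \<rho> then 1 / card \<rho> else 0)"

lemma supp_bary: "finite \<rho> \<Longrightarrow> supp (bary \<rho>) = \<rho>"
  by (auto simp: bary_def)

lemma sum_bary: "finite \<rho> \<Longrightarrow> \<rho> \<noteq> {} \<Longrightarrow> (\<Sum>v\<in>\<rho>. bary \<rho> v) = 1"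
  by (simp add: bary_def)

lemma open_pos: "finite A \<Longrightarrow> open {x :: 'v \<Rightarrow> real. \<forall>v\<in>A. 0 < x v}"
proof -
  assume "finite A"
  then have "open (\<Inter>v\<in>A. {x :: 'v \<Rightarrow> real. 0 < x v})"
    by (intro open_INT ballI open_Collect_less continuous_intros continuous_on_coord)
  moreover have "(\<Inter>v\<in>A. {x :: 'v \<Rightarrow> real. 0 < x v}) = {x. \<forall>v\<in>A. 0 < x v}" by auto
  ultimately show ?thesis by simp
qed

lemma closed_supp_subset: "closed {x :: 'v \<Rightarrow> real. supp x \<subseteq> \<sigma>}"
proof -
  have "closed (\<Inter>v\<in>-\<sigma>. {x :: 'v \<Rightarrow> real. x v = 0})"
    by (intro closed_INT ballI closed_Collect_eq continuous_intros continuous_on_coord)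
  moreover have "(\<Inter>v\<in>-\<sigma>. {x :: 'v \<Rightarrow> real. x v = 0}) = {x. supp x \<subseteq> \<sigma>}" by auto
  ultimately show ?thesis by simp
qed

locale ball_complex =
  fixes d :: nat and K :: "'v set set" and h g
  assumes d2: "2 \<le> d"
    and complex: "abstract_complex K"
    and dim: "\<And>\<sigma>. \<sigma> \<in> K \<Longrightarrow> card \<sigma> \<le> d + 1"
    and ne: "facets d K \<noteq> {}"
    and hom: "homeomorphism (realization K) (fcball d) h g"
    and low: "\<And>\<sigma>. \<sigma> \<in> K \<Longrightarrow> card \<sigma> \<le> d - 1 \<Longrightarrow> closed_simplex K \<sigma> \<subseteq> ball_boundary d K"
begin

abbreviation X :: "('v \<Rightarrow> real) set" where "X \<equiv> realization K"

text \<open>All simplices of codimension at least two lie on the boundary, so that \<open>h\<close> maps their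
  complement \<open>D\<close> onto a ball without a part of its sphere, which is a convex set.\<close>

definition D :: "('v \<Rightarrow> real) set" where "D = {x \<in> X. d \<le> card (supp x)}"

lemma finK: "finite K" using complex by (simp add: abstract_complex_def)

lemma fin: "\<sigma> \<in> K \<Longrightarrow> finite \<sigma>" and nonempty: "\<sigma> \<in> K \<Longrightarrow> \<sigma> \<noteq> {}"
  using complex by (simp_all add: abstract_complex_def)

lemma face: "\<sigma> \<in> K \<Longrightarrow> \<tau> \<noteq> {} \<Longrightarrow> \<tau> \<subseteq> \<sigma> \<Longrightarrow> \<tau> \<in> K"
  using complex unfolding abstract_complex_def by meson

lemma facetD: "\<sigma> \<in> facets d K \<Longrightarrow> \<sigma> \<in> K" "\<sigma> \<in> facets d K \<Longrightarrow> card \<sigma> = d + 1" "\<sigma> \<in> facets d K \<Longrightarrow> finite \<sigma>"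
  using fin by (auto simp: facets_def)

lemma fin_facets: "finite (facets d K)"
  using finK by (simp add: facets_def)

lemma X_supp: "x \<in> X \<Longrightarrow> supp x \<in> K" and X_nn: "x \<in> X \<Longrightarrow> 0 \<le> x v"
  by (auto simp: realization_def)

lemma X_I:
  assumes "\<sigma> \<in> K" "supp x \<subseteq> \<sigma>" "\<And>v. 0 \<le> x v" "(\<Sum>v\<in>\<sigma>. x v) = 1" shows "x \<in> X"
proof -
  have s: "(\<Sum>v\<in>\<sigma>. x v) = (\<Sum>v | x v \<noteq> 0. x v)"
    by (rule sum.mono_neutral_right) (use fin assms in auto)
  then have "supp x \<noteq> {}" using assms(4) by (metis sum.empty zero_neq_one)
  then have "supp x \<in> K" by (rule face[OF assms(1) _ assms(2)])
  then show ?thesis using s assms by (simp add: realization_def)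
qed

lemma X_sum: "x \<in> X \<Longrightarrow> \<sigma> \<in> K \<Longrightarrow> supp x \<subseteq> \<sigma> \<Longrightarrow> (\<Sum>v\<in>\<sigma>. x v) = 1"
proof -
  assume a: "x \<in> X" "\<sigma> \<in> K" "supp x \<subseteq> \<sigma>"
  have "(\<Sum>v\<in>\<sigma>. x v) = (\<Sum>v | x v \<noteq> 0. x v)"
    by (rule sum.mono_neutral_right) (use fin a in auto)
  then show ?thesis using a by (simp add: realization_def)
qed

lemma bary_X: "\<rho> \<in> K \<Longrightarrow> bary \<rho> \<in> X"
  by (rule X_I[of \<rho>]) (use fin nonempty sum_bary in \<open>auto simp: bary_def\<close>)

lemma lerp_X:
  assumes "x \<in> X" "y \<in> X" "\<sigma> \<in> K" "supp x \<subseteq> \<sigma>" "supp y \<subseteq> \<sigma>" "0 \<le> t" "t \<le> 1"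
  shows "lerp t x y \<in> X" "supp (lerp t x y) \<subseteq> \<sigma>"
proof -
  have "lerp t x y v = 0" if "v \<notin> \<sigma>" for v
  proof -
    have "x v = 0" "y v = 0" using assms(4,5) that by blast+
    then show ?thesis by (simp add: lerp_def)
  qed
  then show s: "supp (lerp t x y) \<subseteq> \<sigma>" by blast
  have "(\<Sum>v\<in>\<sigma>. lerp t x y v) = (1 - t) * (\<Sum>v\<in>\<sigma>. x v) + t * (\<Sum>v\<in>\<sigma>. y v)"
    by (simp add: lerp_def sum.distrib sum_distrib_left)
  then have "(\<Sum>v\<in>\<sigma>. lerp t x y v) = 1" using X_sum assms by simp
  moreover have "0 \<le> lerp t x y v" for v using assms X_nn by (simp add: lerp_def)
  ultimately show "lerp t x y \<in> X" using X_I assms(3) s by blast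
qed

lemma supp_lerp:
  assumes "x \<in> X" "y \<in> X" "0 < t" "t < 1" shows "supp (lerp t x y) = supp x \<union> supp y"
proof -
  have "lerp t x y v \<noteq> 0 \<longleftrightarrow> x v \<noteq> 0 \<or> y v \<noteq> 0" for v
  proof -
    have "0 \<le> (1 - t) * x v" "0 \<le> t * y v" using assms X_nn by simp_all
    then have "lerp t x y v = 0 \<longleftrightarrow> (1 - t) * x v = 0 \<and> t * y v = 0" unfolding lerp_def by (rule add_nonneg_eq_0_iff)
    then show ?thesis using assms by simp
  qed
  then show ?thesis by auto
qed

lemma toward_bary:
  assumes "x \<in> X" "\<sigma> \<in> K" "supp x \<subseteq> \<sigma>" "0 < t" "t < 1"
  shows "lerp t x (bary \<sigma>) \<in> X" "supp (lerp t x (bary \<sigma>)) = \<sigma>"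
proof -
  have b: "bary \<sigma> \<in> X" "supp (bary \<sigma>) = \<sigma>" using bary_X supp_bary fin assms by auto
  show "lerp t x (bary \<sigma>) \<in> X" using lerp_X[of x "bary \<sigma>" \<sigma> t] b assms by simp
  show "supp (lerp t x (bary \<sigma>)) = \<sigma>" using supp_lerp[OF assms(1) b(1) assms(4,5)] b(2) assms(3) by blast
qed

text \<open>A small move towards the barycentre makes the support all of \<open>\<sigma>\<close>. So
  a neighbourhood of a point meets the interior of every simplex containing that point.\<close>

lemma toward_bary_open:
  assumes "x \<in> X" "\<sigma> \<in> K" "supp x \<subseteq> \<sigma>" "openin (top_of_set X) U" "x \<in> U"
  obtains t where "0 < t" "t < 1" "lerp t x (bary \<sigma>) \<in> U"
proof -
  obtain O' where O: "open O'" "U = X \<inter> O'" using assms(4) by (auto simp: openin_open)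
  have "open ((\<lambda>t. lerp t x (bary \<sigma>)) -` O')"
    using O(1) continuous_on_lerp by (metis continuous_on_open_vimage open_UNIV inf_top.right_neutral)
  moreover have "0 \<in> (\<lambda>t. lerp t x (bary \<sigma>)) -` O'" using assms(5) O by simp
  ultimately obtain e where e: "0 < e" "ball 0 e \<subseteq> (\<lambda>t. lerp t x (bary \<sigma>)) -` O'" by (meson openE)
  define t where "t = min (e / 2) (1 / 2)"
  have t: "0 < t" "t < 1" "t \<in> ball 0 e" using e(1) by (auto simp: t_def)
  then have "lerp t x (bary \<sigma>) \<in> O'" using e(2) by blast
  then have "lerp t x (bary \<sigma>) \<in> U" using O(2) toward_bary(1)[OF assms(1-3) t(1,2)] by blast
  then show ?thesis using that t by blast
qed

lemma h_X: "x \<in> X \<Longrightarrow> h x \<in> fcball d" and gh: "x \<in> X \<Longrightarrow> g (h x) = x"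
  and g_X: "y \<in> fcball d \<Longrightarrow> g y \<in> X" and hg: "y \<in> fcball d \<Longrightarrow> h (g y) = y"
  and cont_h: "continuous_on X h" and cont_g: "continuous_on (fcball d) g"
  using hom unfolding homeomorphism_def by blast+

lemma low_norm:
  assumes "x \<in> X" "card (supp x) < d" shows "(\<Sum>i<d. (h x i)\<^sup>2) = 1"
proof -
  have "x \<in> closed_simplex K (supp x)" using assms by (simp add: closed_simplex_def)
  moreover have "card (supp x) \<le> d - 1" using assms by simp
  ultimately have "x \<in> ball_boundary d K" using low X_supp assms by blast
  then show ?thesis using ball_boundary_norm hom by blast
qed

lemma D_subset: "D \<subseteq> X" by (auto simp: D_def)

lemma interior_in_D: "x \<in> X \<Longrightarrow> (\<Sum>i<d. (h x i)\<^sup>2) < 1 \<Longrightarrow> x \<in> D"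
  using low_norm by (force simp: D_def not_less)

lemma hD: "h ` D \<subseteq> fcball d"
  using h_X D_subset by blast

lemma fconvex_hD: "fconvex (h ` D)"
proof (rule fconvex_ball_minus_sphere)
  show "h ` D \<subseteq> fcball d" by (rule hD)
  fix y assume y: "y \<in> fcball d" "(\<Sum>i<d. (y i)\<^sup>2) < 1"
  then have "g y \<in> D" using interior_in_D g_X hg by simp
  then show "y \<in> h ` D" using hg y by (metis imageI)
qed

lemma ghD: "S \<subseteq> D \<Longrightarrow> g ` (h ` S) = S"
  using gh D_subset by (force simp: image_image)

lemma connected_D: "connected D"
proof -
  have "continuous_on (h ` D) g" by (rule continuous_on_subset[OF cont_g hD])
  then have "connected (g ` (h ` D))" using fconvex_connected[OF fconvex_hD] by (rule connected_continuous_image)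
  then show ?thesis using ghD by simp
qed

text \<open>\<open>D\<close> is dense: pulling \<open>h x\<close> slightly towards the centre gives
  points of the open ball, and their preimages lie in \<open>D\<close>.\<close>

lemma open_meets_D:
  assumes "openin (top_of_set X) U" "U \<noteq> {}" shows "U \<inter> D \<noteq> {}"
proof -
  obtain x where x: "x \<in> U" using assms by blast
  then have xX: "x \<in> X" using assms(1) openin_imp_subset by blast
  obtain O' where O: "open O'" "h ` U = fcball d \<inter> O'"
    using homeomorphism_imp_open_map[OF hom assms(1)] by (auto simp: openin_open)
  define c where "c = (\<lambda>t i. t * h x i)"
  have "continuous_on UNIV c" unfolding c_def
    by (intro continuous_on_coordinatewise_then_product continuous_intros)
  then have "open (c -` O')" using O(1) by (simp add: continuous_on_open_vimage)
  moreover have "1 \<in> c -` O'" using x O(2) by (auto simp: c_def)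
  ultimately obtain e where e: "0 < e" "ball 1 e \<subseteq> c -` O'" by (meson openE)
  define t where "t = max (1 - e / 2) 0"
  have t: "0 \<le> t" "t < 1" "t \<in> ball 1 e" using e(1) by (auto simp: t_def dist_real_def)
  have "(\<Sum>i<d. (h x i)\<^sup>2) \<le> 1" and 0: "\<forall>i\<ge>d. h x i = 0" using h_X[OF xX] by (auto simp: fcball_def)
  moreover have s: "(\<Sum>i<d. (c t i)\<^sup>2) = t\<^sup>2 * (\<Sum>i<d. (h x i)\<^sup>2)"
    by (simp add: c_def power_mult_distrib sum_distrib_left)
  moreover have "t\<^sup>2 < 1" using t by (simp add: power_less_one_iff)
  ultimately have lt: "(\<Sum>i<d. (c t i)\<^sup>2) < 1"
    by (metis less_eq_real_def mult_left_le order_le_less_trans zero_le_power2)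
  have "c t \<in> fcball d" using lt 0 by (auto simp: fcball_def c_def)
  moreover have "c t \<in> O'" using e t by blast
  ultimately obtain y where y: "y \<in> U" "c t = h y" using O(2) by blast
  then have "y \<in> X" using assms(1) openin_imp_subset by blast
  then have "y \<in> D" using interior_in_D lt y by simp
  then show ?thesis using y by blast
qed

lemma ex_maximal:
  assumes "\<rho> \<in> K" obtains \<rho>' where "\<rho>' \<in> K" "\<rho> \<subseteq> \<rho>'" "\<And>\<sigma>. \<sigma> \<in> K \<Longrightarrow> \<rho>' \<subseteq> \<sigma> \<Longrightarrow> \<sigma> = \<rho>'"
proof -
  let ?S = "{\<sigma> \<in> K. \<rho> \<subseteq> \<sigma>}"
  have "finite ?S" "?S \<noteq> {}" using finK assms by auto
  from finite_has_maximal[OF this] obtain \<rho>' where m: "\<rho>' \<in> ?S" "\<forall>b\<in>?S. \<rho>' \<subseteq> b \<longrightarrow> \<rho>' = b" ..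
  show ?thesis
  proof (rule that)
    show "\<rho>' \<in> K" "\<rho> \<subseteq> \<rho>'" using m(1) by auto
    show "\<sigma> = \<rho>'" if s: "\<sigma> \<in> K" "\<rho>' \<subseteq> \<sigma>" for \<sigma>
    proof -
      have "\<sigma> \<in> ?S" using s m(1) by auto
      then show ?thesis using bspec[OF m(2)] s(2) by blast
    qed
  qed
qed

lemma supp_pos: "x \<in> X \<Longrightarrow> \<rho> \<subseteq> supp x \<longleftrightarrow> (\<forall>v\<in>\<rho>. 0 < x v)"
  using X_nn by (auto simp: less_le)

text \<open>The interior of a maximal simplex is open in the realization, so it meets the dense set
  \<open>D\<close> and the simplex has at least \<open>d\<close> vertices. With exactly
  \<open>d\<close> vertices its interior would also be closed in \<open>D\<close>, hence all of the
  connected set \<open>D\<close>, which however contains the barycentre of a facet.\<close>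

lemma pure:
  assumes "\<rho> \<in> K" shows "\<exists>\<sigma>\<in>facets d K. \<rho> \<subseteq> \<sigma>"
proof -
  obtain \<rho>' where r: "\<rho>' \<in> K" "\<rho> \<subseteq> \<rho>'" and max: "\<And>\<sigma>. \<sigma> \<in> K \<Longrightarrow> \<rho>' \<subseteq> \<sigma> \<Longrightarrow> \<sigma> = \<rho>'" using ex_maximal[OF assms] by blast
  let ?O = "{x :: 'v \<Rightarrow> real. \<forall>v\<in>\<rho>'. 0 < x v}"
  have op: "open ?O" by (rule open_pos[OF fin[OF r(1)]])
  have b: "bary \<rho>' \<in> X" "bary \<rho>' \<in> ?O" using bary_X supp_pos[OF bary_X[OF r(1)], of \<rho>'] supp_bary fin r by auto
  have eq: "supp x = \<rho>'" if "x \<in> X" "x \<in> ?O" for x using that max[of "supp x"] X_supp supp_pos by blast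
  have "openin (top_of_set X) (X \<inter> ?O)" using op by (simp add: openin_open_Int)
  then obtain x where x: "x \<in> X" "x \<in> ?O" "x \<in> D" using open_meets_D b by blast
  then have ge: "d \<le> card \<rho>'" using eq[of x] by (simp add: D_def)
  have "card \<rho>' \<noteq> d"
  proof
    assume c: "card \<rho>' = d"
    have bD: "bary \<rho>' \<in> D" using b eq c by (simp add: D_def)
    have "D \<inter> ?O = D \<inter> {x. supp x \<subseteq> \<rho>'}"
    proof
      show "D \<inter> ?O \<subseteq> D \<inter> {x. supp x \<subseteq> \<rho>'}" using eq D_subset by blast
      have eqD: "supp x = \<rho>'" if "x \<in> D" "supp x \<subseteq> \<rho>'" for x
        using card_seteq[OF fin[OF r(1)] that(2)] that(1) c by (simp add: D_def)
      have inO: "x \<in> ?O" if "x \<in> D" "supp x \<subseteq> \<rho>'" for x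
        using supp_pos[OF subsetD[OF D_subset that(1)], of \<rho>'] eqD[OF that] by simp
      show "D \<inter> {x. supp x \<subseteq> \<rho>'} \<subseteq> D \<inter> ?O"
      proof (rule subsetI)
        fix x assume "x \<in> D \<inter> {x. supp x \<subseteq> \<rho>'}"
        then have x: "x \<in> D" "supp x \<subseteq> \<rho>'" by simp_all
        show "x \<in> D \<inter> ?O" by (rule IntI[OF x(1) inO[OF x]])
      qed
    qed
    then have cl: "closedin (top_of_set D) (D \<inter> ?O)" by (simp only: closedin_closed_Int[OF closed_supp_subset])
    have op': "openin (top_of_set D) (D \<inter> ?O)" using op by (rule openin_open_Int)
    have "D \<inter> ?O \<noteq> {}" by (rule ex_in_conv[THEN iffD1, OF exI, OF IntI[OF bD b(2)]])
    then have all: "D \<inter> ?O = D"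
      using connected_D[unfolded connected_clopen, rule_format, OF conjI[OF op' cl]] by (simp only: simp_thms)
    obtain \<sigma> where s: "\<sigma> \<in> facets d K" using ne by blast
    then have sp: "supp (bary \<sigma>) = \<sigma>" by (intro supp_bary facetD(3))
    then have "bary \<sigma> \<in> D" using bary_X facetD[OF s] by (simp add: D_def)
    then have bO: "bary \<sigma> \<in> D \<inter> ?O" by (simp only: all)
    then have "\<sigma> = \<rho>'" using eq[OF subsetD[OF D_subset IntD1[OF bO]] IntD2[OF bO]] sp by simp
    then show False using c facetD[OF s] by simp
  qed
  then have "card \<rho>' = d + 1" using ge dim[OF r(1)] by linarith
  then show ?thesis using r by (auto simp: facets_def)
qed

lemma faces_facets: "faces (facets d K) = K"
proof
  show "faces (facets d K) \<subseteq> K" using face facetD by (auto simp: faces_def)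
  show "K \<subseteq> faces (facets d K)" using pure nonempty by (auto simp: faces_def)
qed

text \<open>The points supported in a given simplex form a closed set, so two finite groups of
  simplices cannot split a connected \<open>W\<close>. It serves for all of \<open>D\<close> and for
  its part near a vertex.\<close>

lemma covered_connected:
  assumes W: "W \<subseteq> X" "connected W" and fin: "finite P" "finite Q"
    and cover: "\<And>x. x \<in> W \<Longrightarrow> \<exists>\<sigma>\<in>P \<union> Q. supp x \<subseteq> \<sigma>"
    and ne: "\<exists>x\<in>W. \<exists>\<sigma>\<in>P. supp x \<subseteq> \<sigma>" "\<exists>x\<in>W. \<exists>\<sigma>\<in>Q. supp x \<subseteq> \<sigma>"
  shows "\<exists>x\<in>W. \<exists>p\<in>P. \<exists>q\<in>Q. supp x \<subseteq> p \<inter> q"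
proof (rule ccontr)
  assume not: "\<not> ?thesis"
  let ?A = "\<lambda>P. W \<inter> (\<Union>\<sigma>\<in>P. {x. supp x \<subseteq> \<sigma>})"
  have cl: "closedin (top_of_set W) (?A S)" if "finite S" for S
    using that closed_supp_subset by (intro closedin_closed_Int closed_UN) auto
  have "?A P \<union> ?A Q = W" using cover by blast
  moreover have "?A P \<inter> ?A Q = {}" using not by blast
  moreover have "?A P \<noteq> {}" "?A Q \<noteq> {}" using ne by blast+
  ultimately show False using W(2) cl[OF fin(1)] cl[OF fin(2)] unfolding connected_closedin_eq by metis
qed

section \<open>Connectivity of the facets, globally and at a vertex\<close>

lemma card_facet_Int:
  assumes "p \<in> facets d K" "q \<in> facets d K" "p \<noteq> q" shows "card (p \<inter> q) \<le> d"
proof -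
  have "p \<inter> q \<noteq> p" using assms facetD by (metis card_subset_eq inf.orderI Int_lower2 inf_commute)
  then have "card (p \<inter> q) < card p" using assms facetD by (intro psubset_card_mono) auto
  then show ?thesis using facetD(2)[OF assms(1)] by simp
qed

lemma bary_facet_D: "\<sigma> \<in> facets d K \<Longrightarrow> bary \<sigma> \<in> D"
  using bary_X facetD supp_bary[of \<sigma>] by (simp add: D_def)

lemma adjacent_in_D:
  assumes "x \<in> D" "supp x \<subseteq> p \<inter> q" "p \<in> facets d K" "q \<in> facets d K" "p \<noteq> q"
  shows "card (p \<inter> q) = d"
proof -
  have "card (supp x) \<le> card (p \<inter> q)" using assms facetD by (intro card_mono) auto
  then show ?thesis using card_facet_Int[OF assms(3-5)] assms(1) by (simp add: D_def)
qed

lemma strongly_connected: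
  assumes "P \<union> Q = facets d K" "P \<inter> Q = {}" "P \<noteq> {}" "Q \<noteq> {}"
  shows "\<exists>p\<in>P. \<exists>q\<in>Q. card (p \<inter> q) = d"
proof -
  have "\<exists>x\<in>D. \<exists>p\<in>P. \<exists>q\<in>Q. supp x \<subseteq> p \<inter> q"
  proof (rule covered_connected[OF D_subset connected_D])
    show "finite P" "finite Q" using assms(1) fin_facets by (metis finite_Un)+
    show "\<exists>\<sigma>\<in>P \<union> Q. supp x \<subseteq> \<sigma>" if "x \<in> D" for x
      using pure[OF X_supp[OF subsetD[OF D_subset that]]] assms(1) by blast
    show "\<exists>x\<in>D. \<exists>\<sigma>\<in>P. supp x \<subseteq> \<sigma>" using assms bary_facet_D facetD(3) supp_bary by (metis UnCI equals0I order_refl)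
    show "\<exists>x\<in>D. \<exists>\<sigma>\<in>Q. supp x \<subseteq> \<sigma>" using assms bary_facet_D facetD(3) supp_bary by (metis UnCI equals0I order_refl)
  qed
  then show ?thesis using adjacent_in_D assms by (metis IntI UnCI empty_iff)
qed

text \<open>The vertex itself is not in \<open>D\<close>, since \<open>d\<close> is at least 2; the
  set \<open>W\<close> is the part of \<open>D\<close> near it. Its image is an intersection of two
  convex sets, wherever on the sphere the vertex lies. Close to the vertex every support contains
  \<open>v\<close>, and every facet at \<open>v\<close> is met.\<close>

lemma vertex_connected:
  assumes "P \<union> Q = {\<sigma> \<in> facets d K. v \<in> \<sigma>}" "P \<inter> Q = {}" "P \<noteq> {}" "Q \<noteq> {}"
  shows "\<exists>p\<in>P. \<exists>q\<in>Q. card (p \<inter> q) = d \<and> v \<in> p \<inter> q"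
proof -
  have PQ: "\<sigma> \<in> facets d K" "v \<in> \<sigma>" if "\<sigma> \<in> P \<union> Q" for \<sigma> using that assms(1) by auto
  obtain \<sigma>0 where "\<sigma>0 \<in> P" using assms by blast
  then have vK: "{v} \<in> K" using PQ[of \<sigma>0] facetD(1) face by blast
  define x0 where "x0 = bary {v}"
  have x0: "x0 \<in> X" "supp x0 = {v}" using bary_X[OF vK] supp_bary[of "{v}"] by (simp_all add: x0_def)
  let ?O = "{x :: 'v \<Rightarrow> real. \<forall>u\<in>{v}. 0 < x u}"
  have "openin (top_of_set X) (X \<inter> ?O)" using open_pos[of "{v}"] by (simp add: openin_open_Int)
  then obtain O' where O: "open O'" "h ` (X \<inter> ?O) = fcball d \<inter> O'"
    using homeomorphism_imp_open_map[OF hom] by (meson openin_open)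
  have "x0 \<in> X \<inter> ?O" using x0 supp_pos[OF x0(1), of "{v}"] by simp
  then have "h x0 \<in> O'" using O by blast
  then obtain N where N: "open N" "fconvex N" "h x0 \<in> N" "N \<subseteq> O'"
    using open_fconvex_neighbourhood[OF O(1)] by blast
  define W where "W = {x \<in> D. h x \<in> N}"
  have hW: "h ` W = h ` D \<inter> N" by (auto simp: W_def)
  have "connected (h ` W)" unfolding hW using fconvex_connected[OF fconvex_Int[OF fconvex_hD N(2)]] .
  moreover have "continuous_on (h ` W) g" by (rule continuous_on_subset[OF cont_g]) (use hW hD in blast)
  ultimately have "connected (g ` (h ` W))" using connected_continuous_image by blast
  then have cW: "connected W" using ghD[of W] by (simp add: W_def)
  have WX: "W \<subseteq> X" using D_subset by (auto simp: W_def)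
  have vW: "v \<in> supp x" if "x \<in> W" for x
  proof -
    have "h x \<in> h ` (X \<inter> ?O)" using that O(2) N(4) h_X WX by (auto simp: W_def)
    then obtain y where "y \<in> X \<inter> ?O" "h x = h y" by blast
    then have "x = y" using gh WX that by (metis IntD1 subsetD)
    then show ?thesis using \<open>y \<in> X \<inter> ?O\<close> by simp
  qed
  have meets: "\<exists>x\<in>W. supp x \<subseteq> \<sigma>" if s: "\<sigma> \<in> P \<union> Q" for \<sigma>
  proof -
    have sx: "supp x0 \<subseteq> \<sigma>" using x0(2) PQ(2)[OF s] by simp
    have "openin (top_of_set X) (X \<inter> h -` N)" using cont_h N(1) by (rule continuous_openin_preimage_gen)
    moreover have "x0 \<in> X \<inter> h -` N" using x0 N by simp
    ultimately obtain t where t: "0 < t" "t < 1" "lerp t x0 (bary \<sigma>) \<in> X \<inter> h -` N"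
      using toward_bary_open[OF x0(1) facetD(1)[OF PQ(1)[OF s]] sx] by blast
    have sp: "supp (lerp t x0 (bary \<sigma>)) = \<sigma>"
      by (rule toward_bary(2)[OF x0(1) facetD(1)[OF PQ(1)[OF s]] _ t(1,2)]) (use x0(2) PQ(2)[OF s] in simp)
    then have "lerp t x0 (bary \<sigma>) \<in> W" using t(3) facetD(2)[OF PQ(1)[OF s]] by (simp add: W_def D_def)
    then show ?thesis using sp by blast
  qed
  have "\<exists>x\<in>W. \<exists>p\<in>P. \<exists>q\<in>Q. supp x \<subseteq> p \<inter> q"
  proof (rule covered_connected[OF WX cW])
    have "finite (P \<union> Q)" unfolding assms(1) using fin_facets by simp
    then show "finite P" "finite Q" by simp_all
    show "\<exists>\<sigma>\<in>P \<union> Q. supp x \<subseteq> \<sigma>" if xW: "x \<in> W" for x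
    proof -
      obtain \<sigma> where "\<sigma> \<in> facets d K" "supp x \<subseteq> \<sigma>" using pure[OF X_supp[OF subsetD[OF WX xW]]] by blast
      then show ?thesis using vW[OF that] unfolding assms(1) by blast
    qed
    show "\<exists>x\<in>W. \<exists>\<sigma>\<in>P. supp x \<subseteq> \<sigma>" "\<exists>x\<in>W. \<exists>\<sigma>\<in>Q. supp x \<subseteq> \<sigma>" using meets assms(3,4) by blast+
  qed
  then obtain x p q where x: "x \<in> W" "p \<in> P" "q \<in> Q" "supp x \<subseteq> p \<inter> q" by blast
  then have "p \<noteq> q" using assms(2) by blast
  moreover have "x \<in> D" using x by (simp add: W_def)
  ultimately have "card (p \<inter> q) = d" using adjacent_in_D x PQ(1) by blast
  then show ?thesis using x vW[of x] by blast
qed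

end

text \<open>The union of two open facets and of their common wall \<open>\<tau>\<close> is the image of an open set of
  coordinates: the difference of the coordinates of the two apices and all but one of the
  coordinates of \<open>\<tau>\<close>.\<close>

lemma wall_chart:
  fixes \<tau> :: "'v set"
  assumes \<tau>: "finite \<tau>" "card \<tau> = d" "1 \<le> d" and ab: "a \<notin> \<tau>" "b \<notin> \<tau>" "a \<noteq> b"
  defines "V \<equiv> {x :: 'v \<Rightarrow> real. (\<forall>v. 0 \<le> x v) \<and> (\<forall>v\<in>\<tau>. 0 < x v) \<and> (\<forall>v. v \<notin> insert a (insert b \<tau>) \<longrightarrow> x v = 0) \<and>
     (x a = 0 \<or> x b = 0) \<and> x a + x b + (\<Sum>v\<in>\<tau>. x v) = 1}"
  shows "\<exists>W \<psi>. openin (Euclidean_space d) W \<and> continuous_on W \<psi> \<and> inj_on \<psi> W \<and> \<psi> ` W = V"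
proof -
  obtain e where e: "bij_betw e {..<d} \<tau>"
    using ex_bij_betw_nat_finite[of \<tau>] \<tau> by (metis atLeast0LessThan)
  define r where "r = inv_into {..<d} e"
  have r: "r v < d" "e (r v) = v" if "v \<in> \<tau>" for v
    using e that inv_into_into[of v e "{..<d}"] by (auto simp: r_def bij_betw_def f_inv_into_f)
  have re: "r (e i) = i" and e\<tau>: "e i \<in> \<tau>" if "i < d" for i using e that by (auto simp: r_def bij_betw_def)
  have sum_e: "(\<Sum>v\<in>\<tau>. f v) = f (e 0) + (\<Sum>i=1..<d. f (e i))" for f :: "'v \<Rightarrow> real"
  proof -
    have "(\<Sum>v\<in>\<tau>. f v) = (\<Sum>i<d. f (e i))" using sum.reindex_bij_betw[OF e, of f] by simp
    also have "\<dots> = f (e 0) + (\<Sum>i=1..<d. f (e i))"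
      using \<tau>(3) by (simp add: lessThan_atLeast0 sum.atLeast_Suc_lessThan)
    finally show ?thesis .
  qed
  define W where "W = {y :: nat \<Rightarrow> real. (\<forall>i\<ge>d. y i = 0) \<and> (\<forall>i\<in>{1..<d}. 0 < y i) \<and> \<bar>y 0\<bar> + (\<Sum>i=1..<d. y i) < 1}"
  \<comment> \<open>The omitted coordinate of \<open>\<tau>\<close>, the one at \<open>e 0\<close>,
    is what remains of the total mass 1. As one of the two apices carries no mass,
    \<open>\<bar>y 0\<bar>\<close> is the mass of both together.\<close>
  define c where "c = (\<lambda>(y :: nat \<Rightarrow> real) i. if i = 0 then 1 - \<bar>y 0\<bar> - (\<Sum>i=1..<d. y i) else y i)"
  define \<psi> where "\<psi> = (\<lambda>y v. if v \<in> \<tau> then c y (r v) else if v = a then max (y 0) 0 else if v = b then max (- y 0) 0 else 0)"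
  have \<psi>e: "\<psi> y (e i) = c y i" if "i < d" for y i using that re e\<tau> by (simp add: \<psi>_def)
  have \<psi>ab: "\<psi> y a = max (y 0) 0" "\<psi> y b = max (- y 0) 0" for y using ab by (auto simp: \<psi>_def)
  have "open (\<Inter>i\<in>{1..<d}. {y :: nat \<Rightarrow> real. 0 < y i})"
    by (intro open_INT ballI open_Collect_less continuous_intros continuous_on_coord) auto
  moreover have "open {y :: nat \<Rightarrow> real. \<bar>y 0\<bar> + (\<Sum>i=1..<d. y i) < 1}"
    by (intro open_Collect_less continuous_intros continuous_on_coord)
  ultimately have "open ((\<Inter>i\<in>{1..<d}. {y :: nat \<Rightarrow> real. 0 < y i}) \<inter> {y. \<bar>y 0\<bar> + (\<Sum>i=1..<d. y i) < 1})"
    by (rule open_Int)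
  moreover have "W = {y. \<forall>i\<ge>d. y i = 0} \<inter> ((\<Inter>i\<in>{1..<d}. {y. 0 < y i}) \<inter> {y. \<bar>y 0\<bar> + (\<Sum>i=1..<d. y i) < 1})"
    by (auto simp: W_def)
  ultimately have "openin (Euclidean_space d) W" unfolding Euclidean_space_eq by (simp only: openin_open_Int)
  moreover have "continuous_on W \<psi>"
  proof (rule continuous_on_coordinatewise_then_product)
    fix v
    have "continuous_on W (\<lambda>y. c y i)" for i
      by (cases "i = 0") (auto simp: c_def intro!: continuous_intros continuous_on_coord)
    then show "continuous_on W (\<lambda>y. \<psi> y v)"
      by (cases "v \<in> \<tau>"; cases "v = a"; cases "v = b")
        (auto simp: \<psi>_def intro!: continuous_intros continuous_on_coord continuous_on_max)
  qed
  moreover have "inj_on \<psi> W"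
  proof (rule inj_onI)
    fix y z assume y: "y \<in> W" and z: "z \<in> W" and eq: "\<psi> y = \<psi> z"
    have "y 0 = \<psi> y a - \<psi> y b" "z 0 = \<psi> z a - \<psi> z b" unfolding \<psi>ab by (auto simp: max_def)
    then have "y 0 = z 0" using eq by simp
    moreover have "y i = z i" if "0 < i" "i < d" for i
      using \<psi>e[OF that(2), of y] \<psi>e[OF that(2), of z] eq that by (simp add: c_def)
    moreover have "y i = z i" if "d \<le> i" for i using y z that by (simp add: W_def)
    ultimately show "y = z" by (metis not_gr_zero not_less ext)
  qed
  moreover have "\<psi> ` W = V"
  proof
    show "\<psi> ` W \<subseteq> V"
    proof (rule image_subsetI)
      fix y assume y: "y \<in> W"
      have cpos: "0 < c y i" if "i < d" for i
        using y that by (cases "i = 0") (auto simp: W_def c_def)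
      have "\<forall>v\<in>\<tau>. 0 < \<psi> y v" using cpos r by (simp add: \<psi>_def)
      moreover have "\<forall>v. 0 \<le> \<psi> y v" using cpos r by (auto simp: \<psi>_def less_imp_le)
      moreover have "\<psi> y a + \<psi> y b + (\<Sum>v\<in>\<tau>. \<psi> y v) = 1"
      proof -
        have "(\<Sum>v\<in>\<tau>. \<psi> y v) = c y 0 + (\<Sum>i=1..<d. c y i)"
          unfolding sum_e using \<psi>e \<tau>(3) by (intro arg_cong2[where f="(+)"] sum.cong) auto
        also have "(\<Sum>i=1..<d. c y i) = (\<Sum>i=1..<d. y i)" by (intro sum.cong) (auto simp: c_def)
        finally show ?thesis unfolding \<psi>ab by (simp add: c_def)
      qed
      ultimately show "\<psi> y \<in> V" using \<psi>ab[of y] unfolding V_def by (auto simp: \<psi>_def)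
    qed
    show "V \<subseteq> \<psi> ` W"
    proof (rule subsetI)
      fix x assume "x \<in> V"
      then have x: "\<And>v. 0 \<le> x v" "\<And>v. v \<in> \<tau> \<Longrightarrow> 0 < x v" "\<And>v. v \<notin> insert a (insert b \<tau>) \<Longrightarrow> x v = 0"
        "x a = 0 \<or> x b = 0" "x a + x b + (\<Sum>v\<in>\<tau>. x v) = 1" by (simp_all add: V_def)
      define y where "y = (\<lambda>i. if d \<le> i then 0 else if i = 0 then x a - x b else x (e i))"
      have y0: "y 0 = x a - x b" using \<tau>(3) by (simp add: y_def)
      have yi: "y i = x (e i)" if "0 < i" "i < d" for i using that by (simp add: y_def)
      have ys: "(\<Sum>i=1..<d. y i) = (\<Sum>i=1..<d. x (e i))" by (intro sum.cong) (auto simp: yi)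
      have y0': "\<bar>y 0\<bar> = x a + x b" using x(1)[of a] x(1)[of b] x(4) y0 by auto
      have x0: "x (e 0) = 1 - \<bar>y 0\<bar> - (\<Sum>i=1..<d. y i)" using x(5) unfolding sum_e ys y0' by simp
      have "0 < x (e 0)" using x(2) e\<tau> \<tau>(3) by simp
      moreover have "\<forall>i\<in>{1..<d}. 0 < y i" using yi x(2) e\<tau> by simp
      ultimately have yW: "y \<in> W" using x0 by (simp add: W_def) (simp add: y_def)
      have cy: "c y i = x (e i)" if "i < d" for i using x0 yi[of i] that by (cases "i = 0") (auto simp: c_def)
      have "\<psi> y v = x v" for v
      proof -
        consider "v \<in> \<tau>" | "v = a" | "v = b" | "v \<notin> insert a (insert b \<tau>)" by blast
        then show ?thesis
        proof cases
          case 1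
          then have "\<psi> y v = c y (r v)" by (simp add: \<psi>_def)
          also have "\<dots> = x (e (r v))" by (rule cy[OF r(1)[OF 1]])
          finally show ?thesis using r[OF 1] by simp
        next
          case 2
          then show ?thesis using \<psi>ab(1)[of y] y0 x(1)[of a] x(1)[of b] x(4) by auto
        next
          case 3
          then show ?thesis using \<psi>ab(2)[of y] y0 x(1)[of a] x(1)[of b] x(4) by auto
        next
          case 4
          then show ?thesis using x(3)[OF 4] by (simp add: \<psi>_def)
        qed
      qed
      then have "x = \<psi> y" by auto
      then show "x \<in> \<psi> ` W" using yW by (rule image_eqI)
    qed
  qed
  ultimately show ?thesis by blast
qed

section \<open>Walls: invariance of domain and separation\<close>

context ball_complex
begin

text \<open>\<open>V\<close> is the union of the two open facets and their open wall, which
  \<open>wall_chart\<close> parametrizes by an open set of coordinates. By invariance of domain its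
  image under \<open>h\<close> is open in the coordinate space and avoids the sphere.\<close>

lemma wall_open:
  assumes \<tau>: "card \<tau> = d" and ab: "a \<notin> \<tau>" "b \<notin> \<tau>" "a \<noteq> b" and K: "insert a \<tau> \<in> K" "insert b \<tau> \<in> K"
  defines "V \<equiv> {x \<in> X. (supp x \<subseteq> insert a \<tau> \<or> supp x \<subseteq> insert b \<tau>) \<and> \<tau> \<subseteq> supp x}"
  shows "openin (top_of_set X) V" "\<And>x. x \<in> V \<Longrightarrow> (\<Sum>i<d. (h x i)\<^sup>2) < 1"
proof -
  have f\<tau>: "finite \<tau>" using fin[OF K(1)] by simp
  have d1: "1 \<le> d" using d2 by simp
  have Veq: "V = {x. (\<forall>v. 0 \<le> x v) \<and> (\<forall>v\<in>\<tau>. 0 < x v) \<and> (\<forall>v. v \<notin> insert a (insert b \<tau>) \<longrightarrow> x v = 0) \<and>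
     (x a = 0 \<or> x b = 0) \<and> x a + x b + (\<Sum>v\<in>\<tau>. x v) = 1}" (is "V = ?V")
  proof (rule Set.set_eqI)
    fix x
    show "x \<in> V \<longleftrightarrow> x \<in> ?V"
    proof
      assume x: "x \<in> V"
      then have xX: "x \<in> X" and "\<tau> \<subseteq> supp x" by (simp_all add: V_def)
      then have pos: "\<forall>v\<in>\<tau>. 0 < x v" using supp_pos by simp
      have "supp x \<subseteq> insert a \<tau> \<or> supp x \<subseteq> insert b \<tau>" using x by (simp add: V_def)
      then show "x \<in> ?V"
      proof
        assume s: "supp x \<subseteq> insert a \<tau>"
        then have "x b = 0" using ab by auto
        moreover have "x a + (\<Sum>v\<in>\<tau>. x v) = 1" using X_sum[OF xX K(1) s] f\<tau> ab by simp
        moreover have "x v = 0" if "v \<notin> insert a (insert b \<tau>)" for v using s that by auto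
        ultimately show ?thesis using pos X_nn[OF xX] by simp
      next
        assume s: "supp x \<subseteq> insert b \<tau>"
        then have "x a = 0" using ab by auto
        moreover have "x b + (\<Sum>v\<in>\<tau>. x v) = 1" using X_sum[OF xX K(2) s] f\<tau> ab by simp
        moreover have "x v = 0" if "v \<notin> insert a (insert b \<tau>)" for v using s that by auto
        ultimately show ?thesis using pos X_nn[OF xX] by simp
      qed
    next
      assume x: "x \<in> ?V"
      then have nn: "\<And>v. 0 \<le> x v" and pos: "\<And>v. v \<in> \<tau> \<Longrightarrow> 0 < x v"
        and z: "\<And>v. v \<notin> insert a (insert b \<tau>) \<Longrightarrow> x v = 0" and ab0: "x a = 0 \<or> x b = 0"
        and s1: "x a + x b + (\<Sum>v\<in>\<tau>. x v) = 1" by simp_all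
      have t: "\<tau> \<subseteq> supp x" using pos by force
      from ab0 show "x \<in> V"
      proof
        assume a0: "x a = 0"
        have s: "supp x \<subseteq> insert b \<tau>"
        proof
          fix v assume "v \<in> supp x" then show "v \<in> insert b \<tau>" using z[of v] a0 by auto
        qed
        have "x \<in> X" by (rule X_I[OF K(2) s nn]) (use s1 a0 f\<tau> ab in simp)
        then show ?thesis using s t by (simp add: V_def)
      next
        assume b0: "x b = 0"
        have s: "supp x \<subseteq> insert a \<tau>"
        proof
          fix v assume "v \<in> supp x" then show "v \<in> insert a \<tau>" using z[of v] b0 by auto
        qed
        have "x \<in> X" by (rule X_I[OF K(1) s nn]) (use s1 b0 f\<tau> ab in simp)
        then show ?thesis using s t by (simp add: V_def)
      qed
    qed
  qed
  have "\<exists>W \<psi>. openin (Euclidean_space d) W \<and> continuous_on W \<psi> \<and> inj_on \<psi> W \<and> \<psi> ` W = V"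
    unfolding Veq by (rule wall_chart[OF f\<tau> \<tau> d1 ab])
  then obtain W \<psi> where W: "openin (Euclidean_space d) W" "continuous_on W \<psi>" "inj_on \<psi> W" "\<psi> ` W = V"
    by (elim exE conjE)
  have VX: "V \<subseteq> X" by (auto simp: V_def)
  have c: "continuous_on W (h \<circ> \<psi>)"
    using W(2) continuous_on_subset[OF cont_h VX] unfolding W(4)[symmetric] by (rule continuous_on_compose)
  have "inj_on h X" by (rule inj_on_inverseI[of _ g]) (rule gh)
  then have i: "inj_on (h \<circ> \<psi>) W" using W(3,4) VX inj_on_subset by (metis comp_inj_on)
  have im: "(h \<circ> \<psi>) ` W = h ` V" using W(4) by (metis image_comp)
  have sub: "h ` V \<subseteq> fcball d" using VX h_X by auto
  note emb = open_embedding_in_ball[OF W(1) c i, unfolded im, OF sub]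
  show "(\<Sum>i<d. (h x i)\<^sup>2) < 1" if "x \<in> V" for x using emb(2) that by simp
  obtain O' where O: "open O'" "h ` V = {y. \<forall>i\<ge>d. y i = 0} \<inter> O'"
    using emb(1) by (auto simp: Euclidean_space_eq openin_open)
  have "h ` V = fcball d \<inter> O'" using O(2) sub by (auto simp: fcball_def)
  then have "openin (top_of_set (fcball d)) (h ` V)" using O(1) by (simp add: openin_open_Int)
  then have "openin (top_of_set X) (g ` h ` V)"
    using homeomorphism_imp_open_map[OF homeomorphism_symD[OF hom]] by blast
  moreover have "g ` h ` V = V" using VX gh by (force simp: image_image)
  ultimately show "openin (top_of_set X) V" by simp
qed

text \<open>By \<open>wall_open\<close> the two facets contain a neighbourhood of the barycentre of
  \<open>\<tau>\<close>. A point just inside \<open>\<sigma>\<close> lies in that neighbourhood,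
  which leaves no third facet.\<close>

lemma wall_two_facets:
  assumes \<tau>: "card \<tau> = d" and ab: "a \<notin> \<tau>" "b \<notin> \<tau>" "a \<noteq> b" and K: "insert a \<tau> \<in> K" "insert b \<tau> \<in> K"
    and \<sigma>: "\<sigma> \<in> facets d K" "\<tau> \<subseteq> \<sigma>"
  shows "\<sigma> = insert a \<tau> \<or> \<sigma> = insert b \<tau>"
proof (rule ccontr)
  assume neq: "\<not> ?thesis"
  have "\<tau> \<noteq> {}" using \<tau> d2 by auto
  then have \<tau>K: "\<tau> \<in> K" by (rule face[OF K(1)]) auto
  have b: "bary \<tau> \<in> X" "supp (bary \<tau>) = \<tau>" using bary_X[OF \<tau>K] supp_bary fin[OF \<tau>K] by auto
  let ?V = "{x \<in> X. (supp x \<subseteq> insert a \<tau> \<or> supp x \<subseteq> insert b \<tau>) \<and> \<tau> \<subseteq> supp x}"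
  have s: "supp (bary \<tau>) \<subseteq> \<sigma>" using b(2) \<sigma>(2) by simp
  have "bary \<tau> \<in> ?V" using b by auto
  then obtain t where t: "0 < t" "t < 1" "lerp t (bary \<tau>) (bary \<sigma>) \<in> ?V"
    using toward_bary_open[OF b(1) facetD(1)[OF \<sigma>(1)] s wall_open(1)[OF \<tau> ab K]] by blast
  have "supp (lerp t (bary \<tau>) (bary \<sigma>)) = \<sigma>" by (rule toward_bary(2)[OF b(1) facetD(1)[OF \<sigma>(1)] s t(1,2)])
  then have "\<sigma> \<subseteq> insert a \<tau> \<or> \<sigma> \<subseteq> insert b \<tau>" using t(3) by simp
  moreover have "card (insert a \<tau>) = d + 1" "card (insert b \<tau>) = d + 1" using \<tau> ab fin[OF \<tau>K] by simp_all
  ultimately show False using neq facetD[OF \<sigma>(1)] fin[OF K(1)] fin[OF K(2)] by (metis card_subset_eq)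
qed

lemma facet_insert:
  assumes "\<sigma> \<in> facets d K" "\<tau> \<subseteq> \<sigma>" "card \<tau> = d" obtains a where "a \<notin> \<tau>" "\<sigma> = insert a \<tau>"
proof -
  have "Suc (card \<tau>) = card \<sigma>" using assms(3) facetD(2)[OF assms(1)] by simp
  then obtain a where "a \<in> \<sigma>" "\<tau> = \<sigma> - {a}"
    using subset_card_pred[OF facetD(3)[OF assms(1)] assms(2)] by metis
  then have "a \<notin> \<tau>" "\<sigma> = insert a \<tau>" by (simp_all add: insert_absorb)
  then show ?thesis by (rule that)
qed

text \<open>Two facets at \<open>R\<close> would make the barycentre of \<open>R\<close> an interior
  point.\<close>

lemma root_unique_facet:
  assumes R: "R \<in> K" "card R = d" "closed_simplex K R \<subseteq> ball_boundary d K"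
  shows "\<exists>!\<sigma>. \<sigma> \<in> facets d K \<and> R \<subseteq> \<sigma>"
proof (rule ex_ex1I)
  show "\<exists>\<sigma>. \<sigma> \<in> facets d K \<and> R \<subseteq> \<sigma>" using pure[OF R(1)] by blast
  fix \<sigma> \<sigma>' assume s: "\<sigma> \<in> facets d K \<and> R \<subseteq> \<sigma>" and s': "\<sigma>' \<in> facets d K \<and> R \<subseteq> \<sigma>'"
  obtain a where a: "a \<notin> R" "\<sigma> = insert a R" using facet_insert s R(2) by metis
  obtain b where b: "b \<notin> R" "\<sigma>' = insert b R" using facet_insert s' R(2) by metis
  show "\<sigma> = \<sigma>'"
  proof (rule ccontr)
    assume "\<sigma> \<noteq> \<sigma>'"
    then have "a \<noteq> b" using a b by blast
    have bR: "bary R \<in> X" "supp (bary R) = R" using bary_X[OF R(1)] supp_bary fin[OF R(1)] by auto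
    then have "bary R \<in> closed_simplex K R" by (simp add: closed_simplex_def)
    then have 1: "(\<Sum>i<d. (h (bary R) i)\<^sup>2) = 1" using ball_boundary_norm[OF hom] R(3) by blast
    have "insert a R \<in> K" "insert b R \<in> K" using s s' a b facetD(1) by auto
    from wall_open(2)[OF R(2) a(1) b(1) \<open>a \<noteq> b\<close> this] have "(\<Sum>i<d. (h (bary R) i)\<^sup>2) < 1"
      using bR by auto
    then show False using 1 by simp
  qed
qed

definition cell :: "'v set \<Rightarrow> ('v \<Rightarrow> real) set" where "cell \<sigma> = {x \<in> D. supp x \<subseteq> \<sigma>}"

text \<open>Strictly inside a segment the support is the union of the supports of the ends, so a
  closed facet stays convex when its small faces are removed.\<close>

lemma connected_cell:
  assumes "\<sigma> \<in> facets d K" shows "connected (cell \<sigma>)"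
proof (rule fconvex_connected, unfold fconvex_def, intro ballI)
  fix x y t assume x: "x \<in> cell \<sigma>" and y: "y \<in> cell \<sigma>" and t: "t \<in> {0..1::real}"
  have xX: "x \<in> X" "y \<in> X" and s: "supp x \<subseteq> \<sigma>" "supp y \<subseteq> \<sigma>" and c: "d \<le> card (supp x)"
    using x y by (simp_all add: cell_def D_def)
  note L = lerp_X[OF xX facetD(1)[OF assms] s]
  consider "t = 0" | "t = 1" | "0 < t" "t < 1" using t by fastforce
  then show "lerp t x y \<in> cell \<sigma>"
  proof cases
    case 3
    have "card (supp x) \<le> card (supp (lerp t x y))"
      unfolding supp_lerp[OF xX 3] by (rule card_mono) (use s facetD(3)[OF assms] in \<open>auto intro: finite_subset\<close>)
    then show ?thesis using L[of t] 3 c by (simp add: cell_def D_def)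
  qed (use x y in auto)
qed

text \<open>If removing the wall did not separate the facets, then a map to the circle winding once
  across the wall would be well defined and would lift to the line, as \<open>D\<close> is homeomorphic to a
  convex set; but a lift is constant off the wall and jumps by \<open>2\<pi>\<close> across it.\<close>

lemma wall_separates:
  assumes \<tau>: "card \<tau> = d" and ab: "a \<notin> \<tau>" "b \<notin> \<tau>" "a \<noteq> b"
    and F: "insert a \<tau> \<in> facets d K" "insert b \<tau> \<in> facets d K"
  shows "\<exists>P Q. P \<union> Q = facets d K \<and> P \<inter> Q = {} \<and> insert a \<tau> \<in> P \<and> insert b \<tau> \<in> Q \<and>
    (\<forall>p\<in>P. \<forall>q\<in>Q. card (p \<inter> q) = d \<longrightarrow> p \<inter> q = \<tau>)"
proof -
  have f\<tau>: "finite \<tau>" using facetD(3)[OF F(1)] by simp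
  have two: "\<sigma> = insert a \<tau> \<or> \<sigma> = insert b \<tau>" if "\<sigma> \<in> facets d K" "\<tau> \<subseteq> \<sigma>" for \<sigma>
    using wall_two_facets[OF \<tau> ab facetD(1)[OF F(1)] facetD(1)[OF F(2)] that] .
  have neq: "insert a \<tau> \<noteq> insert b \<tau>" using ab by blast
  \<comment> \<open>Vanishes on the realization exactly where a coordinate in \<open>\<tau>\<close>
    does, in particular on all walls of the two facets other than \<open>\<tau>\<close>.\<close>
  define \<mu> where "\<mu> = (\<lambda>x :: 'v \<Rightarrow> real. \<Prod>v\<in>\<tau>. x v)"
  have \<mu>: "0 \<le> \<mu> x" "\<mu> x = 0 \<longleftrightarrow> \<not> \<tau> \<subseteq> supp x" if "x \<in> X" for x
    using X_nn[OF that] f\<tau> by (auto simp: \<mu>_def intro: prod_nonneg)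
  \<comment> \<open>An angle on each facet: 0 on all other walls, and on \<open>\<tau>\<close> equal
    to pi from one side and -pi from the other. On a cell \<open>\<mu> x\<close> and the coordinate
    of the apex cannot both vanish, so the denominator is positive.\<close>
  define \<phi> where "\<phi> = (\<lambda>\<sigma> (x :: 'v \<Rightarrow> real). if \<sigma> = insert a \<tau> then pi * \<mu> x / (\<mu> x + x a)
     else if \<sigma> = insert b \<tau> then - (pi * \<mu> x / (\<mu> x + x b)) else 0)"
  have DX: "x \<in> X" if "x \<in> D" for x using that D_subset by (rule subsetD[rotated])
  have cX: "x \<in> X" and cD: "x \<in> D" and cs: "supp x \<subseteq> \<sigma>" if "x \<in> cell \<sigma>" for x \<sigma>
    using that D_subset by (auto simp: cell_def)
  have pos: "0 < \<mu> x + x v" if "x \<in> cell (insert v \<tau>)" "v \<notin> \<tau>" for x v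
  proof (cases "x v = 0")
    case True
    then have s: "supp x \<subseteq> \<tau>" using cs[OF that(1)] by auto
    moreover have "card \<tau> \<le> card (supp x)" using cD[OF that(1)] \<tau> by (simp add: D_def)
    ultimately have "supp x = \<tau>" using f\<tau> by (simp add: card_seteq)
    then have "\<mu> x \<noteq> 0" using \<mu>(2)[OF cX[OF that(1)]] by simp
    then show ?thesis using \<mu>(1)[OF cX[OF that(1)]] True by simp
  next
    case False
    then show ?thesis using \<mu>(1)[OF cX[OF that(1)]] X_nn[OF cX[OF that(1)], of v] by simp
  qed
  have cont\<mu>: "continuous_on S \<mu>" for S unfolding \<mu>_def by (intro continuous_intros continuous_on_coord)
  have cont\<phi>: "continuous_on (cell \<sigma>) (\<phi> \<sigma>)" for \<sigma>
  proof -
    have 1: "continuous_on (cell (insert v \<tau>)) (\<lambda>x. pi * \<mu> x / (\<mu> x + x v))" if "v \<notin> \<tau>" for v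
      using pos[OF _ that] by (intro continuous_intros cont\<mu> continuous_on_coord) force
    consider "\<sigma> = insert a \<tau>" | "\<sigma> = insert b \<tau>" "\<sigma> \<noteq> insert a \<tau>" | "\<sigma> \<noteq> insert a \<tau>" "\<sigma> \<noteq> insert b \<tau>" by blast
    then show ?thesis
    proof cases
      case 1
      then show ?thesis using \<open>\<And>v. v \<notin> \<tau> \<Longrightarrow> _\<close>[OF ab(1)] by (simp add: \<phi>_def)
    next
      case 2
      then show ?thesis using continuous_on_minus[OF \<open>\<And>v. v \<notin> \<tau> \<Longrightarrow> _\<close>[OF ab(2)]] by (simp add: \<phi>_def)
    qed (simp add: \<phi>_def)
  qed
  have \<phi>0: "\<phi> \<sigma> x = 0" if "x \<in> X" "\<not> \<tau> \<subseteq> supp x" for \<sigma> x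
    using \<mu>(2)[OF that(1)] that(2) by (simp add: \<phi>_def)
  have \<phi>a: "\<phi> (insert a \<tau>) x = pi" and \<phi>b: "\<phi> (insert b \<tau>) x = - pi" if "x \<in> X" "supp x = \<tau>" for x
  proof -
    have "x a = 0" "x b = 0" using ab(1,2) unfolding that(2)[symmetric] by simp_all
    moreover have "\<mu> x \<noteq> 0" using \<mu>(2)[OF that(1)] that(2) by simp
    ultimately show "\<phi> (insert a \<tau>) x = pi" "\<phi> (insert b \<tau>) x = - pi" using neq by (simp_all add: \<phi>_def)
  qed
  \<comment> \<open>Both pi and -pi give the value -1, so the functions on the facets agree on
    \<open>\<tau>\<close> as well and can be pasted.\<close>
  define E where "E = (\<lambda>\<sigma> x. exp (\<i> * of_real (\<phi> \<sigma> x)))"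
  have agree: "E \<sigma> x = E \<sigma>' x" if s: "\<sigma> \<in> facets d K" "\<sigma>' \<in> facets d K" "x \<in> cell \<sigma>" "x \<in> cell \<sigma>'" for \<sigma> \<sigma>' x
  proof (cases "\<tau> \<subseteq> supp x \<and> \<sigma> \<noteq> \<sigma>'")
    case True
    have st: "\<tau> \<subseteq> \<sigma>" "\<tau> \<subseteq> \<sigma>'" using True cs[OF s(3)] cs[OF s(4)] by auto
    have "\<sigma> = insert a \<tau> \<and> \<sigma>' = insert b \<tau> \<or> \<sigma> = insert b \<tau> \<and> \<sigma>' = insert a \<tau>"
      using two[OF s(1) st(1)] two[OF s(2) st(2)] True by blast
    moreover from this have "supp x \<subseteq> insert a \<tau> \<inter> insert b \<tau>" using cs[OF s(3)] cs[OF s(4)] by auto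
    then have "supp x = \<tau>" using True ab by auto
    moreover have "exp (\<i> * complex_of_real pi) = exp (\<i> * complex_of_real (- pi))"
      by (simp add: exp_minus)
    ultimately show ?thesis using \<phi>a[OF cX[OF s(3)]] \<phi>b[OF cX[OF s(3)]] unfolding E_def by metis
  next
    case False
    then show ?thesis using \<phi>0[OF cX[OF s(3)]] unfolding E_def by metis
  qed
  have cov: "\<exists>\<sigma>\<in>facets d K. x \<in> cell \<sigma>" if xD: "x \<in> D" for x
    unfolding cell_def using pure[OF X_supp[OF DX[OF xD]]] xD by (simp only: mem_Collect_eq simp_thms)
  define f where "f x = E (SOME \<sigma>. \<sigma> \<in> facets d K \<and> x \<in> cell \<sigma>) x" for x
  have f: "f x = E \<sigma> x" if "\<sigma> \<in> facets d K" "x \<in> cell \<sigma>" for \<sigma> x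
    unfolding f_def
  proof (rule someI2)
    show "\<sigma> \<in> facets d K \<and> x \<in> cell \<sigma>" using that ..
    show "E \<sigma>' x = E \<sigma> x" if s': "\<sigma>' \<in> facets d K \<and> x \<in> cell \<sigma>'" for \<sigma>'
      by (rule agree[OF conjunct1[OF s'] _ conjunct2[OF s']]) fact+
  qed
  have "continuous_map (top_of_set D) euclidean f"
  proof (rule pasting_lemma_closed[where I = "facets d K" and T = cell and f = E])
    show "closedin (top_of_set D) (cell \<sigma>)" for \<sigma>
    proof -
      have "cell \<sigma> = D \<inter> {x. supp x \<subseteq> \<sigma>}" by (auto simp: cell_def)
      then show ?thesis using closedin_closed_Int[OF closed_supp_subset] by metis
    qed
    have "continuous_on (cell \<sigma>) (E \<sigma>)" for \<sigma> unfolding E_def by (intro continuous_intros cont\<phi>)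
    moreover have "cell \<sigma> \<subseteq> D" for \<sigma> by (auto simp: cell_def)
    ultimately show "continuous_map (subtopology (top_of_set D) (cell \<sigma>)) euclidean (E \<sigma>)" for \<sigma>
      by (simp add: subtopology_subtopology Int_absorb1)
    show "E \<sigma> x = E \<sigma>' x" if "\<sigma> \<in> facets d K" "\<sigma>' \<in> facets d K" "x \<in> topspace (top_of_set D) \<inter> cell \<sigma> \<inter> cell \<sigma>'" for \<sigma> \<sigma>' x
      using agree that by blast
    show "\<exists>\<sigma>. \<sigma> \<in> facets d K \<and> x \<in> cell \<sigma> \<and> f x = E \<sigma> x" if "x \<in> topspace (top_of_set D)" for x
      using cov[of x] f that by auto
  qed (rule fin_facets)
  then have cf: "continuous_on D f" by simp
  have chD: "continuous_on (h ` D) g" by (rule continuous_on_subset[OF cont_g hD])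
  have "continuous_on (h ` D) (f \<circ> g)"
    by (rule continuous_on_compose[OF chD]) (simp only: ghD[OF order_refl] cf)
  moreover have "(f \<circ> g) y \<noteq> 0" if "y \<in> h ` D" for y
    unfolding f_def E_def comp_def by simp
  moreover have "y i = 0" if "y \<in> h ` D" "d \<le> i" for y i
    using subsetD[OF hD that(1)] that(2) by (simp add: fcball_def)
  ultimately obtain l where l: "continuous_on (h ` D) l" "\<And>y. y \<in> h ` D \<Longrightarrow> (f \<circ> g) y = exp (l y)"
    using continuous_logarithm_on_fconvex[OF fconvex_hD, of d "f \<circ> g"] by blast
  define L where "L = l \<circ> h"
  have cL: "continuous_on D L" unfolding L_def
    by (rule continuous_on_compose[OF continuous_on_subset[OF cont_h D_subset] l(1)])
  have fL: "f x = exp (L x)" if "x \<in> D" for x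
    using l(2)[OF imageI[OF that]] gh[OF DX[OF that]] by (simp add: L_def)
  \<comment> \<open>On a cell the lift and the angle have the same exponential, so \<open>G\<close>
    takes values in the integer multiples of 2 pi i and is constant there.\<close>
  define G where "G = (\<lambda>\<sigma> x. L x - \<i> * of_real (\<phi> \<sigma> x))"
  have G1: "exp (G \<sigma> x) = 1" if "\<sigma> \<in> facets d K" "x \<in> cell \<sigma>" for \<sigma> x
    using f[OF that] fL[OF cD[OF that(2)]] by (simp add: G_def E_def exp_diff)
  have G_const: "G \<sigma> constant_on cell \<sigma>" if s: "\<sigma> \<in> facets d K" for \<sigma>
  proof (rule continuous_discrete_range_constant[OF connected_cell[OF s]])
    have "cell \<sigma> \<subseteq> D" by (auto simp: cell_def)
    then show "continuous_on (cell \<sigma>) (G \<sigma>)" unfolding G_def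
      by (intro continuous_intros cont\<phi> continuous_on_subset[OF cL])
    fix x assume x: "x \<in> cell \<sigma>"
    have "2 * pi \<le> norm (G \<sigma> y - G \<sigma> x)" if y: "y \<in> cell \<sigma>" "G \<sigma> y \<noteq> G \<sigma> x" for y
    proof -
      have "exp (G \<sigma> y) = exp (G \<sigma> x)" using G1 s x y by simp
      then obtain n :: int where n: "G \<sigma> y = G \<sigma> x + of_int (2 * n) * pi * \<i>" by (auto simp: exp_eq)
      then have "n \<noteq> 0" using y(2) by auto
      then have "1 \<le> \<bar>of_int n :: real\<bar>" by linarith
      moreover have "norm (G \<sigma> y - G \<sigma> x) = 2 * pi * \<bar>of_int n\<bar>" using n by (simp add: norm_mult)
      ultimately show ?thesis by (simp add: mult_le_cancel_left1)
    qed
    then show "\<exists>e>0. \<forall>y. y \<in> cell \<sigma> \<and> G \<sigma> y \<noteq> G \<sigma> x \<longrightarrow> e \<le> norm (G \<sigma> y - G \<sigma> x)"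
      by (intro exI[of _ "2 * pi"]) simp
  qed
  define \<kappa> where "\<kappa> \<sigma> = G \<sigma> (bary \<sigma>)" for \<sigma>
  have \<kappa>: "G \<sigma> x = \<kappa> \<sigma>" if s: "\<sigma> \<in> facets d K" "x \<in> cell \<sigma>" for \<sigma> x
  proof -
    have "bary \<sigma> \<in> cell \<sigma>" using bary_facet_D[OF s(1)] supp_bary[OF facetD(3)[OF s(1)]] by (simp add: cell_def)
    then show ?thesis using G_const[OF s(1)] s(2) unfolding \<kappa>_def constant_on_def by metis
  qed
  have bc: "bary \<rho> \<in> X" "supp (bary \<rho>) = \<rho>" "bary \<rho> \<in> cell \<sigma>"
    if "\<rho> \<in> K" "card \<rho> = d" "\<rho> \<subseteq> \<sigma>" for \<rho> \<sigma>
    using bary_X[OF that(1)] supp_bary[OF fin[OF that(1)]] that by (simp_all add: cell_def D_def)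
  have \<tau>K: "\<tau> \<in> K" by (rule face[OF facetD(1)[OF F(1)]]) (use \<tau> d2 in auto)
  \<comment> \<open>The constant changes by 2 pi i across \<open>\<tau>\<close> and by nothing
    across any other wall, where the angles of both sides are 0. Its level set at
    \<open>insert a \<tau>\<close> is therefore one side of \<open>\<tau>\<close>.\<close>
  let ?P = "{\<sigma> \<in> facets d K. \<kappa> \<sigma> = \<kappa> (insert a \<tau>)}" and ?Q = "{\<sigma> \<in> facets d K. \<kappa> \<sigma> \<noteq> \<kappa> (insert a \<tau>)}"
  have "\<kappa> (insert b \<tau>) \<noteq> \<kappa> (insert a \<tau>)"
  proof -
    note ba = bc[OF \<tau>K \<tau> subset_insertI[of \<tau> a]] and bb = bc[OF \<tau>K \<tau> subset_insertI[of \<tau> b]]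
    have "\<kappa> (insert a \<tau>) = L (bary \<tau>) - \<i> * of_real pi"
      using \<kappa>[OF F(1) ba(3)] \<phi>a[OF ba(1,2)] by (simp add: G_def)
    moreover have "\<kappa> (insert b \<tau>) = L (bary \<tau>) + \<i> * of_real pi"
      using \<kappa>[OF F(2) bb(3)] \<phi>b[OF ba(1,2)] by (simp add: G_def)
    ultimately show ?thesis by (simp add: complex_eq_iff)
  qed
  moreover have "p \<inter> q = \<tau>" if p: "p \<in> ?P" and q: "q \<in> ?Q" and c: "card (p \<inter> q) = d" for p q
  proof (rule ccontr)
    assume ne: "p \<inter> q \<noteq> \<tau>"
    have pf: "p \<in> facets d K" "q \<in> facets d K" using p q by auto
    have "p \<inter> q \<noteq> {}" using c d2 by auto
    then have pqK: "p \<inter> q \<in> K" by (rule face[OF facetD(1)[OF pf(1)]]) simp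
    note bp = bc[OF pqK c Int_lower1] and bq = bc[OF pqK c Int_lower2]
    have "\<not> \<tau> \<subseteq> p \<inter> q" using ne c \<tau> fin[OF pqK] by (metis card_subset_eq)
    then have "\<phi> p (bary (p \<inter> q)) = 0" "\<phi> q (bary (p \<inter> q)) = 0" using \<phi>0[OF bp(1)] bp(2) by auto
    then have "G p (bary (p \<inter> q)) = G q (bary (p \<inter> q))" by (simp add: G_def)
    then have "\<kappa> p = \<kappa> q" using \<kappa>[OF pf(1) bp(3)] \<kappa>[OF pf(2) bq(3)] by simp
    then show False using p q by simp
  qed
  ultimately show ?thesis using F by (intro exI[of _ ?P] exI[of _ ?Q]) auto
qed

end

section \<open>Growing a stacked family until it contains all facets\<close>

lemma stacked_nonempty: "stacked d R F \<Longrightarrow> F \<noteq> {}"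
  by (induction rule: stacked.induct) auto

text \<open>Serves to show that a stacked family containing only one of the two facets at a wall
  stays on one side of that wall.\<close>

lemma stacked_connected:
  assumes "stacked d R F" "F = A \<union> B" "A \<inter> B = {}" "A \<noteq> {}" "B \<noteq> {}"
  shows "\<exists>p\<in>A. \<exists>q\<in>B. card (p \<inter> q) = d"
  using assms
proof (induction arbitrary: A B)
  case (base w)
  obtain p where p: "p \<in> A" using base.prems(3) by auto
  obtain q where q: "q \<in> B" using base.prems(4) by auto
  have "p = insert w R" "q = insert w R" using p q base.prems(1) by (metis UnI1 singletonD, metis UnI2 singletonD)
  then show ?case using p q base.prems(2) by auto
next
  case (step F \<sigma> \<tau> w)
  let ?\<nu> = "insert w \<tau>"
  have wF: "?\<nu> \<notin> F" using step.hyps(7) by blast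
  have adj: "card (?\<nu> \<inter> \<sigma>) = d" "card (\<sigma> \<inter> ?\<nu>) = d"
  proof -
    have "w \<notin> \<sigma>" using step.hyps(2,7) by blast
    then have "?\<nu> \<inter> \<sigma> = \<tau>" "\<sigma> \<inter> ?\<nu> = \<tau>" using step.hyps(3) by auto
    then show "card (?\<nu> \<inter> \<sigma>) = d" "card (\<sigma> \<inter> ?\<nu>) = d" using step.hyps(4) by simp_all
  qed
  have F: "F = (A - {?\<nu>}) \<union> (B - {?\<nu>})" using step.prems(1) wF by auto
  have disj: "(A - {?\<nu>}) \<inter> (B - {?\<nu>}) = {}" using step.prems(2) by auto
  show ?case
  proof (cases "A - {?\<nu>} = {} \<or> B - {?\<nu>} = {}")
    case True
    then show ?thesis
    proof
      assume A: "A - {?\<nu>} = {}"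
      then have "A = {?\<nu>}" using step.prems(3) by auto
      moreover have "\<sigma> \<in> B" using step.hyps(2) F A by auto
      ultimately show ?thesis using adj(1) by blast
    next
      assume B: "B - {?\<nu>} = {}"
      then have "B = {?\<nu>}" using step.prems(4) by auto
      moreover have "\<sigma> \<in> A" using step.hyps(2) F B by auto
      ultimately show ?thesis using adj(2) by blast
    qed
  next
    case False
    then have "\<exists>p\<in>A - {?\<nu>}. \<exists>q\<in>B - {?\<nu>}. card (p \<inter> q) = d" using step.IH[OF F disj] by simp
    then show ?thesis by auto
  qed
qed

context ball_complex
begin

text \<open>Take a maximal stacked family \<open>F\<close> of facets. If a facet is missing, strong
  connectivity gives a missing facet \<open>\<sigma>\<close> that shares a wall
  \<open>\<tau>\<close> with a facet of \<open>F\<close>. The point is then that the vertex of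
  \<open>\<sigma>\<close> off \<open>\<tau>\<close> is new, so that \<open>F\<close> could have been
  enlarged.\<close>

theorem stacked_facets:
  assumes R: "R \<in> K" "card R = d" "closed_simplex K R \<subseteq> ball_boundary d K"
  shows "stacked d R (facets d K)"
proof -
  obtain \<sigma>0 where s0: "\<sigma>0 \<in> facets d K" "R \<subseteq> \<sigma>0" using pure[OF R(1)] by blast
  have uniq: "\<sigma> = \<sigma>'" if "\<sigma> \<in> facets d K" "\<sigma>' \<in> facets d K" "R \<subseteq> \<sigma>" "R \<subseteq> \<sigma>'" for \<sigma> \<sigma>'
    using root_unique_facet[OF R] that by auto
  obtain w where w: "w \<notin> R" "\<sigma>0 = insert w R" using facet_insert[OF s0 R(2)] by metis
  let ?S = "{F. F \<subseteq> facets d K \<and> stacked d R F}"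
  have "{\<sigma>0} \<in> ?S" using stacked.base[OF fin[OF R(1)] R(2) w(1)] s0(1) w(2) by simp
  then have neS: "?S \<noteq> {}" by (rule ex_in_conv[THEN iffD1, OF exI])
  have finS: "finite ?S" by (rule finite_subset[of _ "Pow (facets d K)"]) (use fin_facets in auto)
  from finite_has_maximal[OF finS neS] obtain F where F: "F \<in> ?S" "\<forall>G\<in>?S. F \<subseteq> G \<longrightarrow> F = G" ..
  then have Fsub: "F \<subseteq> facets d K" and Fst: "stacked d R F" by simp_all
  have "F = facets d K"
  proof (rule ccontr)
    assume "F \<noteq> facets d K"
    then have "facets d K - F \<noteq> {}" using Fsub by auto
    moreover have "F \<union> (facets d K - F) = facets d K" using Fsub by auto
    moreover have "F \<inter> (facets d K - F) = {}" by auto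
    ultimately obtain \<sigma>' \<sigma> where s: "\<sigma>' \<in> F" "\<sigma> \<in> facets d K - F" "card (\<sigma>' \<inter> \<sigma>) = d"
      using strongly_connected stacked_nonempty[OF Fst] by metis
    define \<tau> where "\<tau> = \<sigma>' \<inter> \<sigma>"
    have sf: "\<sigma>' \<in> facets d K" "\<sigma> \<in> facets d K" "\<sigma> \<notin> F" using s Fsub by auto
    have \<tau>: "card \<tau> = d" "\<tau> \<subseteq> \<sigma>'" "\<tau> \<subseteq> \<sigma>" using s(3) by (auto simp: \<tau>_def)
    obtain a where a: "a \<notin> \<tau>" "\<sigma>' = insert a \<tau>" using facet_insert[OF sf(1) \<tau>(2,1)] by metis
    obtain b where b: "b \<notin> \<tau>" "\<sigma> = insert b \<tau>" using facet_insert[OF sf(2) \<tau>(3,1)] by metis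
    have ab: "a \<noteq> b" using a b s(1) sf(3) by auto
    have fab: "insert a \<tau> \<in> facets d K" "insert b \<tau> \<in> facets d K" using sf a b by simp_all
    have two: "\<rho> = \<sigma>' \<or> \<rho> = \<sigma>" if "\<rho> \<in> facets d K" "\<tau> \<subseteq> \<rho>" for \<rho>
      using wall_two_facets[OF \<tau>(1) a(1) b(1) ab facetD(1)[OF fab(1)] facetD(1)[OF fab(2)] that] a b by simp
    from wall_separates[OF \<tau>(1) a(1) b(1) ab fab]
    obtain P Q where PQ: "P \<union> Q = facets d K" "P \<inter> Q = {}" "\<sigma>' \<in> P" "\<sigma> \<in> Q"
      "\<And>p q. p \<in> P \<Longrightarrow> q \<in> Q \<Longrightarrow> card (p \<inter> q) = d \<Longrightarrow> p \<inter> q = \<tau>"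
      unfolding a(2)[symmetric] b(2)[symmetric] by auto
    \<comment> \<open>To reach the other side \<open>F\<close> would need adjacent facets meeting in
      \<open>\<tau>\<close>. Only two facets contain \<open>\<tau>\<close>, and
      \<open>\<sigma>\<close> is not in \<open>F\<close>.\<close>
    have FP: "F \<inter> Q = {}"
    proof (rule ccontr)
      assume ne: "F \<inter> Q \<noteq> {}"
      have "F = (F \<inter> P) \<union> (F \<inter> Q)" "(F \<inter> P) \<inter> (F \<inter> Q) = {}" "F \<inter> P \<noteq> {}" using PQ(1,2,3) Fsub s(1) by auto
      then obtain p q where pq: "p \<in> F \<inter> P" "q \<in> F \<inter> Q" "card (p \<inter> q) = d"
        using stacked_connected[OF Fst _ _ _ ne] by metis
      have "p \<inter> q = \<tau>" using PQ(5) pq by auto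
      then have "\<tau> \<subseteq> p" "\<tau> \<subseteq> q" by auto
      then have "p = \<sigma>'" "q = \<sigma>'" using two[of p] two[of q] pq(1,2) Fsub sf(3) by auto
      then show False using pq PQ(2) by auto
    qed
    \<comment> \<open>Otherwise both sides have facets at \<open>b\<close>, and connectivity at
      \<open>b\<close> gives an adjacent pair across the wall with \<open>b\<close> in common; but
      such a pair meets in \<open>\<tau>\<close>, which misses \<open>b\<close>.\<close>
    have bF: "b \<notin> \<Union>F"
    proof
      assume "b \<in> \<Union>F"
      then obtain \<rho> where r: "\<rho> \<in> F" "b \<in> \<rho>" by blast
      then have rP: "\<rho> \<in> P" using FP Fsub PQ(1) by auto
      let ?P = "{\<sigma> \<in> P. b \<in> \<sigma>}" and ?Q = "{\<sigma> \<in> Q. b \<in> \<sigma>}"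
      have 1: "?P \<union> ?Q = {\<sigma> \<in> facets d K. b \<in> \<sigma>}" unfolding PQ(1)[symmetric] by blast
      have 2: "?P \<inter> ?Q = {}" using PQ(2) by blast
      have 3: "?P \<noteq> {}" using rP r(2) by blast
      have 4: "?Q \<noteq> {}" using PQ(4) b(2) by blast
      from vertex_connected[OF 1 2 3 4] obtain p q where pq: "p \<in> ?P" "q \<in> ?Q" "card (p \<inter> q) = d" "b \<in> p \<inter> q"
        by (elim bexE conjE)
      have "p \<inter> q = \<tau>" using PQ(5)[of p q] pq(1-3) by simp
      then have "b \<in> \<tau>" using pq(4) by (simp only:)
      then show False using b(1) by simp
    qed
    have "\<tau> \<noteq> R" using uniq[OF sf(1,2)] \<tau>(2,3) s(1) sf(3) by auto
    moreover have "\<forall>\<rho>\<in>F. \<tau> \<subseteq> \<rho> \<longrightarrow> \<rho> = \<sigma>'"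
    proof (intro ballI impI)
      fix \<rho> assume "\<rho> \<in> F" "\<tau> \<subseteq> \<rho>"
      then show "\<rho> = \<sigma>'" using two[of \<rho>] Fsub sf(3) by auto
    qed
    ultimately have "stacked d R (insert (insert b \<tau>) F)"
      using stacked.step[OF Fst s(1) \<tau>(2,1) _ _ bF] by simp
    then have "insert \<sigma> F \<in> ?S" using Fsub sf(2) b(2) by simp
    then have "F \<subseteq> insert \<sigma> F \<longrightarrow> F = insert \<sigma> F" by (rule bspec[OF F(2)])
    then show False using sf(3) by auto
  qed
  then show ?thesis using Fst by simp
qed

end

theorem fuss_catalan_stacked:
  assumes "2 \<le> d" "fuss_catalan_complex d n K" "R \<in> K" "card R = d" "closed_simplex K R \<subseteq> ball_boundary d K"
  shows "stacked d R (facets d K)" "K = faces (facets d K)"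
proof -
  obtain h g where hg: "homeomorphism (realization K) (fcball d) h g"
    using assms(2) unfolding fuss_catalan_complex_def realization_top_eq closed_ball_top_eq homeomorphic_space_euclidean by blast
  interpret ball_complex d K h g
  proof
    show "facets d K \<noteq> {}" using assms(2) by (auto simp: fuss_catalan_complex_def)
  qed (use assms(1,2) hg in \<open>simp_all add: fuss_catalan_complex_def\<close>)
  show "stacked d R (facets d K)" using stacked_facets assms by blast
  show "K = faces (facets d K)" by (simp add: faces_facets)
qed

section \<open>Rooted complexes and trees\<close>

lemma Union_tree_complex:
  assumes "dtree d T" shows "\<Union>(tree_complex d T) = set (root_at d []) \<union> apex ` T"
proof
  have sub: "set (root_at d q) \<subseteq> set (root_at d []) \<union> apex ` T" if "q \<in> T" for q
    using that
  proof (induction q)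
    case (Cons i q)
    then have "q \<in> T" using dtree_tl[OF assms] by blast
    then show ?case using Cons.IH set_root_at_Cons_subset[of d i q] by (auto simp: facet_at_def)
  qed simp
  show "\<Union>(tree_complex d T) \<subseteq> set (root_at d []) \<union> apex ` T"
  proof
    fix v assume "v \<in> \<Union>(tree_complex d T)"
    then consider "v \<in> set (root_at d [])" | q where "q \<in> T" "v \<in> facet_at d q"
      by (auto simp: tree_complex_def faces_def)
    then show "v \<in> set (root_at d []) \<union> apex ` T"
    proof cases
      case 2
      then show ?thesis using sub[OF 2(1)] by (auto simp: facet_at_def)
    qed simp
  qed
  show "set (root_at d []) \<union> apex ` T \<subseteq> \<Union>(tree_complex d T)"
  proof
    fix v assume "v \<in> set (root_at d []) \<union> apex ` T"
    then have "{v} \<in> tree_complex d T" by (auto simp: tree_complex_def faces_def facet_at_def)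
    then show "v \<in> \<Union>(tree_complex d T)" by blast
  qed
qed

lemma tree_complex_eq:
  assumes "dtree d T" "T \<noteq> {}" shows "tree_complex d T = faces (facet_at d ` T)"
proof -
  have "[] \<in> T" by (rule dtree_Nil_mem[OF assms])
  moreover have "set (root_at d []) \<subseteq> facet_at d []" by (auto simp: facet_at_def)
  ultimately show ?thesis unfolding tree_complex_def faces_def by auto
qed

lemma image_faces: "(\<lambda>\<sigma>. f ` \<sigma>) ` faces F = faces ((\<lambda>\<sigma>. f ` \<sigma>) ` F)"
proof
  show "(\<lambda>\<sigma>. f ` \<sigma>) ` faces F \<subseteq> faces ((\<lambda>\<sigma>. f ` \<sigma>) ` F)" by (auto simp: faces_def)
  show "faces ((\<lambda>\<sigma>. f ` \<sigma>) ` F) \<subseteq> (\<lambda>\<sigma>. f ` \<sigma>) ` faces F"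
  proof
    fix \<rho> assume "\<rho> \<in> faces ((\<lambda>\<sigma>. f ` \<sigma>) ` F)"
    then obtain \<sigma> where s: "\<sigma> \<in> F" "\<rho> \<subseteq> f ` \<sigma>" "\<rho> \<noteq> {}" by (auto simp: faces_def)
    then obtain \<rho>' where "\<rho>' \<subseteq> \<sigma>" "\<rho> = f ` \<rho>'" by (meson subset_image_iff)
    then show "\<rho> \<in> (\<lambda>\<sigma>. f ` \<sigma>) ` faces F" using s by (auto simp: faces_def)
  qed
qed

lemma tree_rooted_fuss_catalan:
  assumes "dtree d T" "2 \<le> d"
  shows "rooted_fuss_catalan d (card T) (tree_complex d T) (root_at d [])"
proof (cases "T = {}")
  case True
  then show ?thesis
    by (auto simp: rooted_fuss_catalan_def tree_complex_def faces_def distinct_root_at)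
next
  case False
  have st: "stacked d (set (root_at d [])) (facet_at d ` T)" by (rule stacked_tree[OF assms(1) False])
  have c: "card (facet_at d ` T) = card T" by (rule card_image) (simp add: inj_on_def)
  have "card T \<noteq> 0" using False assms(1) by (simp add: dtree_def)
  then show ?thesis
    using stacked_fuss_catalan[OF st assms(2)] unfolding rooted_fuss_catalan_def tree_complex_eq[OF assms(1) False] c
    by (simp add: distinct_root_at)
qed

text \<open>Index 0 is treated apart: that complex has no facet and hence no stacked family, and its
  tree is empty.\<close>

lemma rooted_fuss_catalan_tree:
  assumes "rooted_fuss_catalan d n K r" "2 \<le> d"
  shows "\<exists>T. dtree d T \<and> card T = n \<and> rooted_iso (tree_complex d T, root_at d []) (K, r)"
proof (cases "n = 0")
  case True
  have r: "distinct r" "length r = d" and K: "K = faces {set r}"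
    using assms True by (auto simp: rooted_fuss_catalan_def faces_def)
  define f where "f = (\<lambda>v. r ! (v div 2))"
  have m: "map f (root_at d []) = r"
    by (rule nth_equalityI) (auto simp: r f_def root_at.simps(1) base_vertex_def)
  have s: "f ` set (root_at d []) = set r" using set_map[of f "root_at d []"] unfolding m by simp
  have "inj_on f (set (root_at d []))" using r(1) distinct_map[of f "root_at d []"] unfolding m by simp
  moreover have "(\<lambda>\<sigma>. f ` \<sigma>) ` tree_complex d {} = K"
    unfolding tree_complex_def image_faces K by (simp add: s)
  ultimately have "rooted_iso (tree_complex d {}, root_at d []) (K, r)"
    using m Union_tree_complex[of d "{}"] by (auto simp: rooted_iso_def)
  then show ?thesis using True by (intro exI[of _ "{}"]) simp
next
  case False
  then have r: "distinct r" "length r = d" and FC: "fuss_catalan_complex d n K" "set r \<in> K"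
    "closed_simplex K (set r) \<subseteq> ball_boundary d K" using assms by (auto simp: rooted_fuss_catalan_def)
  have c: "card (set r) = d" using r by (simp add: distinct_card)
  note S = fuss_catalan_stacked[OF assms(2) FC(1,2) c FC(3)]
  obtain T f where T: "dtree d T" "T \<noteq> {}" "inj_on f (\<Union>(facet_at d ` T))" "map f (root_at d []) = r"
    "(\<lambda>q. f ` facet_at d q) ` T = facets d K"
    using stacked_imp_tree[OF S(1) r] by (elim exE conjE)
  have "inj_on (\<lambda>q. f ` facet_at d q) T"
  proof (rule inj_onI)
    fix p q assume pq: "p \<in> T" "q \<in> T" "f ` facet_at d p = f ` facet_at d q"
    have "facet_at d p = facet_at d q" by (rule inj_on_image_eq_iff[THEN iffD1, OF T(3)]) (use pq in auto)
    then show "p = q" by simp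
  qed
  then have "card T = n" using card_image[of "\<lambda>q. f ` facet_at d q" T] T(5) FC(1) by (simp add: fuss_catalan_complex_def)
  moreover have U: "\<Union>(tree_complex d T) \<subseteq> \<Union>(facet_at d ` T)"
    unfolding tree_complex_eq[OF T(1,2)] by (auto simp: faces_def)
  moreover have "(\<lambda>\<sigma>. f ` \<sigma>) ` tree_complex d T = K"
    unfolding tree_complex_eq[OF T(1,2)] image_faces image_image T(5) by (rule S(2)[symmetric])
  ultimately show ?thesis
    using T(1,4) inj_on_subset[OF T(3) U] by (auto simp: rooted_iso_def)
qed

section \<open>Rooted isomorphism as an equivalence\<close>

lemma rooted_iso_refl: "rooted_iso X X"
  unfolding rooted_iso_def by (intro exI[of _ id]) (simp add: image_def)

text \<open>The inverse map is controlled only on the vertices of the complex, hence the hypothesis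
  on the marked list.\<close>

lemma rooted_iso_sym:
  assumes "set (snd X) \<subseteq> \<Union>(fst X)" "rooted_iso X Y" shows "rooted_iso Y X"
proof -
  obtain f where f: "inj_on f (\<Union>(fst X))" "(\<lambda>\<sigma>. f ` \<sigma>) ` fst X = fst Y" "map f (snd X) = snd Y"
    using assms by (auto simp: rooted_iso_def)
  define g where "g = inv_into (\<Union>(fst X)) f"
  have gf: "g (f v) = v" if "v \<in> \<Union>(fst X)" for v using that f(1) by (simp only: g_def inv_into_f_f)
  have U: "\<Union>(fst Y) = f ` \<Union>(fst X)" unfolding f(2)[symmetric] by auto
  have "inj_on g (\<Union>(fst Y))" unfolding U g_def by (simp add: inj_on_inv_into)
  moreover have "(\<lambda>\<sigma>. g ` \<sigma>) ` fst Y = fst X"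
  proof -
    have "g ` f ` \<sigma> = \<sigma>" if "\<sigma> \<in> fst X" for \<sigma>
    proof -
      have "g ` f ` \<sigma> = (\<lambda>v. v) ` \<sigma>" unfolding image_image by (rule image_cong[OF refl]) (use gf that in blast)
      then show ?thesis by simp
    qed
    then have "(\<lambda>\<sigma>. g ` f ` \<sigma>) ` fst X = (\<lambda>\<sigma>. \<sigma>) ` fst X" by (intro image_cong refl)
    then show ?thesis unfolding f(2)[symmetric] image_image by simp
  qed
  moreover have "map g (snd Y) = snd X"
    unfolding f(3)[symmetric] map_map by (rule map_idI) (simp add: gf[OF subsetD[OF assms(1)]])
  ultimately show ?thesis unfolding rooted_iso_def by blast
qed

lemma rooted_iso_trans:
  assumes "rooted_iso X Y" "rooted_iso Y Z" shows "rooted_iso X Z"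
proof -
  obtain f where f: "inj_on f (\<Union>(fst X))" "(\<lambda>\<sigma>. f ` \<sigma>) ` fst X = fst Y" "map f (snd X) = snd Y"
    using assms by (auto simp: rooted_iso_def)
  obtain g where g: "inj_on g (\<Union>(fst Y))" "(\<lambda>\<sigma>. g ` \<sigma>) ` fst Y = fst Z" "map g (snd Y) = snd Z"
    using assms by (auto simp: rooted_iso_def)
  have U: "\<Union>(fst Y) = f ` \<Union>(fst X)" unfolding f(2)[symmetric] by auto
  have "inj_on (g \<circ> f) (\<Union>(fst X))" using comp_inj_on[OF f(1)] g(1) U by simp
  moreover have "(\<lambda>\<sigma>. (g \<circ> f) ` \<sigma>) ` fst X = fst Z"
    unfolding g(2)[symmetric] f(2)[symmetric] image_image by (simp add: image_comp)
  moreover have "map (g \<circ> f) (snd X) = snd Z" unfolding g(3)[symmetric] f(3)[symmetric] by simp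
  ultimately show ?thesis unfolding rooted_iso_def by blast
qed

section \<open>Colourings\<close>

definition root_colours :: "nat \<Rightarrow> (nat \<Rightarrow> nat) \<Rightarrow> nat list" where
  "root_colours k \<beta> = replicate (\<beta> 0 - 1) 0 @ concat (map (\<lambda>i. replicate (\<beta> i) i) [1..<Suc k])"

lemma count_list_replicate: "count_list (replicate n x) c = (if x = c then n else 0)"
  by (induction n) auto

lemma count_root_colours:
  assumes "1 \<le> \<beta> 0"
  shows "count_list (root_colours k \<beta>) c + (if c = 0 then 1 else 0) = (if c \<le> k then \<beta> c else 0)"
proof -
  have "count_list (concat (map (\<lambda>i. replicate (\<beta> i) i) [1..<Suc k])) c = (if 1 \<le> c \<and> c \<le> k then \<beta> c else 0)"
    by (induction k) (auto simp: count_list_replicate)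
  then show ?thesis using assms by (auto simp: root_colours_def count_list_replicate)
qed

lemma length_root_colours:
  assumes "1 \<le> \<beta> 0" shows "length (root_colours k \<beta>) + 1 = (\<Sum>i\<le>k. \<beta> i)"
proof -
  have "length (concat (map (\<lambda>i. replicate (\<beta> i) i) [1..<Suc k])) = (\<Sum>i=1..k. \<beta> i)"
    by (induction k) auto
  moreover have "(\<Sum>i\<le>k. \<beta> i) = \<beta> 0 + (\<Sum>i=1..k. \<beta> i)"
    by (simp add: atMost_atLeast0 sum.atLeast_Suc_atMost)
  ultimately show ?thesis using assms by (simp add: root_colours_def)
qed

lemma card_colour_list:
  "distinct xs \<Longrightarrow> card {v \<in> set xs. f v = c} = count_list (map f xs) c"
proof (induction xs)
  case (Cons x xs)
  have "{v \<in> set (x # xs). f v = c} = (if f x = c then {x} else {}) \<union> {v \<in> set xs. f v = c}" by auto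
  then show ?case using Cons by (auto simp: card_insert_if)
qed simp

locale coloured_trees =
  fixes d k :: nat and \<beta> :: "nat \<Rightarrow> nat"
  assumes d2: "2 \<le> d" and \<beta>0: "1 \<le> \<beta> 0" and sum_\<beta>: "(\<Sum>i\<le>k. \<beta> i) = d + 1"
begin

text \<open>The marked wall has \<open>\<beta> 0 - 1\<close> vertices of colour 0, so the colour it
  misses is 0.\<close>

definition s0 :: "nat list \<times> nat" where "s0 = (root_colours k \<beta>, 0)"

text \<open>\<open>good_state\<close> ranges over all natural numbers as colours, whereas
  \<open>\<beta>\<close> is meaningful only up to \<open>k\<close>.\<close>

definition b :: "nat \<Rightarrow> nat" where "b c = (if c \<le> k then \<beta> c else 0)"

text \<open>Decodes the vertices of the universal complex: an odd number is an apex and gets the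
  colour missed by the wall of its node, an even number encodes a position in the initial
  wall.\<close>

definition col :: "nat \<Rightarrow> nat" where
  "col v = (if odd v then snd (fc_state s0 (from_nat (v div 2))) else root_colours k \<beta> ! (v div 2))"

lemma good_s0: "good_state d b s0"
  using count_root_colours[of \<beta> k] length_root_colours[of \<beta> k] \<beta>0 sum_\<beta> by (auto simp: good_state_def s0_def b_def)

lemma good_state: "set q \<subseteq> {..<d} \<Longrightarrow> good_state d b (fc_state s0 q)"
  by (induction q) (auto simp: good_s0 good_state_child)

lemma col_apex: "col (apex q) = snd (fc_state s0 q)"
  by (simp add: col_def apex_def)

lemma col_root_at: "set q \<subseteq> {..<d} \<Longrightarrow> map col (root_at d q) = fst (fc_state s0 q)"
proof (induction q)
  case Nil
  show ?case
    by (rule nth_equalityI) (use good_s0 in \<open>auto simp: good_state_def s0_def root_at.simps(1) col_def base_vertex_def\<close>)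
next
  case (Cons i q)
  then show ?case by (simp add: map_update fc_child_def col_apex)
qed

lemma card_facet_at_colour:
  "card {v \<in> facet_at d q. c v = i} = count_list (map c (root_at d q)) i + (if c (apex q) = i then 1 else 0)"
proof -
  have "{v \<in> facet_at d q. c v = i} = (if c (apex q) = i then {apex q} else {}) \<union> {v \<in> set (root_at d q). c v = i}"
    by (auto simp: facet_at_def)
  then show ?thesis using card_colour_list[OF distinct_root_at, of d q c i] by (auto simp: card_insert_if)
qed

lemma card_facet_at_col: "set q \<subseteq> {..<d} \<Longrightarrow> card {v \<in> facet_at d q. col v = i} = b i"
  unfolding card_facet_at_colour using col_root_at[of q] good_state[of q] by (auto simp: good_state_def col_apex)

lemma col_le: "set q \<subseteq> {..<d} \<Longrightarrow> v \<in> facet_at d q \<Longrightarrow> col v \<le> k"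
proof (rule ccontr)
  assume q: "set q \<subseteq> {..<d}" and v: "v \<in> facet_at d q" and "\<not> col v \<le> k"
  then have "card {u \<in> facet_at d q. col u = col v} = 0" by (simp add: card_facet_at_col b_def)
  moreover have "v \<in> {u \<in> facet_at d q. col u = col v}" "finite {u \<in> facet_at d q. col u = col v}" using v by simp_all
  ultimately show False by (metis card_0_eq empty_iff)
qed

lemma tree_words: "dtree d T \<Longrightarrow> q \<in> T \<Longrightarrow> set q \<subseteq> {..<d}"
  by (simp add: dtree_def)

lemma tree_colouring:
  assumes "dtree d T" shows "fc_colouring d k \<beta> (tree_complex d T) (root_at d []) col"
  unfolding fc_colouring_def
proof (intro conjI ballI allI impI)
  have m: "map col (root_at d []) = root_colours k \<beta>" using col_root_at[of "[]"] by (simp add: s0_def)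
  then show "map col (root_at d []) = replicate (\<beta> 0 - 1) 0 @ concat (map (\<lambda>i. replicate (\<beta> i) i) [1..<Suc k])"
    by (simp add: root_colours_def)
  show "col v \<le> k" if v: "v \<in> \<Union>(tree_complex d T)" for v
  proof -
    consider "v \<in> facet_at d []" | q where "q \<in> T" "v \<in> facet_at d q"
      using v unfolding Union_tree_complex[OF assms] by (auto simp: facet_at_def)
    then show ?thesis
    proof cases
      case 1
      then show ?thesis using col_le[of "[]" v] by simp
    next
      case 2
      then show ?thesis using col_le[OF tree_words[OF assms]] by blast
    qed
  qed
  show "card {v \<in> \<sigma>. col v = i} = \<beta> i" if "\<sigma> \<in> facets d (tree_complex d T)" "i \<le> k" for \<sigma> i
    using that card_facet_at_col tree_words[OF assms] by (auto simp: facets_tree_complex b_def)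
qed

text \<open>The colours on a wall and the prescribed numbers of vertices of each colour in the facet
  force the colour of the apex. The marked wall starts the induction.\<close>

lemma colouring_unique:
  assumes "dtree d T" "fc_colouring d k \<beta> (tree_complex d T) (root_at d []) c" "v \<in> \<Union>(tree_complex d T)"
  shows "c v = col v"
proof -
  have m: "map c (root_at d []) = map col (root_at d [])"
    using assms(2) tree_colouring[OF assms(1)] by (simp add: fc_colouring_def)
  have "q \<in> T \<longrightarrow> map c (root_at d q) = map col (root_at d q) \<and> c (apex q) = col (apex q)" for q
  proof (induction q)
    have step: "c (apex q) = col (apex q)" if q: "q \<in> T" "map c (root_at d q) = map col (root_at d q)" for q
    proof -
      let ?i = "col (apex q)"
      have "apex q \<in> facet_at d q" by (simp add: facet_at_def)
      then have i: "?i \<le> k" using col_le tree_words[OF assms(1) q(1)] by blast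
      have f: "facet_at d q \<in> facets d (tree_complex d T)" using q(1) by (simp add: facets_tree_complex)
      have "card {v \<in> facet_at d q. c v = ?i} = \<beta> ?i" "card {v \<in> facet_at d q. col v = ?i} = \<beta> ?i"
        using assms(2) tree_colouring[OF assms(1)] f i by (simp_all add: fc_colouring_def)
      then show ?thesis unfolding card_facet_at_colour q(2) by (simp split: if_splits)
    qed
    { case Nil
      show ?case using step m by blast
    next
      case (Cons i q)
      show ?case
      proof
        assume iq: "i # q \<in> T"
        then have "q \<in> T" by (rule dtree_tl[OF assms(1)])
        then have "map c (root_at d q) = map col (root_at d q)" "c (apex q) = col (apex q)" using Cons by simp_all
        then have "map c (root_at d (i # q)) = map col (root_at d (i # q))" by (simp only: root_at.simps map_update)
        then show "map c (root_at d (i # q)) = map col (root_at d (i # q)) \<and> c (apex (i # q)) = col (apex (i # q))"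
          using step[OF iq] by blast
      qed }
  qed
  moreover have "c v = col v" if "v \<in> set (root_at d [])" using m that by (simp only: map_eq_conv)
  ultimately show ?thesis using assms(3) unfolding Union_tree_complex[OF assms(1)] by blast
qed

lemma colour_class_size:
  assumes "dtree d T" "i \<le> k"
  shows "card {v \<in> \<Union>(tree_complex d T). col v = i} + (if i = 0 then 1 else 0) = \<beta> i + colour_count s0 T i"
proof -
  have fT: "finite T" using assms by (simp add: dtree_def)
  have eq: "{v \<in> \<Union>(tree_complex d T). col v = i} = {v \<in> set (root_at d []). col v = i} \<union> apex ` {q \<in> T. snd (fc_state s0 q) = i}"
    unfolding Union_tree_complex[OF assms(1)] by (auto simp: col_apex)
  have "apex q \<notin> set (root_at d [])" for q using apex_in_root_at[of q d "[]"] by auto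
  then have disj: "{v \<in> set (root_at d []). col v = i} \<inter> apex ` {q \<in> T. snd (fc_state s0 q) = i} = {}" by auto
  have "card (apex ` {q \<in> T. snd (fc_state s0 q) = i}) = colour_count s0 T i"
    unfolding colour_count_def by (rule card_image) (simp add: inj_on_def)
  moreover have "card {v \<in> set (root_at d []). col v = i} = count_list (root_colours k \<beta>) i"
    using card_colour_list[OF distinct_root_at, of d "[]" col i] col_root_at[of "[]"] by (simp add: s0_def)
  ultimately have "card {v \<in> \<Union>(tree_complex d T). col v = i} = count_list (root_colours k \<beta>) i + colour_count s0 T i"
    unfolding eq using fT disj by (subst card_Un_disjoint) auto
  then show ?thesis using count_root_colours[where \<beta> = \<beta> and k = k and c = i, OF \<beta>0] assms(2) by simp
qed

lemma colouring_transport: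
  assumes "inj_on f (\<Union>K)" "(\<lambda>\<sigma>. f ` \<sigma>) ` K = L" "map f r = r'" "fc_colouring d k \<beta> L r' c" "set r \<subseteq> \<Union>K"
  shows "fc_colouring d k \<beta> K r (c \<circ> f)"
    and "card {v \<in> \<Union>K. (c \<circ> f) v = i} = card {v \<in> \<Union>L. c v = i}"
proof -
  have card_f: "card {v \<in> A. (c \<circ> f) v = i} = card {v \<in> f ` A. c v = i}" if "A \<subseteq> \<Union>K" for A i
  proof -
    have "{v \<in> f ` A. c v = i} = f ` {v \<in> A. (c \<circ> f) v = i}" by auto
    moreover have "inj_on f {v \<in> A. (c \<circ> f) v = i}" by (rule inj_on_subset[OF assms(1)]) (use that in auto)
    ultimately show ?thesis by (simp add: card_image)
  qed
  have U: "\<Union>L = f ` \<Union>K" unfolding assms(2)[symmetric] by auto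
  then show "card {v \<in> \<Union>K. (c \<circ> f) v = i} = card {v \<in> \<Union>L. c v = i}" using card_f[of "\<Union>K"] by simp
  show "fc_colouring d k \<beta> K r (c \<circ> f)"
    unfolding fc_colouring_def
  proof (intro conjI ballI allI impI)
    show "(c \<circ> f) v \<le> k" if "v \<in> \<Union>K" for v using assms(4) U that by (auto simp: fc_colouring_def)
    show "map (c \<circ> f) r = replicate (\<beta> 0 - 1) 0 @ concat (map (\<lambda>i. replicate (\<beta> i) i) [1..<Suc k])"
      using assms(3,4) by (auto simp: fc_colouring_def)
    fix \<sigma> i assume s: "\<sigma> \<in> facets d K" "i \<le> k"
    have sK: "\<sigma> \<subseteq> \<Union>K" using s by (auto simp: facets_def)
    have "f ` \<sigma> \<in> facets d L"
      using s(1) assms(2) card_image[OF inj_on_subset[OF assms(1) sK]] by (auto simp: facets_def)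
    then show "card {v \<in> \<sigma>. (c \<circ> f) v = i} = \<beta> i"
      unfolding card_f[OF sK] using assms(4) s(2) by (auto simp: fc_colouring_def)
  qed
qed

text \<open>The summand 1 makes up for the marked wall, which has one vertex of colour 0 less than a
  facet; all other vertices are apices, one for each node.\<close>

definition tree_class :: "nat \<Rightarrow> (nat \<Rightarrow> nat) \<Rightarrow> nat list set set" where
  "tree_class n \<gamma> = {T. dtree d T \<and> card T = n \<and> (\<forall>i\<le>k. \<gamma> i + (if i = 0 then 1 else 0) = \<beta> i + colour_count s0 T i)}"

lemma tree_in_coloured:
  assumes "T \<in> tree_class n \<gamma>" shows "(tree_complex d T, root_at d []) \<in> coloured_rooted_fc d k n \<beta> \<gamma>"
proof -
  have T: "dtree d T" "card T = n" and g: "\<And>i. i \<le> k \<Longrightarrow> \<gamma> i + (if i = 0 then 1 else 0) = \<beta> i + colour_count s0 T i"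
    using assms by (auto simp: tree_class_def)
  have "card {v \<in> \<Union>(tree_complex d T). col v = i} = \<gamma> i" if "i \<le> k" for i
    using g[OF that] colour_class_size[OF T(1) that] by (simp split: if_splits)
  then show ?thesis
    using tree_rooted_fuss_catalan[OF T(1) d2] tree_colouring[OF T(1)] T(2) unfolding coloured_rooted_fc_def by blast
qed

lemma coloured_iso_tree:
  assumes "(K, r) \<in> coloured_rooted_fc d k n \<beta> \<gamma>"
  shows "\<exists>T\<in>tree_class n \<gamma>. rooted_iso (tree_complex d T, root_at d []) (K, r)"
proof -
  have R: "rooted_fuss_catalan d n K r" using assms by (simp add: coloured_rooted_fc_def)
  obtain c where c: "fc_colouring d k \<beta> K r c" "\<And>i. i \<le> k \<Longrightarrow> card {v \<in> \<Union>K. c v = i} = \<gamma> i"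
    using assms by (auto simp: coloured_rooted_fc_def)
  obtain T where T: "dtree d T" "card T = n" "rooted_iso (tree_complex d T, root_at d []) (K, r)"
    using rooted_fuss_catalan_tree[OF R d2] by (elim exE conjE)
  obtain f where f: "inj_on f (\<Union>(tree_complex d T))" "(\<lambda>\<sigma>. f ` \<sigma>) ` tree_complex d T = K" "map f (root_at d []) = r"
    using T(3) by (auto simp: rooted_iso_def)
  have sub: "set (root_at d []) \<subseteq> \<Union>(tree_complex d T)" unfolding Union_tree_complex[OF T(1)] by simp
  note tr = colouring_transport[OF f c(1) sub]
  have "{v \<in> \<Union>(tree_complex d T). (c \<circ> f) v = i} = {v \<in> \<Union>(tree_complex d T). col v = i}" for i
    by (rule Collect_cong) (metis colouring_unique[OF T(1) tr(1)])
  then have "\<gamma> i + (if i = 0 then 1 else 0) = \<beta> i + colour_count s0 T i" if "i \<le> k" for i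
    using colour_class_size[OF T(1) that] tr(2)[of i] c(2)[OF that] by simp
  then show ?thesis using T by (auto simp: tree_class_def)
qed

lemma root_in_complex:
  assumes "(K, r) \<in> coloured_rooted_fc d k n \<beta> \<gamma>" shows "set r \<subseteq> \<Union>K"
proof -
  have "rooted_fuss_catalan d n K r" using assms by (simp add: coloured_rooted_fc_def)
  then show ?thesis by (auto simp: rooted_fuss_catalan_def split: if_splits)
qed

text \<open>A tree goes to the class of its model in the universal complex. Rigidity of rooted
  isomorphisms gives injectivity. Every coloured complex is isomorphic to such a model, and
  uniqueness of the colouring transfers the colour counts.\<close>

lemma bij_iso_types:
  defines "S \<equiv> \<lambda>n \<gamma>. coloured_rooted_fc d k n \<beta> \<gamma>"
  shows "\<exists>\<Phi>. bij_betw \<Phi> (tree_class n \<gamma>) (iso_types (S n \<gamma>))"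
proof -
  let ?S = "S n \<gamma>"
  let ?r = "{(X, Y). X \<in> ?S \<and> Y \<in> ?S \<and> rooted_iso X Y}"
  let ?\<Phi> = "\<lambda>T. (tree_complex d T, root_at d [])"
  have eq: "equiv ?S ?r"
  proof (rule equivI)
    show "?r \<subseteq> ?S \<times> ?S" by auto
    show "refl_on ?S ?r" by (auto simp: refl_on_def rooted_iso_refl)
    show "sym ?r"
    proof (rule symI)
      fix X Y assume XY: "(X, Y) \<in> ?r"
      obtain K r where X: "X = (K, r)" by (cases X)
      have "(K, r) \<in> coloured_rooted_fc d k n \<beta> \<gamma>" using XY X unfolding S_def by simp
      then have sub: "set (snd X) \<subseteq> \<Union>(fst X)" using root_in_complex X by simp
      have "rooted_iso X Y" using XY by simp
      then have "rooted_iso Y X" by (rule rooted_iso_sym[OF sub])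
      then show "(Y, X) \<in> ?r" using XY by simp
    qed
    show "trans ?r" by (rule transI) (use rooted_iso_trans in blast)
  qed
  have \<Phi>S: "?\<Phi> T \<in> ?S" if "T \<in> tree_class n \<gamma>" for T using tree_in_coloured[OF that] by (simp add: S_def)
  have inj: "T = T'" if t: "T \<in> tree_class n \<gamma>" "T' \<in> tree_class n \<gamma>" "?r `` {?\<Phi> T} = ?r `` {?\<Phi> T'}" for T T'
  proof -
    have "(?\<Phi> T, ?\<Phi> T') \<in> ?r" using eq_equiv_class[OF t(3) eq \<Phi>S[OF t(2)]] .
    then have "rooted_iso (?\<Phi> T) (?\<Phi> T')" by simp
    moreover have "(?\<Phi> T', ?\<Phi> T) \<in> ?r" using eq_equiv_class[OF t(3)[symmetric] eq \<Phi>S[OF t(1)]] .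
    then have "rooted_iso (?\<Phi> T') (?\<Phi> T)" by simp
    moreover have "dtree d T" "dtree d T'" using t by (auto simp: tree_class_def)
    ultimately show ?thesis using tree_complex_iso_subset by blast
  qed
  have "(\<lambda>T. ?r `` {?\<Phi> T}) ` tree_class n \<gamma> = ?S // ?r"
  proof
    show "(\<lambda>T. ?r `` {?\<Phi> T}) ` tree_class n \<gamma> \<subseteq> ?S // ?r" 
      by (intro image_subsetI quotientI \<Phi>S)
    show "?S // ?r \<subseteq> (\<lambda>T. ?r `` {?\<Phi> T}) ` tree_class n \<gamma>"
    proof
      fix Z assume "Z \<in> ?S // ?r"
      then obtain X where X: "X \<in> ?S" "Z = ?r `` {X}" by (rule quotientE)
      obtain K r where Kr: "X = (K, r)" by (cases X)
      obtain T where T: "T \<in> tree_class n \<gamma>" "rooted_iso (?\<Phi> T) X"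
        using coloured_iso_tree[of K r n \<gamma>] X(1) unfolding S_def Kr by blast
      then have "(?\<Phi> T, X) \<in> ?r" using \<Phi>S X(1) by simp
      then have "?r `` {?\<Phi> T} = ?r `` {X}" by (rule equiv_class_eq[OF eq])
      then have "Z = ?r `` {?\<Phi> T}" unfolding X(2) by (rule sym)
      then show "Z \<in> (\<lambda>T. ?r `` {?\<Phi> T}) ` tree_class n \<gamma>" using T(1) by (rule image_eqI)
    qed
  qed
  then have "bij_betw (\<lambda>T. ?r `` {?\<Phi> T}) (tree_class n \<gamma>) (?S // ?r)"
    unfolding bij_betw_def using inj by (intro conjI inj_onI) blast+
  then show ?thesis unfolding iso_types_def by blast
qed

section \<open>The number of trees with prescribed colours\<close>

lemma colour_count_zero:
  assumes "dtree d T" "k < c" shows "colour_count s0 T c = 0"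
proof -
  have "snd (fc_state s0 q) \<noteq> c" if "q \<in> T" for q
    using col_le[of q "apex q"] tree_words[OF assms(1) that] assms(2) by (auto simp: col_apex facet_at_def)
  then have "{q \<in> T. snd (fc_state s0 q) = c} = {}" by auto
  then show ?thesis by (simp only: colour_count_def card.empty)
qed

lemma card_tree_content:
  assumes "dtree d T" shows "card T = (\<Sum>i\<le>k. colour_count s0 T i)"
proof -
  have fT: "finite T" using assms by (simp add: dtree_def)
  have "snd (fc_state s0 q) \<le> k" if "q \<in> T" for q
    using col_le[of q "apex q"] tree_words[OF assms(1) that] by (auto simp: col_apex facet_at_def)
  then have "T = (\<Union>i\<le>k. {q \<in> T. snd (fc_state s0 q) = i})" by auto
  then have "card T = card (\<Union>i\<le>k. {q \<in> T. snd (fc_state s0 q) = i})" by simp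
  also have "\<dots> = (\<Sum>i\<le>k. colour_count s0 T i)"
    unfolding colour_count_def by (rule card_UN_disjoint) (use fT in auto)
  finally show ?thesis .
qed

text \<open>A tree is a list of length one, so \<open>card_forests\<close> applies. If some
  \<open>\<gamma> i\<close> is too small, no tree exists and a binomial coefficient with negative
  lower index makes the formula 0. For \<open>n = 0\<close> only the empty tree is possible.\<close>

theorem card_tree_class:
  assumes "(\<Sum>i\<le>k. \<gamma> i) = n + d"
  shows "finite (tree_class n \<gamma>) \<and> real (card (tree_class n \<gamma>)) = fc_formula k \<beta> \<gamma> (real n)"
proof (cases "n = 0")
  case True
  have "tree_class n \<gamma> = (if \<gamma> 0 + 1 = \<beta> 0 \<and> (\<forall>j\<in>{1..k}. \<gamma> j = \<beta> j) then {{}} else {})"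
  proof -
    have "T \<in> tree_class n \<gamma> \<longleftrightarrow> T = {} \<and> (\<forall>i\<le>k. \<gamma> i + (if i = 0 then 1 else 0) = \<beta> i)" for T
      using True by (auto simp: tree_class_def dtree_def)
    moreover have "(\<forall>i\<le>k. \<gamma> i + (if i = 0 then 1 else 0) = \<beta> i) \<longleftrightarrow> \<gamma> 0 + 1 = \<beta> 0 \<and> (\<forall>j\<in>{1..k}. \<gamma> j = \<beta> j)"
      (is "?L \<longleftrightarrow> ?R")
    proof
      assume L: ?L
      have "\<gamma> j = \<beta> j" if "j \<in> {1..k}" for j using L[rule_format, of j] that by simp
      then show ?R using L[rule_format, of 0] by simp
    next
      assume R: ?R
      show ?L
      proof (intro allI impI)
        fix i assume "i \<le> k"
        then show "\<gamma> i + (if i = 0 then 1 else 0) = \<beta> i" using R by (cases "i = 0") auto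
      qed
    qed
    ultimately show ?thesis by auto
  qed
  then show ?thesis using True by (simp add: fc_formula_def)
next
  case False
  show ?thesis
  proof (cases "\<forall>i\<le>k. \<beta> i \<le> \<gamma> i + (if i = 0 then 1 else 0)")
    case True
    define m where "m i = (if i \<le> k then \<gamma> i + (if i = 0 then 1 else 0) - \<beta> i else 0)" for i
    have m: "\<gamma> i + (if i = 0 then 1 else 0) = \<beta> i + m i" if "i \<le> k" for i
      using True that by (auto simp: m_def)
    have "(\<Sum>i\<le>k. \<gamma> i + (if i = 0 then 1 else 0)) = (\<Sum>i\<le>k. \<beta> i + m i)" by (rule sum.cong) (use m in auto)
    then have sm: "(\<Sum>i\<le>k. m i) = n" using assms sum_\<beta> by (simp add: sum.distrib sum.delta)
    have mem: "T \<in> tree_class n \<gamma> \<longleftrightarrow> dtree d T \<and> colour_count s0 T = m" for T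
    proof
      assume T: "T \<in> tree_class n \<gamma>"
      then have dT: "dtree d T" by (simp add: tree_class_def)
      have "colour_count s0 T i = m i" for i
        using T m[of i] colour_count_zero[OF dT, of i] by (cases "i \<le> k") (auto simp: tree_class_def m_def)
      then show "dtree d T \<and> colour_count s0 T = m" using dT by auto
    next
      assume T: "dtree d T \<and> colour_count s0 T = m"
      then have "card T = n" using card_tree_content[of T] sm by simp
      then show "T \<in> tree_class n \<gamma>" using T m by (simp add: tree_class_def)
    qed
    have "forests d [s0] m = (\<lambda>T. [T]) ` tree_class n \<gamma>"
    proof
      show "forests d [s0] m \<subseteq> (\<lambda>T. [T]) ` tree_class n \<gamma>"
      proof
        fix Ts assume Ts: "Ts \<in> forests d [s0] m"
        then obtain T where T: "Ts = [T]" by (auto simp: forests_def length_Suc_conv)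
        then have "T \<in> tree_class n \<gamma>" using Ts unfolding mem by (auto simp: forests_def forest_content_def)
        then show "Ts \<in> (\<lambda>T. [T]) ` tree_class n \<gamma>" using T by blast
      qed
      show "(\<lambda>T. [T]) ` tree_class n \<gamma> \<subseteq> forests d [s0] m"
        unfolding mem[THEN Collect_cong, simplified] by (auto simp: mem forests_def forest_content_def)
    qed
    moreover have "inj_on (\<lambda>T. [T]) (tree_class n \<gamma>)" by (simp add: inj_on_def)
    moreover have "finite (forests d [s0] m) \<and> real (card (forests d [s0] m)) = forest_number k b (miss_count [s0]) m"
      by (rule card_forests) (use good_s0 in \<open>auto simp: b_def m_def\<close>)
    ultimately have 1: "finite (tree_class n \<gamma>)" "real (card (tree_class n \<gamma>)) = forest_number k b (miss_count [s0]) m"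
      by (auto simp: card_image finite_image_iff)
    have "miss_count [s0] = (\<lambda>i. if i = 0 then 1 else 0)" by (auto simp: miss_count_def s0_def)
    moreover have "forest_number k b e g = forest_number k \<beta> e g" for e g
    proof -
      have "b i = \<beta> i" if "i \<in> {..k}" for i using that by (simp add: b_def)
      then show ?thesis unfolding forest_number_def Let_def
        by (intro arg_cong2[where f="(-)"] sum.cong prod.cong arg_cong2[where f="(*)"] refl) simp_all
    qed
    ultimately show ?thesis
      using 1 fc_formula_eq_forest_number[where m = m and n = n and k = k and \<gamma> = \<gamma> and \<beta> = \<beta>, OF m sm _ \<beta>0] False by simp
  next
    case not: False
    then obtain i where i: "i \<le> k" "\<gamma> i + (if i = 0 then 1 else 0) < \<beta> i" by (meson not_le)
    have "T \<notin> tree_class n \<gamma>" for T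
    proof
      assume "T \<in> tree_class n \<gamma>"
      then have "\<gamma> i + (if i = 0 then 1 else 0) = \<beta> i + colour_count s0 T i" using i(1) by (simp add: tree_class_def)
      then show False using i(2) by simp
    qed
    then have "tree_class n \<gamma> = {}" by auto
    moreover have "fc_formula k \<beta> \<gamma> (real n) = 0"
    proof (cases "i = 0")
      case True
      then have "int (\<gamma> 0) - int (\<beta> 0) + 1 < 0" using i(2) by simp
      then show ?thesis using False by (simp add: fc_formula_def int_binom_def)
    next
      case ne: False
      then have "fc_factor (real n) (\<beta> i) (\<gamma> i) = 0" using i(2) by (simp add: fc_factor_def int_binom_def)
      then have "(\<Prod>j=1..k. fc_factor (real n) (\<beta> j) (\<gamma> j)) = 0"
        using ne i(1) by (intro prod_zero) auto
      then show ?thesis using False by (simp add: fc_formula_def)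
    qed
    ultimately show ?thesis by simp
  qed
qed

end

theorem theorem4:
  fixes d k n :: nat and \<beta> \<gamma> :: "nat \<Rightarrow> nat" and s :: real
  assumes "d \<ge> 2"
    and "\<beta> 0 \<ge> 1"
    and "(\<Sum>i\<le>k. \<beta> i) = d + 1"
    and "(\<Sum>i\<le>k. \<gamma> i) = n + d"
    and "s = - real d + (\<Sum>j\<le>k. real (\<gamma> j))"
  shows "finite (iso_types (coloured_rooted_fc d k n \<beta> \<gamma>)) \<and>
         real (card (iso_types (coloured_rooted_fc d k n \<beta> \<gamma>))) = fc_formula k \<beta> \<gamma> s"
proof -
  interpret coloured_trees d k \<beta> by standard (use assms in auto)
  have "(\<Sum>j\<le>k. real (\<gamma> j)) = real (n + d)" using assms(4) by (simp flip: of_nat_sum)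
  then have s: "s = real n" using assms(5) by simp
  obtain \<Phi> where "bij_betw \<Phi> (tree_class n \<gamma>) (iso_types (coloured_rooted_fc d k n \<beta> \<gamma>))"
    using bij_iso_types by blast
  then show ?thesis
    unfolding s using card_tree_class[OF assms(4)] bij_betw_finite bij_betw_same_card by metis
qed

end
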